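(* Let $L$ be a finite-dimensional (right) Leibniz algebra over a field of characteristic zero. (i) If $L$ is $\phi$-free, then $L$ is almost reductive (and so almost algebraic). (ii) Suppose $L$ is almost reductive. Then $L$ is $\phi$-free if and only if its nilradical is abelian.
   Context: A (right) Leibniz algebra over a field $F$ is an $F$-vector space with a bilinear product $[\cdot,\cdot]$ satisfying $[x,[y,z]]=[[x,y],z]-[[x,z],y]$ for all $x,y,z$. The Leibniz kernel of $L$ is $I=\mathrm{span}\{x^2: x\in L\}$ with $x^2=[x,x]$; it is an ideal and $L/I$ is a Lie algebra. With $L^1=L$, $L^{k+1}=[L^k,L]$, $L$ is nilpotent if $L^n=0$ for some $n$; the nilradical $N(L)$ is the largest nilpotent ideal of $L$. An algebra $M$ is abelian if $[M,M]=0$. The Frattini ideal $\phi(L)$ is the largest ideal of $L$ contained in all maximal subalgebras of $L$; $L$ is $\phi$-free if $\phi(L)=0$. Almost reductive: $L$ is almost reductive if $L=N(L)\dot{+}\Sigma$ (vector space direct sum) where $\Sigma$ is a subalgebra of $L$ that is a Lie algebra and $N(L)$ is a completely reducible $\Sigma$-bimodule, i.e. $N(L)$ is a direct sum of subspaces $A$ with $[A,\Sigma]\subseteq A$, $[\Sigma,A]\subseteq A$, each irreducible with respect to these left and right actions. Almost algebraic: a linear Lie algebra $\mathfrak g\leq \mathrm{gl}(V)$ is almost algebraic if it contains the semisimple and nilpotent Jordan components of each of its elements; an abstract Lie algebra $\mathfrak g$ is almost algebraic if $\mathrm{ad}\,\mathfrak g\leq \mathrm{gl}(\mathfrak g)$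 is almost algebraic; a Leibniz algebra $L$ is almost algebraic if the Lie algebra $L/I$ is almost algebraic. *)

theory Defs
  imports Complex_Main "HOL-Library.FuncSet"
begin

section \<open>Algebras on a carrier set, and almost algebraic Lie algebras\<close>

text \<open>The quotient of a Leibniz algebra by its Leibniz kernel lives on a set of cosets, so the
  notions that are applied to it are stated for vector spaces with a product whose carrier is a set.\<close>

record ('f, 'v) alg_on =
  carr :: "'v set"
  vadd :: "'v \<Rightarrow> 'v \<Rightarrow> 'v"
  vzero :: "'v"
  vscale :: "'f \<Rightarrow> 'v \<Rightarrow> 'v"
  vprod :: "'v \<Rightarrow> 'v \<Rightarrow> 'v"

definition subspace_on :: "('f, 'v, 'm) alg_on_scheme \<Rightarrow> 'v set \<Rightarrow> bool" where
  "subspace_on V W \<longleftrightarrow> W \<subseteq> carr V \<and> vzero V \<in> W \<and>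
     (\<forall>x\<in>W. \<forall>y\<in>W. vadd V x y \<in> W) \<and> (\<forall>c. \<forall>x\<in>W. vscale V c x \<in> W)"

text \<open>Endomorphisms are extensional functions (\<^term>\<open>undefined\<close> off the carrier), so that two of them
  are equal as soon as they agree on the carrier.\<close>

definition endos :: "('f, 'v, 'm) alg_on_scheme \<Rightarrow> ('v \<Rightarrow> 'v) set" where
  "endos V = {T \<in> carr V \<rightarrow>\<^sub>E carr V.
     (\<forall>x\<in>carr V. \<forall>y\<in>carr V. T (vadd V x y) = vadd V (T x) (T y)) \<and>
     (\<forall>c. \<forall>x\<in>carr V. T (vscale V c x) = vscale V c (T x))}"

text \<open>Over a perfect field, in particular in characteristic zero, an endomorphism of a
  finite-dimensional space is semisimple in this sense iff it is diagonalizable over the algebraic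
  closure.\<close>

definition semisimple_endo :: "('f, 'v, 'm) alg_on_scheme \<Rightarrow> ('v \<Rightarrow> 'v) \<Rightarrow> bool" where
  "semisimple_endo V T \<longleftrightarrow> T \<in> endos V \<and>
     (\<forall>W. subspace_on V W \<and> T ` W \<subseteq> W \<longrightarrow>
        (\<exists>W'. subspace_on V W' \<and> T ` W' \<subseteq> W' \<and> W \<inter> W' = {vzero V} \<and>
              carr V = {vadd V w w' | w w'. w \<in> W \<and> w' \<in> W'}))"

definition nilpotent_endo :: "('f, 'v, 'm) alg_on_scheme \<Rightarrow> ('v \<Rightarrow> 'v) \<Rightarrow> bool" where
  "nilpotent_endo V T \<longleftrightarrow> T \<in> endos V \<and> (\<exists>n. \<forall>x\<in>carr V. (T ^^ n) x = vzero V)"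

definition jordan_components ::
    "('f, 'v, 'm) alg_on_scheme \<Rightarrow> ('v \<Rightarrow> 'v) \<Rightarrow> ('v \<Rightarrow> 'v) \<Rightarrow> ('v \<Rightarrow> 'v) \<Rightarrow> bool" where
  "jordan_components V T S N \<longleftrightarrow> semisimple_endo V S \<and> nilpotent_endo V N \<and>
     (\<forall>x\<in>carr V. T x = vadd V (S x) (N x)) \<and> (\<forall>x\<in>carr V. S (N x) = N (S x))"

text \<open>In characteristic zero the components of an endomorphism of a finite-dimensional space exist
  and are unique.\<close>

definition almost_algebraic_linear :: "('f, 'v, 'm) alg_on_scheme \<Rightarrow> ('v \<Rightarrow> 'v) set \<Rightarrow> bool" where
  "almost_algebraic_linear V g \<longleftrightarrow> (\<forall>T\<in>g. \<exists>S\<in>g. \<exists>N\<in>g. jordan_components V T S N)"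

definition ad_on :: "('f, 'v, 'm) alg_on_scheme \<Rightarrow> 'v \<Rightarrow> 'v \<Rightarrow> 'v" where
  "ad_on V x = (\<lambda>y\<in>carr V. vprod V x y)"

definition almost_algebraic_lie :: "('f, 'v, 'm) alg_on_scheme \<Rightarrow> bool" where
  "almost_algebraic_lie V \<longleftrightarrow> almost_algebraic_linear V (ad_on V ` carr V)"


section \<open>Leibniz algebras\<close>

locale leibniz_algebra = vector_space scale
  for scale :: "'f::field \<Rightarrow> 'a::ab_group_add \<Rightarrow> 'a" +
  fixes br :: "'a \<Rightarrow> 'a \<Rightarrow> 'a"
  assumes linear_br_left: "Vector_Spaces.linear scale scale (\<lambda>x. br x y)"
    and linear_br_right: "Vector_Spaces.linear scale scale (\<lambda>y. br x y)"
    and leibniz: "br x (br y z) = br (br x y) z - br (br x z) y"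
begin

definition br_span :: "'a set \<Rightarrow> 'a set \<Rightarrow> 'a set" where
  "br_span A B = span {br a b | a b. a \<in> A \<and> b \<in> B}"

definition subalgebra :: "'a set \<Rightarrow> bool" where
  "subalgebra A \<longleftrightarrow> subspace A \<and> (\<forall>x\<in>A. \<forall>y\<in>A. br x y \<in> A)"

definition lie_subalgebra :: "'a set \<Rightarrow> bool" where
  "lie_subalgebra A \<longleftrightarrow> subalgebra A \<and> (\<forall>x\<in>A. br x x = 0) \<and>
     (\<forall>x\<in>A. \<forall>y\<in>A. \<forall>z\<in>A. br x (br y z) + br y (br z x) + br z (br x y) = 0)"

definition ideal :: "'a set \<Rightarrow> bool" where
  "ideal J \<longleftrightarrow> subspace J \<and> (\<forall>x\<in>J. \<forall>y. br x y \<in> J \<and> br y x \<in> J)"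

definition leibniz_kernel :: "'a set" where
  "leibniz_kernel = span (range (\<lambda>x. br x x))"

definition abelian :: "'a set \<Rightarrow> bool" where
  "abelian A \<longleftrightarrow> br_span A A = {0}"

text \<open>The lower central series is indexed from 0 here: \<open>lower_central A k\<close> is \<open>A\<^sup>k\<^sup>+\<^sup>1\<close>.\<close>

primrec lower_central :: "'a set \<Rightarrow> nat \<Rightarrow> 'a set" where
  "lower_central A 0 = A"
| "lower_central A (Suc k) = br_span (lower_central A k) A"

definition nilpotent :: "'a set \<Rightarrow> bool" where
  "nilpotent A \<longleftrightarrow> (\<exists>k. lower_central A k = {0})"

definition nilradical :: "'a set" where
  "nilradical = (GREATEST J. ideal J \<and> nilpotent J)"

definition maximal_subalgebra :: "'a set \<Rightarrow> bool" where
  "maximal_subalgebra M \<longleftrightarrow> subalgebra M \<and> M \<noteq> UNIV \<and>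
     (\<forall>K. subalgebra K \<and> M \<subseteq> K \<longrightarrow> K = M \<or> K = UNIV)"

definition frattini_ideal :: "'a set" where
  "frattini_ideal = (GREATEST J. ideal J \<and> (\<forall>M. maximal_subalgebra M \<longrightarrow> J \<subseteq> M))"

definition phi_free :: bool where
  "phi_free \<longleftrightarrow> frattini_ideal = {0}"

definition subbimodule :: "'a set \<Rightarrow> 'a set \<Rightarrow> bool" where
  "subbimodule S A \<longleftrightarrow> subspace A \<and> (\<forall>a\<in>A. \<forall>s\<in>S. br a s \<in> A \<and> br s a \<in> A)"

definition irreducible_subbimodule :: "'a set \<Rightarrow> 'a set \<Rightarrow> bool" where
  "irreducible_subbimodule S A \<longleftrightarrow> subbimodule S A \<and> A \<noteq> {0} \<and>
     (\<forall>B. subbimodule S B \<and> B \<subseteq> A \<longrightarrow> B = {0} \<or> B = A)"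

text \<open>Internal direct sum. Indexing by a set of subspaces loses nothing, since a nonzero
  subspace cannot occur twice in a direct sum.\<close>

definition direct_sum_of :: "'a set set \<Rightarrow> 'a set \<Rightarrow> bool" where
  "direct_sum_of \<A> N \<longleftrightarrow> N = span (\<Union>\<A>) \<and> (\<forall>A\<in>\<A>. A \<inter> span (\<Union>(\<A> - {A})) = {0})"

definition completely_reducible :: "'a set \<Rightarrow> 'a set \<Rightarrow> bool" where
  "completely_reducible S N \<longleftrightarrow>
     (\<exists>\<A>. (\<forall>A\<in>\<A>. irreducible_subbimodule S A) \<and> direct_sum_of \<A> N)"

definition almost_reductive :: bool where
  "almost_reductive \<longleftrightarrow> (\<exists>S. lie_subalgebra S \<and>
     nilradical \<inter> S = {0} \<and> {n + s | n s. n \<in> nilradical \<and> s \<in> S} = UNIV \<and>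
     completely_reducible S nilradical)"

definition kernel_coset :: "'a \<Rightarrow> 'a set" where
  "kernel_coset x = {x + i | i. i \<in> leibniz_kernel}"

text \<open>The quotient by the Leibniz kernel. Scalar multiples and products of representatives are
  saturated by adding the kernel, as e.g. \<open>{0 \<cdot> a | a \<in> A} = {0}\<close> need not be a coset.\<close>

definition lie_quotient :: "('f, 'a set) alg_on" where
  "lie_quotient =
    \<lparr> carr = range kernel_coset,
      vadd = (\<lambda>A B. {a + b | a b. a \<in> A \<and> b \<in> B}),
      vzero = leibniz_kernel,
      vscale = (\<lambda>c A. {scale c a + i | a i. a \<in> A \<and> i \<in> leibniz_kernel}),
      vprod = (\<lambda>A B. {br a b + i | a b i. a \<in> A \<and> b \<in> B \<and> i \<in> leibniz_kernel}) \<rparr>"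

definition almost_algebraic :: bool where
  "almost_algebraic \<longleftrightarrow> almost_algebraic_lie lie_quotient"

lemma br_simps:
  "br (x + y) z = br x z + br y z" "br x (y + z) = br x y + br x z"
  "br (scale c x) z = scale c (br x z)" "br x (scale c z) = scale c (br x z)"
  "br 0 x = 0" "br x 0 = 0"
proof -
  interpret l: Vector_Spaces.linear scale scale "\<lambda>x. br x y" for y by (rule linear_br_left)
  interpret r: Vector_Spaces.linear scale scale "\<lambda>y. br x y" for x by (rule linear_br_right)
  show "br (x + y) z = br x z + br y z" "br x (y + z) = br x y + br x z"
    "br (scale c x) z = scale c (br x z)" "br x (scale c z) = scale c (br x z)"
    "br 0 x = 0" "br x 0 = 0"
    by (rule l.add r.add l.scale r.scale l.zero r.zero)+
qed

lemma subspace_leibniz_kernel: "subspace leibniz_kernel"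
  by (simp add: leibniz_kernel_def)

lemma br_leibniz_kernel_right:
  assumes "i \<in> leibniz_kernel" shows "br x i = 0"
  using assms unfolding leibniz_kernel_def
proof (induction rule: span_induct_alt)
  case (step c y z)
  then show ?case by (auto simp: br_simps leibniz)
qed (simp add: br_simps)

lemma br_leibniz_kernel_left:
  assumes "i \<in> leibniz_kernel" shows "br i x \<in> leibniz_kernel"
proof -
  have sq: "br y y \<in> leibniz_kernel" for y
    unfolding leibniz_kernel_def by (rule span_base) blast
  have "br (i + x) (i + x) - br i i - br x x = br i x + br x i"
    by (simp add: br_simps)
  moreover have "br (i + x) (i + x) - br i i - br x x \<in> leibniz_kernel"
    by (intro subspace_diff subspace_leibniz_kernel sq)
  ultimately show ?thesis using br_leibniz_kernel_right[OF assms] by simp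
qed

lemma ideal_leibniz_kernel: "ideal leibniz_kernel"
  unfolding ideal_def
  using subspace_leibniz_kernel br_leibniz_kernel_left br_leibniz_kernel_right
  by (auto simp: subspace_0)

lemma lie_quotient_simps:
  "carr lie_quotient = range kernel_coset"
  "vzero lie_quotient = kernel_coset 0"
  "vadd lie_quotient (kernel_coset x) (kernel_coset y) = kernel_coset (x + y)"
  "vscale lie_quotient c (kernel_coset x) = kernel_coset (scale c x)"
  "vprod lie_quotient (kernel_coset x) (kernel_coset y) = kernel_coset (br x y)"
proof -
  note S = subspace_leibniz_kernel
  have add: "i + j \<in> leibniz_kernel" if "i \<in> leibniz_kernel" "j \<in> leibniz_kernel" for i j
    using that by (rule subspace_add[OF S])
  have 0: "0 \<in> leibniz_kernel" using S by (rule subspace_0)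
  show "carr lie_quotient = range kernel_coset" by (simp add: lie_quotient_def)
  show "vzero lie_quotient = kernel_coset 0" by (simp add: lie_quotient_def kernel_coset_def)
  show "vadd lie_quotient (kernel_coset x) (kernel_coset y) = kernel_coset (x + y)" (is "?L = ?R")
  proof
    show "?L \<subseteq> ?R"
    proof
      fix u assume "u \<in> ?L"
      then obtain i j where "u = (x + i) + (y + j)" "i \<in> leibniz_kernel" "j \<in> leibniz_kernel"
        by (auto simp: lie_quotient_def kernel_coset_def)
      then have "u = (x + y) + (i + j)" "i + j \<in> leibniz_kernel"
        by (auto simp: algebra_simps add)
      then show "u \<in> ?R" unfolding kernel_coset_def by blast
    qed
    show "?R \<subseteq> ?L"
    proof
      fix u assume "u \<in> ?R"
      then obtain i where "u = (x + i) + (y + 0)" "i \<in> leibniz_kernel"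
        by (auto simp: kernel_coset_def algebra_simps)
      then show "u \<in> ?L" using 0 unfolding lie_quotient_def kernel_coset_def by fastforce
    qed
  qed
  show "vscale lie_quotient c (kernel_coset x) = kernel_coset (scale c x)" (is "?L = ?R")
  proof
    show "?L \<subseteq> ?R"
    proof
      fix u assume "u \<in> ?L"
      then obtain i j where "u = scale c (x + i) + j" "i \<in> leibniz_kernel" "j \<in> leibniz_kernel"
        by (auto simp: lie_quotient_def kernel_coset_def)
      then have "u = scale c x + (scale c i + j)" "scale c i + j \<in> leibniz_kernel"
        by (auto simp: scale_right_distrib algebra_simps intro: add subspace_scale[OF S])
      then show "u \<in> ?R" unfolding kernel_coset_def by blast
    qed
    show "?R \<subseteq> ?L"
    proof
      fix u assume "u \<in> ?R"
      then obtain i where "u = scale c (x + 0) + i" "i \<in> leibniz_kernel"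
        by (auto simp: kernel_coset_def)
      then show "u \<in> ?L" using 0 unfolding lie_quotient_def kernel_coset_def by fastforce
    qed
  qed
  show "vprod lie_quotient (kernel_coset x) (kernel_coset y) = kernel_coset (br x y)" (is "?L = ?R")
  proof
    show "?L \<subseteq> ?R"
    proof
      fix u assume "u \<in> ?L"
      then obtain i j k where u: "u = br (x + i) (y + j) + k"
        and ijk: "i \<in> leibniz_kernel" "j \<in> leibniz_kernel" "k \<in> leibniz_kernel"
        by (auto simp: lie_quotient_def kernel_coset_def)
      have "u = br x y + (br i y + k)"
        using u ijk by (simp add: br_simps br_leibniz_kernel_right algebra_simps)
      moreover have "br i y + k \<in> leibniz_kernel"
        using ijk by (intro add br_leibniz_kernel_left)
      ultimately show "u \<in> ?R" unfolding kernel_coset_def by blast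
    qed
    show "?R \<subseteq> ?L"
    proof
      fix u assume "u \<in> ?R"
      then obtain i where "u = br (x + 0) (y + 0) + i" "i \<in> leibniz_kernel"
        by (auto simp: kernel_coset_def)
      then show "u \<in> ?L" using 0 unfolding lie_quotient_def kernel_coset_def by fastforce
    qed
  qed
qed

lemma frattini_ideal_eq:
  "frattini_ideal = span (\<Union>{J. ideal J \<and> (\<forall>M. maximal_subalgebra M \<longrightarrow> J \<subseteq> M)})"
    (is "_ = span (\<Union>?F)")
proof -
  have mult: "br x y \<in> span (\<Union>?F) \<and> br y x \<in> span (\<Union>?F)" if "x \<in> span (\<Union>?F)" for x y
    using that
  proof (induction rule: span_induct_alt)
    case (step c u v)
    then obtain J where J: "J \<in> ?F" "u \<in> J" by blast
    then have "br u y \<in> J" "br y u \<in> J" unfolding ideal_def by blast+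
    with J(1) have "br u y \<in> span (\<Union>?F)" "br y u \<in> span (\<Union>?F)"
      by (meson UnionI span_base)+
    then show ?case using step by (simp add: br_simps span_add span_scale)
  qed (simp add: br_simps span_zero)
  have "ideal (span (\<Union>?F))" using mult by (simp add: ideal_def)
  moreover have "span (\<Union>?F) \<subseteq> M" if "maximal_subalgebra M" for M
    using that by (intro span_minimal) (auto simp: maximal_subalgebra_def subalgebra_def)
  ultimately show ?thesis
    unfolding frattini_ideal_def by (intro Greatest_equality) (auto intro: span_base)
qed

end

end

theory Submission
  imports Defs "HOL-Computational_Algebra.Polynomial" "HOL-Algebra.Algebraic_Closure_Type"
    "HOL-Library.Function_Algebras"
begin

text \<open>Write \<open>N\<close> for the nilradical. Its derived algebra lies in every maximal subalgebra, so \<open>N\<close> is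
  abelian if \<open>L\<close> is \<open>\<phi>\<close>-free, and then every ideal inside \<open>N\<close> is complemented by a subalgebra; this
  yields \<open>L = N + S\<close> with \<open>N\<close> completely reducible. Conversely, if \<open>N\<close> is abelian and completely
  reducible, the maximal subalgebras through \<open>S\<close> force the Frattini ideal into \<open>S\<close>, and as it acts
  nilpotently its centre would be an abelian ideal, hence part of \<open>N\<close>.

  For almost algebraicity, right multiplications are derivations of \<open>L\<close>, and the semisimple part of a
  derivation is a derivation. Traces of powers show that abelian ideals of \<open>S\<close> are central and that
  central elements of \<open>S\<close> do not lie in \<open>[S, S]\<close>, and Cartan's criterion, proved by passing to
  eigenvalues in the algebraic closure, makes the trace form nondegenerate on \<open>[S, S]\<close>. Hence the
  semisimple part of the right multiplication by an element of \<open>S\<close> is again the right multiplication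
  by an element of \<open>S\<close>; a general element is brought close to \<open>S\<close> by an automorphism
  \<open>v \<mapsto> v + [v, b]\<close> with \<open>b \<in> N\<close>.\<close>

section \<open>Linear operators\<close>

text \<open>Eigenvalues may lie outside the base field. Semisimplicity of an operator is therefore
  carried as a certificate: a polynomial \<open>f\<close> killing it, together with an identity
  \<open>u * pderiv f + w * f = 1\<close>. This survives conjugation and the passage to the
  algebraic closure. \<open>L\<close> itself is never extended: matrix coefficients are regarded as
  functions with values in the closure, and operators act on such functions by precomposition. The
  product is not antisymmetric, and only right multiplications are derivations in general. The left
  action of \<open>S\<close> on \<open>N\<close> is recovered from the splitting of \<open>N\<close>
  into the Leibniz kernel and a complementary ideal; in \<open>L/I\<close> the adjoint map is the
  negative of right multiplication. The reductive structure of \<open>S\<close> is extracted from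
  traces of operators on \<open>L\<close>. Characteristic zero enters because an idempotent of trace
  zero vanishes, because a nonconstant polynomial has a nonzero derivative, and because the closure
  is a rational vector space, which leads to sums of rational squares.\<close>

locale endo_space = vector_space scale
  for scale :: "'k::field \<Rightarrow> 'v::ab_group_add \<Rightarrow> 'v"
begin

abbreviation lin :: "('v \<Rightarrow> 'v) \<Rightarrow> bool" where
  "lin \<equiv> Vector_Spaces.linear scale scale"

lemma linI:
  assumes "\<And>x y. T (x + y) = T x + T y" and "\<And>c x. T (scale c x) = scale c (T x)"
  shows "lin T"
  using assms by unfold_locales auto

lemma lin_simps:
  assumes "lin T"
  shows "T (x + y) = T x + T y" "T (scale c x) = scale c (T x)" "T 0 = 0"
    "T (- x) = - T x" "T (x - y) = T x - T y" "T (sum g A) = (\<Sum>a\<in>A. T (g a))"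
proof -
  interpret Vector_Spaces.linear scale scale T by (rule assms)
  show "T (x + y) = T x + T y" "T (scale c x) = scale c (T x)" "T 0 = 0"
    "T (- x) = - T x" "T (x - y) = T x - T y" "T (sum g A) = (\<Sum>a\<in>A. T (g a))"
    by (rule add scale zero neg diff sum)+
qed

lemma lin_compose: "lin S \<Longrightarrow> lin T \<Longrightarrow> lin (\<lambda>v. S (T v))"
  by (rule linI) (simp_all add: lin_simps)

lemma lin_add: "lin S \<Longrightarrow> lin T \<Longrightarrow> lin (\<lambda>v. S v + T v)"
  by (rule linI) (simp_all add: lin_simps algebra_simps scale_right_distrib)

lemma lin_diff: "lin S \<Longrightarrow> lin T \<Longrightarrow> lin (\<lambda>v. S v - T v)"
  by (rule linI) (simp_all add: lin_simps algebra_simps scale_right_diff_distrib)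

lemma lin_uminus: "lin S \<Longrightarrow> lin (\<lambda>v. - S v)"
  by (rule linI) (simp_all add: lin_simps)

lemma lin_scale: "lin S \<Longrightarrow> lin (\<lambda>v. scale c (S v))"
  by (rule linI) (simp_all add: lin_simps scale_right_distrib scale_left_commute)

lemma lin_id: "lin (\<lambda>v. v)" and lin_zero: "lin (\<lambda>v. 0)"
  by (rule linI; simp)+

lemma lin_funpow: "lin T \<Longrightarrow> lin (T ^^ k)"
  by (induction k) (auto simp: lin_compose lin_id id_def comp_def)

lemma lin_sum: "(\<And>i. i \<in> A \<Longrightarrow> lin (g i)) \<Longrightarrow> lin (\<lambda>v. \<Sum>i\<in>A. g i v)"
  by (rule linI) (simp_all add: lin_simps sum.distrib scale_sum_right)

lemma lin_funpow_commute:
  assumes "\<And>v. A (T v) = T (A v)"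
  shows "A ((T ^^ k) v) = (T ^^ k) (A v)"
  by (induction k) (simp_all add: assms)

lemma subspace_ker: "lin T \<Longrightarrow> subspace {v. T v = 0}"
  by (auto simp: subspace_def lin_simps)

lemma subspace_vimage: "lin T \<Longrightarrow> subspace W \<Longrightarrow> subspace {v. T v \<in> W}"
  by (auto simp: subspace_def lin_simps)

lemma subspace_image: "lin T \<Longrightarrow> subspace W \<Longrightarrow> subspace (T ` W)"
  unfolding subspace_def
proof (intro conjI allI ballI)
  fix c x y
  assume T: "lin T" and W: "0 \<in> W \<and> (\<forall>x\<in>W. \<forall>y\<in>W. x + y \<in> W) \<and> (\<forall>c. \<forall>x\<in>W. scale c x \<in> W)"
  show "0 \<in> T ` W" using W lin_simps(3)[OF T] by force
  show "scale c x \<in> T ` W" if "x \<in> T ` W"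
    using that W lin_simps(2)[OF T, symmetric] by auto
  show "x + y \<in> T ` W" if "x \<in> T ` W" "y \<in> T ` W"
    using that W lin_simps(1)[OF T, symmetric] by auto
qed

lemma ex_projection:
  assumes W: "subspace W"
  obtains p where "lin p" "\<And>v. p v \<in> W" "\<And>w. w \<in> W \<Longrightarrow> p w = w"
proof -
  interpret vector_space_pair scale scale ..
  obtain B where B: "B \<subseteq> W" "independent B" "W \<subseteq> span B"
    using maximal_independent_subset[of W] by metis
  obtain p where p: "lin p" "\<And>x. x \<in> B \<Longrightarrow> p x = x" "range p = span (id ` B)"
    using linear_independent_extend_subspace[OF B(2), of id] by auto
  have *: "span B = W" using B W by (metis span_subspace)
  have "p w = w" if "w \<in> W" for w
    using linear_eq_on[OF p(1) lin_id, of w B] p(2) that * by auto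
  with p * that[of p] show thesis by auto
qed

section \<open>Polynomials in a linear operator\<close>

definition pol :: "'k poly \<Rightarrow> ('v \<Rightarrow> 'v) \<Rightarrow> 'v \<Rightarrow> 'v" where
  "pol p T v = (\<Sum>i\<le>degree p. scale (coeff p i) ((T ^^ i) v))"

lemma pol_altdef: "degree p \<le> n \<Longrightarrow> pol p T v = (\<Sum>i\<le>n. scale (coeff p i) ((T ^^ i) v))"
  unfolding pol_def by (rule sum.mono_neutral_left) (auto simp: coeff_eq_0)

lemma pol_0 [simp]: "pol 0 T v = 0"
  by (simp add: pol_def)

lemma pol_pCons:
  assumes "lin T"
  shows "pol (pCons a p) T v = scale a v + T (pol p T v)"
proof -
  have "pol (pCons a p) T v =
      (\<Sum>i\<le>Suc (degree p). scale (coeff (pCons a p) i) ((T ^^ i) v))"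
    by (rule pol_altdef) (simp add: degree_pCons_le)
  also have "\<dots> = scale a v + (\<Sum>i\<le>degree p. scale (coeff p i) (T ((T ^^ i) v)))"
    by (subst sum.atMost_Suc_shift) simp
  finally show ?thesis
    by (simp add: pol_def lin_simps[OF assms])
qed

lemma lin_pol: "lin T \<Longrightarrow> lin (pol p T)"
  unfolding pol_def by (intro lin_sum lin_scale lin_funpow)

lemma pol_add: "lin T \<Longrightarrow> pol (p + q) T v = pol p T v + pol q T v"
  by (induction p q rule: poly_induct2) (simp_all add: pol_pCons lin_simps scale_left_distrib)

lemma pol_smult: "lin T \<Longrightarrow> pol (smult c p) T v = scale c (pol p T v)"
  by (induction p) (simp_all add: pol_pCons lin_simps scale_right_distrib)

lemma pol_diff: "lin T \<Longrightarrow> pol (p - q) T v = pol p T v - pol q T v"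
  using pol_add[of T p "- q" v] pol_smult[of T "- 1" q v] by simp

lemma pol_sum: "lin T \<Longrightarrow> pol (sum g A) T v = (\<Sum>i\<in>A. pol (g i) T v)"
  by (induction A rule: infinite_finite_induct) (simp_all add: pol_add)

lemma pol_commute:
  assumes "lin T" "lin A" "\<And>v. A (T v) = T (A v)"
  shows "A (pol p T v) = pol p T (A v)"
  by (induction p) (simp_all add: pol_pCons lin_simps assms)

lemma pol_mult: "lin T \<Longrightarrow> pol (p * q) T v = pol p T (pol q T v)"
  by (induction p) (simp_all add: pol_pCons pol_add pol_smult lin_simps)

lemma pol_1 [simp]: "pol 1 T v = v"
  by (simp add: pol_def)

lemma pol_X [simp]: "pol [:0, 1:] T v = T v"
  by (simp add: pol_def)

lemma pol_power: "lin T \<Longrightarrow> pol (p ^ k) T v = (pol p T ^^ k) v"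
  by (induction k arbitrary: v) (simp_all add: pol_mult)

lemma pol_X_power: "lin T \<Longrightarrow> pol ([:0, 1:] ^ k) T v = (T ^^ k) v"
proof -
  have "pol [:0, 1:] T = T" by auto
  then show "lin T \<Longrightarrow> ?thesis" by (simp add: pol_power)
qed

lemma pol_pcompose: "lin T \<Longrightarrow> pol (pcompose p q) T v = pol p (pol q T) v"
  by (induction p) (simp_all add: pol_pCons pcompose_pCons pol_add pol_mult lin_pol lin_simps)

lemma pol_eigen: "lin T \<Longrightarrow> T v = scale c v \<Longrightarrow> pol p T v = scale (poly p c) v"
  by (induction p) (simp_all add: pol_pCons lin_simps scale_left_distrib mult.commute)

lemma pol_in_subspace:
  assumes "lin T" "subspace W" "\<And>w. w \<in> W \<Longrightarrow> T w \<in> W" "v \<in> W"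
  shows "pol p T v \<in> W"
  by (induction p) (use assms in \<open>auto simp: pol_pCons subspace_0 intro!: subspace_add subspace_scale\<close>)

lemma pol_dvd: "lin T \<Longrightarrow> p dvd q \<Longrightarrow> pol p T v = 0 \<Longrightarrow> pol q T v = 0"
  by (metis dvdE mult.commute pol_mult lin_pol lin_simps(3))

text \<open>Applying the sum once gives \<open>A v + B v\<close>; in \<open>A v\<close> the exponent
  of \<open>A\<close> has dropped by one, in \<open>B v\<close> that of \<open>B\<close>, and
  commutation keeps the other exponent. Both exponents belong to the one vector \<open>v\<close>, so
  operators that are nilpotent only at that vector are covered.\<close>

lemma nilpotent_add:
  assumes A: "lin A" and B: "lin B" and AB: "\<And>v. A (B v) = B (A v)"
    and "(A ^^ k) v = 0" "(B ^^ l) v = 0"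
  shows "((\<lambda>x. A x + B x) ^^ (k + l)) v = 0"
  using assms(4,5)
proof (induction "k + l" arbitrary: k l v)
  case 0
  then show ?case by simp
next
  case (Suc n)
  let ?C = "\<lambda>x. A x + B x"
  have C: "lin (?C ^^ m)" for m by (intro lin_funpow lin_add A B)
  show ?case
  proof (cases "k = 0 \<or> l = 0")
    case True
    then have "v = 0" using Suc.prems by auto
    then show ?thesis using C by (simp add: lin_simps)
  next
    case False
    then obtain k' l' where kl: "k = Suc k'" "l = Suc l'" by (meson not0_implies_Suc)
    have "(A ^^ k') (A v) = 0" "(B ^^ l) (A v) = 0" "(A ^^ k) (B v) = 0" "(B ^^ l') (B v) = 0"
      using Suc.prems lin_funpow_commute[of A B l v] lin_funpow_commute[of B A k v] AB
      by (simp_all add: kl funpow_swap1 lin_simps A B)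
    then have "(?C ^^ (k' + l)) (A v) = 0" "(?C ^^ (k + l')) (B v) = 0"
      using Suc.hyps(1)[of k' l "A v"] Suc.hyps(1)[of k l' "B v"] Suc.hyps(2) kl by auto
    then have "(?C ^^ n) (A v) = 0" "(?C ^^ n) (B v) = 0"
      using Suc.hyps(2) kl by auto
    then have "(?C ^^ n) (A v + B v) = 0" by (simp only: lin_simps(1)[OF C]) simp
    then show ?thesis unfolding Suc.hyps(2)[symmetric] funpow_Suc_right comp_apply .
  qed
qed

end

section \<open>Polynomials over a field\<close>

lemma poly_bezout:
  fixes p q :: "'k::field poly"
  assumes "coprime p q" and "p \<noteq> 0"
  obtains a b where "a * p + b * q = 1"
proof -
  define P where "P d \<longleftrightarrow> d \<noteq> 0 \<and> (\<exists>a b. d = a * p + b * q)" for d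
  have "p = 1 * p + 0 * q" by simp
  then have "P p" using assms(2) unfolding P_def by blast
  then obtain d where d: "P d" "\<And>e. P e \<Longrightarrow> degree d \<le> degree e"
    using ex_has_least_nat[of P p degree] by blast
  have dvd: "d dvd r" if r: "r = a * p + b * q" for r a b
  proof (rule ccontr)
    assume nd: "\<not> d dvd r"
    obtain a' b' where ab: "d = a' * p + b' * q" using d(1) unfolding P_def by blast
    define e where "e = r div d"
    have "r mod d = r - e * d" unfolding e_def by (rule minus_div_mult_eq_mod[symmetric])
    also have "\<dots> = (a - e * a') * p + (b - e * b') * q"
      by (subst ab, subst r) (simp add: algebra_simps)
    finally have "r mod d = (a - e * a') * p + (b - e * b') * q" .
    moreover have nz: "r mod d \<noteq> 0" using nd by (simp add: dvd_eq_mod_eq_0)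
    ultimately have "P (r mod d)" unfolding P_def by blast
    then have "degree d \<le> degree (r mod d)" by (rule d(2))
    then show False using degree_mod_less[of d r] d(1) nz unfolding P_def by linarith
  qed
  have "d dvd p" "d dvd q" using dvd[of p 1 0] dvd[of q 0 1] by auto
  then have "d dvd 1" using assms(1) unfolding coprime_def by blast
  then obtain e' where "1 = d * e'" unfolding dvd_def by blast
  then obtain e where e: "e * d = 1" using mult.commute[of d e'] by metis
  obtain a b where ab: "d = a * p + b * q" using d(1) unfolding P_def by blast
  have "(e * a) * p + (e * b) * q = 1" using e unfolding ab by (simp add: algebra_simps)
  then show thesis by (rule that)
qed

lemma bezout_X_power:
  fixes u :: "'k::field poly"
  assumes "poly u 0 \<noteq> 0"
  obtains a c where "a * [:0, 1:] ^ n + c * u = 1"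
proof -
  obtain u0 u1 where u: "u = pCons u0 u1" by (cases u)
  then have u0: "u0 \<noteq> 0" using assms by simp
  have "\<exists>a c. a * [:0, 1:] ^ n + c * u = 1"
  proof (induction n)
    case 0
    then show ?case by (intro exI[of _ 1] exI[of _ 0]) simp
  next
    case (Suc n)
    then obtain a c where ac: "a * [:0, 1:] ^ n + c * u = 1" by blast
    define d where "d = [:inverse u0:]"
    have "u = [:u0:] + [:0, 1:] * u1" using u by simp
    then have "d * u = d * [:u0:] + d * [:0, 1:] * u1" by (metis distrib_left mult.assoc)
    also have "d * [:u0:] = 1" using u0 by (simp add: d_def one_pCons)
    finally have du: "d * u - d * [:0, 1:] * u1 = 1" by simp
    have key: "a * y * (d * u - d * x * u1) + c * u = (- a * d * u1) * (x * y) + (a * y * d + c) * u"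
      for a x y :: "'k poly" by (simp add: algebra_simps)
    have "1 = a * [:0, 1:] ^ n * (d * u - d * [:0, 1:] * u1) + c * u" using ac du by simp
    also have "\<dots> = (- a * d * u1) * [:0, 1:] ^ Suc n + (a * [:0, 1:] ^ n * d + c) * u"
      unfolding power_Suc by (rule key)
    finally show ?case by metis
  qed
  then show thesis using that by blast
qed

lemma pcompose_taylor:
  fixes p :: "'k::field poly"
  shows "\<exists>r. pcompose p (s + h) = pcompose p s + h * pcompose (pderiv p) s + h\<^sup>2 * r"
proof (induction p)
  case 0
  then show ?case by (auto intro: exI[of _ 0])
next
  case (pCons a p)
  then obtain r where r: "pcompose p (s + h) = pcompose p s + h * pcompose (pderiv p) s + h\<^sup>2 * r"
    by blast
  have "pcompose (pCons a p) (s + h) = pcompose (pCons a p) s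
      + h * pcompose (pderiv (pCons a p)) s + h\<^sup>2 * (pcompose (pderiv p) s + (s + h) * r)"
    unfolding pcompose_pCons r pderiv_pCons pcompose_add by (simp add: algebra_simps power2_eq_square)
  then show ?case by blast
qed

text \<open>Newton's iteration started at X, as in Chevalley's construction of the Jordan
  decomposition: modulo \<open>f\<close> the polynomial \<open>u\<close> inverts the derivative, and
  the corrections are multiples of \<open>f\<close>, so \<open>s\<close> stays congruent to X. If
  \<open>f ^ k\<close> kills an operator \<open>T\<close>, then \<open>f\<close> kills
  \<open>s(T)\<close>.\<close>

lemma newton_lift:
  fixes f :: "'k::field poly"
  assumes uw: "u * pderiv f + w * f = 1"
  shows "\<exists>s. f ^ k dvd pcompose f s \<and> f dvd s - [:0, 1:]"
proof (cases k)
  case 0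
  then show ?thesis by (intro exI[of _ "[:0, 1:]"]) simp
next
  case (Suc n)
  have "\<exists>s. f ^ Suc n dvd pcompose f s \<and> f dvd s - [:0, 1:]"
  proof (induction n)
    case 0
    then show ?case by (intro exI[of _ "[:0, 1:]"]) simp
  next
    case (Suc n)
    then obtain s where s: "f ^ Suc n dvd pcompose f s" "f dvd s - [:0, 1:]" by blast
    \<comment> \<open>The Newton correction, with \<open>U\<close> in place of the inverse of the
      derivative at \<open>s\<close>. The new value is a multiple of \<open>F * F\<close>, which has
      at least one more factor \<open>f\<close>.\<close>
    define F U h where "F = pcompose f s" and "U = pcompose u s" and "h = - F * U"
    have F: "f dvd F" using s(1) unfolding F_def by (metis dvd_mult_left power_Suc)
    obtain r where r: "pcompose f (s + h) = F + h * pcompose (pderiv f) s + h\<^sup>2 * r"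
      using pcompose_taylor F_def by metis
    have "pcompose (u * pderiv f + w * f) s = 1" by (simp add: uw pcompose_1)
    then have UP: "U * pcompose (pderiv f) s = 1 - pcompose w s * F"
      by (simp add: pcompose_add pcompose_mult U_def F_def algebra_simps)
    have "pcompose f (s + h) = F - F * (U * pcompose (pderiv f) s) + F * F * (U * U * r)"
      unfolding r by (simp add: h_def algebra_simps power2_eq_square)
    then have "pcompose f (s + h) = F * F * (pcompose w s + U * U * r)"
      unfolding UP by (simp add: algebra_simps)
    moreover have "f ^ Suc (Suc n) dvd F * F"
      using mult_dvd_mono[OF F s(1)] unfolding F_def by simp
    ultimately have "f ^ Suc (Suc n) dvd pcompose f (s + h)" by simp
    moreover have "f dvd (s + h) - [:0, 1:]"
      using dvd_add[OF s(2), of h] F by (simp add: h_def algebra_simps)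
    ultimately show ?case by blast
  qed
  then show ?thesis using Suc by blast
qed

section \<open>Operators annihilated by a separable polynomial\<close>

context endo_space
begin

lemma pol_monom: "lin T \<Longrightarrow> pol (monom c i) T v = scale c ((T ^^ i) v)"
  by (simp add: monom_altdef pol_smult pol_X_power)

text \<open>By separability 0 is at most a simple root of \<open>f\<close>. If
  \<open>f = X g\<close> with \<open>g(0)\<close> nonzero, then \<open>g(E)\<close> kills
  \<open>E v\<close>, while on the generalized null space of \<open>E\<close> a polynomial with
  nonzero constant term is injective.\<close>

lemma separable_ker:
  assumes E: "lin E" and uw: "u * pderiv f + w * f = 1"
    and f: "\<And>v. pol f E v = 0" and "(E ^^ n) v = 0"
  shows "E v = 0"
proof -
  have zero: "v = 0" if "(E ^^ n) v = 0" "pol g E v = 0" "poly g 0 \<noteq> 0" for g n v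
    using that(1,2)
  proof (induction n arbitrary: v)
    case (Suc n)
    have "scale (poly g 0) ((E ^^ n) v) = pol g E ((E ^^ n) v)"
      using Suc.prems(1) by (intro pol_eigen[OF E, symmetric]) simp
    also have "\<dots> = (E ^^ n) (pol g E v)"
      by (rule pol_commute[OF E lin_funpow[OF E], symmetric]) (simp add: funpow_swap1)
    also have "\<dots> = 0"
      using Suc.prems(2) lin_simps(3)[OF lin_funpow[OF E]] by simp
    finally show ?case using that(3) Suc by simp
  qed simp
  show ?thesis
  proof (cases "poly f 0 = 0")
    case False
    then show ?thesis using zero[OF assms(4) f] lin_simps(3)[OF E] by simp
  next
    case True
    then obtain g where g: "f = pCons 0 g" by (cases f) auto
    have "poly (u * pderiv f + w * f) 0 = 1" by (simp add: uw)
    then have "poly g 0 \<noteq> 0" using True by (auto simp: g pderiv_pCons)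
    moreover have "pol g E (E v) = 0"
      using f[of v] pol_commute[OF E E, of g v] by (simp add: g pol_pCons E)
    moreover have "(E ^^ n) (E v) = 0"
      using assms(4) lin_simps(3)[OF E] by (simp add: funpow_swap1[symmetric])
    ultimately show ?thesis using zero by blast
  qed
qed

text \<open>Averaging a projection \<open>P\<close> onto \<open>W\<close> with the separability idempotent of \<open>k[X]/(f)\<close>: writing
  \<open>f(X) - f(Y) = (X - Y) g(X, Y)\<close>, the operator \<open>Q\<close> below is \<open>P\<close> with \<open>E\<close> substituted for \<open>X\<close> on the
  left of \<open>P\<close> and for \<open>Y\<close> on its right.\<close>

lemma separable_complement:
  assumes E: "lin E" and uw: "u * pderiv f + w * f = 1"
    and f: "\<And>v. pol f E v = 0" and W: "subspace W" and EW: "\<And>w. w \<in> W \<Longrightarrow> E w \<in> W"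
  obtains C where "subspace C" "\<And>c. c \<in> C \<Longrightarrow> E c \<in> C" "W \<inter> C = {0}"
    "\<And>v. \<exists>a\<in>W. \<exists>c\<in>C. v = a + c"
proof -
  obtain P where P: "lin P" "\<And>v. P v \<in> W" "\<And>w. w \<in> W \<Longrightarrow> P w = w"
    using ex_projection[OF W] by blast
  note inW = pol_in_subspace[OF E W EW]
  have "\<exists>Q. lin Q \<and> (\<forall>v. E (Q v) - Q (E v) = pol g E (P v) - P (pol g E v)) \<and>
    (\<forall>w\<in>W. Q w = pol (pderiv g) E w) \<and> (\<forall>v. Q v \<in> W)" for g
  proof (induction g)
    case 0
    show ?case using P(1) by (intro exI[of _ "\<lambda>v. 0"]) (simp add: lin_zero lin_simps E subspace_0 W)
  next
    case (pCons a g)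
    then obtain Q where Q: "lin Q" "\<And>v. E (Q v) - Q (E v) = pol g E (P v) - P (pol g E v)"
      "\<And>w. w \<in> W \<Longrightarrow> Q w = pol (pderiv g) E w" "\<And>v. Q v \<in> W" by blast
    \<comment> \<open>The recursion of divided differences: (X g(X) - Y g(Y)) / (X - Y) = X (g(X) -
      g(Y)) / (X - Y) + g(Y), with Y written to the right of \<open>P\<close>.\<close>
    define Q' where "Q' v = P (pol g E v) + E (Q v)" for v
    have "E (Q' v) - Q' (E v) = pol (pCons a g) E (P v) - P (pol (pCons a g) E v)" for v
    proof -
      have "E (Q' v) - Q' (E v) = E (P (pol g E v)) + E (E (Q v) - Q (E v)) - P (pol g E (E v))"
        by (simp add: Q'_def lin_simps[OF E] algebra_simps)
      also have "\<dots> = E (pol g E (P v)) - P (E (pol g E v))"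
        unfolding Q(2) using pol_commute[OF E E, of g v] by (simp add: lin_simps[OF E])
      finally show ?thesis by (simp add: pol_pCons E lin_simps P(1))
    qed
    moreover have "Q' w = pol (pderiv (pCons a g)) E w" if "w \<in> W" for w
      using Q(3)[OF that] P(3)[OF inW[OF _ that]]
      by (simp add: Q'_def pderiv_pCons pol_add pol_pCons E)
    moreover have "lin Q'"
      unfolding Q'_def by (rule lin_add[OF lin_compose[OF P(1) lin_pol[OF E]] lin_compose[OF E Q(1)]])
    moreover have "Q' v \<in> W" for v
      unfolding Q'_def using P(2) Q(4) EW W by (blast intro: subspace_add)
    ultimately show ?case by blast
  qed
  from this[of f] obtain Q where Q: "lin Q"
    "\<And>v. E (Q v) - Q (E v) = pol f E (P v) - P (pol f E v)"
    "\<And>w. w \<in> W \<Longrightarrow> Q w = pol (pderiv f) E w" "\<And>v. Q v \<in> W" by blast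
  \<comment> \<open>On \<open>W\<close> the operator \<open>Q\<close> is the derivative of
    \<open>f\<close> at \<open>E\<close>, so composing it with \<open>u(E)\<close> gives the
    identity there; it commutes with \<open>E\<close> as \<open>f(E) = 0\<close>. The kernel of
    \<open>R\<close> is the complement.\<close>
  define R where "R v = pol u E (Q v)" for v
  have R: "lin R" unfolding R_def by (rule lin_compose[OF lin_pol[OF E] Q(1)])
  have "Q (E v) = E (Q v)" for v using Q(2)[of v] f P(1) by (simp add: lin_simps)
  then have ER: "R (E v) = E (R v)" for v
    unfolding R_def using pol_commute[OF E E] by simp
  have RW: "R v \<in> W" for v unfolding R_def by (intro inW Q(4))
  have Rw: "R x = x" if "x \<in> W" for x
  proof -
    have "R x = pol (u * pderiv f + w * f) E x"
      by (simp add: R_def Q(3)[OF that] pol_mult pol_add E f lin_simps[OF lin_pol[OF E]])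
    then show ?thesis by (simp add: uw)
  qed
  show thesis
  proof (rule that[of "{v. R v = 0}"])
    show "subspace {v. R v = 0}" by (rule subspace_ker[OF R])
    show "E c \<in> {v. R v = 0}" if "c \<in> {v. R v = 0}" for c
      using that by (simp add: ER lin_simps[OF E])
    show "W \<inter> {v. R v = 0} = {0}" using Rw W R by (auto simp: subspace_0 lin_simps)
    show "\<exists>a\<in>W. \<exists>c\<in>{v. R v = 0}. v = a + c" for v
      using RW[of v] Rw[OF RW[of v]]
      by (intro bexI[of _ "R v"] bexI[of _ "v - R v"]) (simp_all add: lin_simps[OF R])
  qed
qed

end

text \<open>Peeling off rank one summands \<open>P i s * P r j / P r s\<close> lowers the trace of an idempotent by one.\<close>

lemma idempotent_matrix_trace:
  fixes P :: "'i \<Rightarrow> 'i \<Rightarrow> 'k::field_char_0"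
  assumes "finite B" and "\<And>i j. i \<in> B \<Longrightarrow> j \<in> B \<Longrightarrow> (\<Sum>k\<in>B. P i k * P k j) = P i j"
  shows "\<exists>m. (\<Sum>i\<in>B. P i i) = of_nat m \<and> (m = 0 \<longrightarrow> (\<forall>i\<in>B. \<forall>j\<in>B. P i j = 0))"
  using assms(2)
proof (induction "card {i\<in>B. \<exists>j\<in>B. P i j \<noteq> 0}" arbitrary: P rule: less_induct)
  case less
  show ?case
  proof (cases "\<forall>i\<in>B. \<forall>j\<in>B. P i j = 0")
    case True
    then show ?thesis by (intro exI[of _ 0]) simp
  next
    case False
    then obtain r s where rs: "r \<in> B" "s \<in> B" "P r s \<noteq> 0" by blast
    define Q where "Q i j = P i j - P i s * P r j / P r s" for i j
    have "{i\<in>B. \<exists>j\<in>B. Q i j \<noteq> 0} \<subset> {i\<in>B. \<exists>j\<in>B. P i j \<noteq> 0}"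
    proof
      show "{i\<in>B. \<exists>j\<in>B. Q i j \<noteq> 0} \<subseteq> {i\<in>B. \<exists>j\<in>B. P i j \<noteq> 0}"
      proof clarify
        fix i j assume "i \<in> B" "j \<in> B" "Q i j \<noteq> 0"
        then have "P i j \<noteq> 0 \<or> P i s \<noteq> 0" by (auto simp: Q_def)
        then show "\<exists>j\<in>B. P i j \<noteq> 0" using \<open>j \<in> B\<close> rs(2) by blast
      qed
      have "Q r j = 0" for j using rs(3) by (simp add: Q_def)
      then show "{i\<in>B. \<exists>j\<in>B. Q i j \<noteq> 0} \<noteq> {i\<in>B. \<exists>j\<in>B. P i j \<noteq> 0}" using rs by blast
    qed
    then have "card {i\<in>B. \<exists>j\<in>B. Q i j \<noteq> 0} < card {i\<in>B. \<exists>j\<in>B. P i j \<noteq> 0}"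
      using assms(1) by (intro psubset_card_mono) auto
    moreover have "(\<Sum>k\<in>B. Q i k * Q k j) = Q i j" if "i \<in> B" "j \<in> B" for i j
    proof -
      have "Q i k * Q k j = P i k * P k j - (P i k * P k s) * (P r j / P r s)
          - (P i s / P r s) * (P r k * P k j)
          + (P i s / P r s) * (P r k * P k s) * (P r j / P r s)" for k
        using rs(3) by (simp add: Q_def field_simps)
      then have "(\<Sum>k\<in>B. Q i k * Q k j) = (\<Sum>k\<in>B. P i k * P k j)
          - (\<Sum>k\<in>B. P i k * P k s) * (P r j / P r s) - (P i s / P r s) * (\<Sum>k\<in>B. P r k * P k j)
          + (P i s / P r s) * (\<Sum>k\<in>B. P r k * P k s) * (P r j / P r s)"
        by (simp only: sum.distrib sum_subtractf sum_distrib_left sum_distrib_right)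
      also have "\<dots> = P i j - P i s * (P r j / P r s) - (P i s / P r s) * P r j
          + (P i s / P r s) * P r s * (P r j / P r s)"
        using that rs by (simp only: less.prems)
      also have "\<dots> = Q i j" using rs(3) by (simp add: Q_def)
      finally show ?thesis .
    qed
    ultimately obtain m where m: "(\<Sum>i\<in>B. Q i i) = of_nat m" using less.hyps[of Q] by blast
    have "P i i = Q i i + P r i * P i s / P r s" for i by (simp add: Q_def)
    then have "(\<Sum>i\<in>B. P i i) = of_nat m + (\<Sum>i\<in>B. P r i * P i s) / P r s"
      by (simp add: sum.distrib m sum_divide_distrib)
    also have "\<dots> = of_nat (Suc m)" using less.prems[OF rs(1,2)] rs(3) by simp
    finally show ?thesis by blast
  qed
qed

section \<open>Traces, annihilating polynomials and the Jordan decomposition\<close>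

locale fd_space = endo_space scale + finite_dimensional_vector_space scale Basis
  for scale :: "'k::field_char_0 \<Rightarrow> 'v::ab_group_add \<Rightarrow> 'v" and Basis :: "'v set"
begin

definition crd :: "'v \<Rightarrow> 'v \<Rightarrow> 'k" where "crd v b = representation Basis v b"

definition trace :: "('v \<Rightarrow> 'v) \<Rightarrow> 'k" where "trace T = (\<Sum>b\<in>Basis. crd (T b) b)"

lemma sum_crd: "(\<Sum>b\<in>Basis. scale (crd v b) b) = v"
  unfolding crd_def
  by (rule sum_representation_eq) (simp_all add: independent_Basis span_Basis finite_Basis)

lemma crd_simps:
  "crd (v + w) b = crd v b + crd w b" "crd (v - w) b = crd v b - crd w b"
  "crd (scale c v) b = c * crd v b" "crd 0 b = 0" "crd (- v) b = - crd v b"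
  "crd (sum g A) b = (\<Sum>a\<in>A. crd (g a) b)"
  by (simp_all add: crd_def representation_add representation_diff representation_scale
      representation_zero representation_neg representation_sum independent_Basis span_Basis)

lemma crd_eq_0_imp: "(\<And>b. b \<in> Basis \<Longrightarrow> crd v b = 0) \<Longrightarrow> v = 0"
  using sum_crd[of v] by simp

lemma lin_eq_0_on_Basis: "lin T \<Longrightarrow> (\<And>b. b \<in> Basis \<Longrightarrow> T b = 0) \<Longrightarrow> T v = 0"
  by (subst sum_crd[symmetric], subst lin_simps(6), assumption) (simp add: lin_simps)

lemma trace_simps:
  "trace (\<lambda>v. S v + T v) = trace S + trace T" "trace (\<lambda>v. S v - T v) = trace S - trace T"
  "trace (\<lambda>v. scale c (T v)) = c * trace T" "trace (\<lambda>v. 0) = 0"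
  "trace (\<lambda>v. \<Sum>i\<in>A. g i v) = (\<Sum>i\<in>A. trace (g i))"
  by (simp_all add: trace_def crd_simps sum.distrib sum_subtractf sum_distrib_left)
    (rule sum.swap)

lemma trace_cong: "(\<And>v. S v = T v) \<Longrightarrow> trace S = trace T"
  by (simp add: trace_def)

lemma crd_lin: "lin A \<Longrightarrow> crd (A v) b = (\<Sum>c\<in>Basis. crd v c * crd (A c) b)"
  by (subst sum_crd[of v, symmetric], subst lin_simps(6), assumption)
    (simp add: lin_simps crd_simps)

lemma trace_commute:
  assumes "lin A" "lin B"
  shows "trace (\<lambda>v. A (B v)) = trace (\<lambda>v. B (A v))"
proof -
  have "trace (\<lambda>v. A (B v)) = (\<Sum>b\<in>Basis. \<Sum>c\<in>Basis. crd (B b) c * crd (A c) b)"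
    unfolding trace_def by (rule sum.cong[OF refl crd_lin[OF assms(1)]])
  also have "\<dots> = (\<Sum>b\<in>Basis. \<Sum>c\<in>Basis. crd (A b) c * crd (B c) b)"
    by (subst sum.swap) (simp add: mult.commute)
  also have "\<dots> = trace (\<lambda>v. B (A v))"
    unfolding trace_def by (rule sum.cong[OF refl crd_lin[OF assms(2), symmetric]])
  finally show ?thesis .
qed

text \<open>With a projection \<open>p\<close> onto the range of \<open>N\<close>, the trace of
  \<open>N = p N\<close> equals that of \<open>N p\<close>, for which the exponent is smaller by
  one.\<close>

lemma trace_nilpotent:
  assumes "lin N" "\<And>v. (N ^^ k) v = 0"
  shows "trace N = 0"
proof -
  have "trace N = 0" if "lin N" "\<And>v. (N ^^ Suc k) v = 0" for N k
    using that
  proof (induction k arbitrary: N)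
    case 0
    then show ?case using trace_cong[of N "\<lambda>v. 0"] by (simp add: trace_simps)
  next
    case (Suc k)
    have "subspace (range N)" by (rule subspace_image[OF Suc.prems(1) subspace_UNIV])
    then obtain p where p: "lin p" "\<And>v. p v \<in> range N" "\<And>w. w \<in> range N \<Longrightarrow> p w = w"
      using ex_projection by blast
    define M where "M v = N (p v)" for v
    have "lin M" unfolding M_def using Suc.prems(1) p(1) by (rule lin_compose)
    moreover have "(M ^^ Suc k) v = 0" for v
    proof -
      have "(M ^^ j) (N x) = N ((N ^^ j) x)" for j x
        by (induction j) (simp_all add: M_def p(3))
      moreover obtain x where "p v = N x" using p(2) by blast
      ultimately have "(M ^^ Suc k) v = N ((N ^^ k) (N x))"
        unfolding funpow_Suc_right comp_apply by (simp add: M_def)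
      then show ?thesis using Suc.prems(2)[of x] by (simp add: funpow_swap1)
    qed
    ultimately have "trace M = 0" by (rule Suc.IH)
    moreover have "trace M = trace (\<lambda>v. p (N v))"
      unfolding M_def by (rule trace_commute[OF Suc.prems(1) p(1)])
    ultimately show ?case using p(3) by simp
  qed
  moreover have "(N ^^ Suc k) v = 0" for v using assms by (simp add: lin_simps)
  ultimately show ?thesis using assms(1) by blast
qed

lemma annihilating_poly:
  assumes T: "lin T"
  obtains m where "m \<noteq> 0" "\<And>v. pol m T v = 0"
proof -
  have "\<exists>p. p \<noteq> 0 \<and> pol p T v = 0" for v
  proof (cases "inj_on (\<lambda>i. (T ^^ i) v) {..dimension}")
    \<comment> \<open>Coinciding iterates collapse in the set to which linear dependence refers;
      here the difference of two monomials kills \<open>v\<close>.\<close>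
    case False
    then obtain i j where ij: "(T ^^ i) v = (T ^^ j) v" "i \<noteq> j" unfolding inj_on_def by blast
    have "monom 1 i - monom 1 j \<noteq> (0 :: 'k poly)"
      using ij(2) by (metis coeff_monom eq_iff_diff_eq_0 zero_neq_one)
    moreover have "pol (monom 1 i - monom 1 j) T v = 0"
      using ij by (simp add: pol_diff pol_monom T)
    ultimately show ?thesis by blast
  next
    case True
    let ?S = "(\<lambda>i. (T ^^ i) v) ` {..dimension}"
    have "card ?S = Suc dimension" using True by (simp add: card_image)
    then have dep: "dependent ?S"
      using independent_card_le_dim[of ?S UNIV] dim_subset_UNIV[of UNIV] by (metis Suc_n_not_le_n order_trans subset_UNIV)
    have "finite ?S" by simp
    from dep[unfolded dependent_finite[OF this]]
    obtain c x where c: "x \<in> ?S" "c x \<noteq> 0" "(\<Sum>y\<in>?S. scale (c y) y) = 0"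
      by blast
    define p where "p = (\<Sum>i\<le>dimension. monom (c ((T ^^ i) v)) i)"
    have "pol p T v = (\<Sum>i\<le>dimension. scale (c ((T ^^ i) v)) ((T ^^ i) v))"
      by (simp add: p_def pol_sum pol_monom T)
    then have "pol p T v = 0" using c(3) True by (simp add: sum.reindex)
    moreover from c(1) obtain i where i: "i \<le> dimension" "x = (T ^^ i) v" by blast
    then have "coeff p i = c x"
      by (simp add: p_def coeff_sum)
    then have "p \<noteq> 0" using c(2) by auto
    ultimately show ?thesis by blast
  qed
  then obtain p where p: "\<And>v. p v \<noteq> 0" "\<And>v. pol (p v) T v = 0" by metis
  let ?m = "\<Prod>b\<in>Basis. p b"
  have "pol ?m T b = 0" if "b \<in> Basis" for b
    using that p(2)[of b] by (intro pol_dvd[OF T dvd_prodI]) (auto simp: finite_Basis)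
  then have "pol ?m T v = 0" for v by (rule lin_eq_0_on_Basis[OF lin_pol[OF T]])
  moreover have "?m \<noteq> 0" using p(1) finite_Basis by auto
  ultimately show thesis using that by blast
qed

text \<open>The polynomial \<open>q\<close> makes \<open>q(T)\<close> the projection onto the part
  where \<open>T\<close> is bijective. Its trace is a combination of traces of positive powers of
  \<open>T\<close>, hence zero, and in characteristic zero an idempotent of trace zero vanishes.
  Then \<open>T ^^ r\<close> is zero.\<close>

lemma nilpotent_if_traces_0:
  assumes T: "lin T" and tr: "\<And>k. trace (T ^^ Suc k) = 0"
  shows "\<exists>n. \<forall>v. (T ^^ n) v = 0"
proof -
  obtain m where m: "m \<noteq> 0" "\<And>v. pol m T v = 0" using annihilating_poly[OF T] by blast
  obtain r u where u: "m = [:0, 1:] ^ r * u" "\<not> [:0, 1:] dvd u"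
    using order_decomp[OF m(1), of 0] by auto
  have "poly u 0 \<noteq> 0" using u(2) by (simp add: poly_eq_0_iff_dvd)
  \<comment> \<open>The exponent \<open>Suc r\<close> instead of \<open>r\<close> gives
    \<open>q\<close> a vanishing constant term even if \<open>r = 0\<close>, so that the trace of
    the identity does not enter.\<close>
  then obtain a c where ac: "a * [:0, 1:] ^ Suc r + c * u = 1" using bezout_X_power by blast
  define q where "q = a * [:0, 1:] ^ Suc r"
  have e: "lin (pol q T)" by (rule lin_pol[OF T])
  have "q * q = q - q * (1 - q)" by (simp add: algebra_simps)
  also have "1 - q = c * u" using ac unfolding q_def by (metis add_diff_cancel_left')
  also have "q * (c * u) = a * [:0, 1:] * c * m"
    by (subst u(1)) (simp only: q_def power_Suc ac_simps)
  finally have qq: "q * q = q - a * [:0, 1:] * c * m" .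
  have idem: "pol q T (pol q T v) = pol q T v" for v
    unfolding pol_mult[OF T, symmetric] qq pol_diff[OF T]
    by (simp only: pol_mult[OF T] m(2) lin_simps[OF lin_pol[OF T]]) simp
  have "coeff q 0 = 0" by (simp add: q_def coeff_mult)
  then have "trace (pol q T) = (\<Sum>i\<le>degree q. coeff q i * trace (T ^^ i))"
    unfolding pol_def by (simp add: trace_simps)
  also have "\<dots> = 0"
  proof (intro sum.neutral ballI)
    show "coeff q i * trace (T ^^ i) = 0" for i
      using \<open>coeff q 0 = 0\<close> tr by (cases i) auto
  qed
  finally have tr0: "trace (pol q T) = 0" .
  have "(\<Sum>k\<in>Basis. crd (pol q T k) i * crd (pol q T j) k) = crd (pol q T j) i" for i j
    using crd_lin[OF e, of "pol q T j" i] idem by (simp add: mult.commute)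
  from idempotent_matrix_trace[OF finite_Basis this]
  have "\<forall>i\<in>Basis. \<forall>j\<in>Basis. crd (pol q T j) i = 0" using tr0 by (auto simp: trace_def)
  then have "pol q T v = 0" for v
    using crd_eq_0_imp lin_eq_0_on_Basis[OF e] by metis
  then have "v = pol (c * u) T v" for v
    using ac unfolding q_def[symmetric] by (metis add_0 pol_1 pol_add[OF T])
  then have "(T ^^ r) v = pol (c * m) T v" for v
    unfolding u(1) by (metis pol_X_power[OF T] pol_mult[OF T] mult.left_commute)
  then have "(T ^^ r) v = 0" for v
    by (simp add: pol_mult[OF T] m(2) lin_simps[OF lin_pol[OF T]])
  then show ?thesis by blast
qed

text \<open>Among the nonzero polynomials with a power killing \<open>T\<close>, one of least degree
  is separable, since a repeated factor could be dropped. Newton's iteration then lifts X to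
  \<open>s\<close> with \<open>f(s(T)) = 0\<close>; as \<open>s - X\<close> is a multiple of
  \<open>f\<close>, the rest \<open>T - s(T)\<close> is nilpotent.\<close>

lemma jordan_decomposition:
  assumes T: "lin T"
  obtains s f u w k where "u * pderiv f + w * f = 1" "\<And>v. pol f (pol s T) v = 0"
    "\<And>v. ((\<lambda>v. T v - pol s T v) ^^ k) v = 0"
proof -
  define P where "P f \<longleftrightarrow> f \<noteq> 0 \<and> (\<exists>k. \<forall>v. pol (f ^ k) T v = 0)" for f
  obtain m where m: "m \<noteq> 0" "\<And>v. pol m T v = 0" using annihilating_poly[OF T] by blast
  have "pol (m ^ 1) T v = 0" for v using m(2) by simp
  with m(1) have "P m" unfolding P_def by blast
  then obtain f where f: "P f" "\<And>g. P g \<Longrightarrow> degree f \<le> degree g"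
    using ex_has_least_nat[of P m degree] by blast
  then obtain k where f0: "f \<noteq> 0" and k: "\<And>v. pol (f ^ k) T v = 0" unfolding P_def by blast
  have "coprime f (pderiv f)"
  proof (rule coprimeI, rule ccontr)
    fix d assume "d dvd f" "d dvd pderiv f" "\<not> is_unit d"
    then have "\<exists>d. d dvd f \<and> d dvd pderiv f \<and> \<not> is_unit d" by blast
    then obtain h where h: "h dvd f" "h dvd pderiv f" "\<not> is_unit h"
      and hmin: "\<And>e. e dvd f \<Longrightarrow> e dvd pderiv f \<Longrightarrow> \<not> is_unit e \<Longrightarrow> degree h \<le> degree e"
      using ex_has_least_nat[of "\<lambda>d. d dvd f \<and> d dvd pderiv f \<and> \<not> is_unit d" _ degree] by metis
    obtain q where q: "f = h * q" using h(1) by blast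
    have q0: "q \<noteq> 0" and h0: "h \<noteq> 0" using q f0 by auto
    have dh: "degree h > 0" using h(3) h0 is_unit_iff_degree by blast
    have dh': "degree (pderiv h) < degree h" "pderiv h \<noteq> 0"
      using dh by (auto simp: degree_pderiv pderiv_eq_0_iff)
    \<comment> \<open>By minimality of its degree \<open>h\<close> is coprime to its own derivative.
      As it divides \<open>pderiv f\<close>, it then divides the cofactor \<open>q\<close> as well,
      so that \<open>q * q\<close> is a multiple of \<open>f\<close>.\<close>
    have "coprime h (pderiv h)"
    proof (rule coprimeI, rule ccontr)
      fix e assume e: "e dvd h" "e dvd pderiv h" "\<not> is_unit e"
      have "e dvd f" "e dvd pderiv f" using e(1) h(1,2) by (blast intro: dvd_trans)+
      then have "degree h \<le> degree e" using hmin e(3) by blast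
      moreover have "degree e \<le> degree (pderiv h)" using e(2) dh'(2) by (rule dvd_imp_degree_le)
      ultimately show False using dh'(1) by simp
    qed
    then obtain a b where ab: "a * h + b * pderiv h = 1" using poly_bezout h0 by blast
    have "h dvd h * pderiv q + q * pderiv h" using h(2) by (simp add: q pderiv_mult)
    then have "h dvd q * pderiv h" by (simp add: dvd_add_right_iff)
    then have "h dvd q * a * h + b * (q * pderiv h)" by simp
    also have "q * a * h + b * (q * pderiv h) = q * (a * h + b * pderiv h)" by (simp add: algebra_simps)
    finally have "h dvd q" unfolding ab by simp
    then obtain r where r: "q = h * r" by blast
    have "q ^ (2 * k) = r ^ k * f ^ k"
      by (simp add: power_mult power2_eq_square q r power_mult_distrib[symmetric] ac_simps)
    then have "pol (q ^ (2 * k)) T v = 0" for v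
      using k by (simp add: pol_mult T lin_simps[OF lin_pol[OF T]])
    then have "P q" using q0 unfolding P_def by blast
    then have "degree f \<le> degree q" by (rule f(2))
    then show False using dh q0 h0 by (simp add: q degree_mult_eq)
  qed
  then obtain w u where "w * f + u * pderiv f = 1" using poly_bezout f0 by blast
  then have uw: "u * pderiv f + w * f = 1" by (simp add: add.commute)
  obtain s where s: "f ^ k dvd pcompose f s" "f dvd s - [:0, 1:]"
    using newton_lift[OF uw, of k] by blast
  have "pol f (pol s T) v = 0" for v
    using pol_dvd[OF T s(1) k] by (simp add: pol_pcompose T)
  moreover have "((\<lambda>v. T v - pol s T v) ^^ k) v = 0" for v
  proof -
    have "f dvd [:0, 1:] - s" using s(2) by (simp add: dvd_diff_commute)
    then have "f ^ k dvd ([:0, 1:] - s) ^ k" by (rule dvd_power_same)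
    then have "(pol ([:0, 1:] - s) T ^^ k) v = 0"
      using pol_dvd[OF T _ k] by (simp add: pol_power[OF T, symmetric])
    moreover have "pol ([:0, 1:] - s) T = (\<lambda>v. T v - pol s T v)"
      by (rule ext) (simp add: pol_diff T)
    ultimately show ?thesis by simp
  qed
  ultimately show thesis using that uw by blast
qed

end

section \<open>Joint eigenvectors\<close>

definition lagrange :: "'k::field set \<Rightarrow> 'k \<Rightarrow> 'k poly" where
  "lagrange \<Lambda> l = (\<Prod>m\<in>\<Lambda> - {l}. smult (inverse (l - m)) [:- m, 1:])"

lemma poly_lagrange:
  "finite \<Lambda> \<Longrightarrow> m \<in> \<Lambda> \<Longrightarrow> poly (lagrange \<Lambda> l) m = (if m = l then 1 else 0)"
proof -
  assume *: "finite \<Lambda>" "m \<in> \<Lambda>"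
  have "poly (lagrange \<Lambda> l) m = (\<Prod>x\<in>\<Lambda> - {l}. inverse (l - x) * (m - x))" (is "_ = ?P")
    by (simp add: lagrange_def poly_prod algebra_simps)
  moreover have "?P = 1" if "m = l"
  proof (rule prod.neutral, rule ballI)
    show "inverse (l - x) * (m - x) = 1" if "x \<in> \<Lambda> - {l}" for x
      using that \<open>m = l\<close> left_inverse[of "l - x"] by auto
  qed
  moreover have "?P = 0" if "m \<noteq> l"
    by (rule prod_zero) (use * that in auto)
  ultimately show ?thesis by simp
qed

lemma poly_sum_lagrange:
  assumes "finite \<Lambda>" "m \<in> \<Lambda>"
  shows "poly (\<Sum>l\<in>\<Lambda>. smult (c l) (lagrange \<Lambda> l)) m = c m"
proof -
  have "poly (\<Sum>l\<in>\<Lambda>. smult (c l) (lagrange \<Lambda> l)) m = (\<Sum>l\<in>\<Lambda>. if l = m then c l else 0)"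
    unfolding poly_sum poly_smult poly_lagrange[OF assms] by (rule sum.cong) auto
  then show ?thesis using assms by simp
qed

context endo_space
begin

text \<open>For finite \<open>\<Lambda>\<close> this says that \<open>v\<close> is a sum of
  eigenvectors of \<open>A\<close> with eigenvalues in \<open>\<Lambda>\<close>. The notion is local
  because it is applied on infinite-dimensional function spaces, where diagonalizability is known
  only at a given function.\<close>

definition diag_at :: "'k set \<Rightarrow> ('v \<Rightarrow> 'v) \<Rightarrow> 'v \<Rightarrow> bool" where
  "diag_at \<Lambda> A v \<longleftrightarrow> (\<forall>q. (\<forall>l\<in>\<Lambda>. poly q l = 0) \<longrightarrow> pol q A v = 0)"

lemma diag_at_expand:
  assumes A: "lin A" and \<Lambda>: "finite \<Lambda>" and "diag_at \<Lambda> A v"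
  shows "pol q A v = (\<Sum>l\<in>\<Lambda>. scale (poly q l) (pol (lagrange \<Lambda> l) A v))"
proof -
  have "pol (q - (\<Sum>l\<in>\<Lambda>. smult (poly q l) (lagrange \<Lambda> l))) A v = 0"
    using assms(3) poly_sum_lagrange[OF \<Lambda>, of _ "poly q"] unfolding diag_at_def by auto
  then show ?thesis by (simp add: pol_diff pol_sum pol_smult A)
qed

lemma diag_at_eigen:
  assumes A: "lin A" and \<Lambda>: "finite \<Lambda>" and "diag_at \<Lambda> A v" and l: "l \<in> \<Lambda>"
  shows "A (pol (lagrange \<Lambda> l) A v) = scale l (pol (lagrange \<Lambda> l) A v)"
proof -
  have "pol ([:- l, 1:] * lagrange \<Lambda> l) A v = 0"
    using assms(3) poly_lagrange[OF \<Lambda>] unfolding diag_at_def by auto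
  then have "pol [:- l, 1:] A (pol (lagrange \<Lambda> l) A v) = 0" by (simp only: pol_mult A)
  then show ?thesis by (simp add: pol_pCons A lin_simps)
qed

lemma diag_at_kill:
  assumes A: "lin A" and H: "lin H" and \<Lambda>: "finite \<Lambda>" and "diag_at \<Lambda> A v"
    and "\<And>l. l \<in> \<Lambda> \<Longrightarrow> H (pol (lagrange \<Lambda> l) A v) = 0"
  shows "H v = 0"
  using arg_cong[OF diag_at_expand[OF A \<Lambda> assms(4), of 1], of H] assms(5)
  by (simp add: lin_simps[OF H])

lemma diag_at_pol:
  assumes "lin A" "lin B" "\<And>v. A (B v) = B (A v)" "diag_at \<Lambda> A v"
  shows "diag_at \<Lambda> A (pol q B v)"
proof -
  have "pol p A (pol q B v) = pol q B (pol p A v)" for p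
    using pol_commute[OF assms(2) lin_pol[OF assms(1)]] pol_commute[OF assms(1,2)] assms(3) by metis
  then show ?thesis using assms(4) by (simp add: diag_at_def lin_simps[OF lin_pol[OF assms(2)]])
qed

text \<open>Lagrange polynomials in \<open>A\<close>, \<open>B\<close> and \<open>C\<close> cut
  \<open>v\<close> into joint eigenvectors inside the invariant subspace \<open>U\<close>.
  \<open>U\<close> carries the extra information, such as nilpotency or a derivation rule, that
  determines \<open>H\<close> on a joint eigenvector.\<close>

lemma joint_eigenvectors_kill:
  assumes lin: "lin A" "lin B" "lin C" "lin H"
    and comm: "\<And>v. A (B v) = B (A v)" "\<And>v. A (C v) = C (A v)" "\<And>v. B (C v) = C (B v)"
    and \<Lambda>: "finite \<Lambda>" and diag: "diag_at \<Lambda> A v" "diag_at \<Lambda> B v" "diag_at \<Lambda> C v"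
    and U: "subspace U" "\<And>x. x \<in> U \<Longrightarrow> A x \<in> U" "\<And>x. x \<in> U \<Longrightarrow> B x \<in> U" "\<And>x. x \<in> U \<Longrightarrow> C x \<in> U"
    and "v \<in> U"
    and kill: "\<And>x l m n. x \<in> U \<Longrightarrow> l \<in> \<Lambda> \<Longrightarrow> m \<in> \<Lambda> \<Longrightarrow> n \<in> \<Lambda> \<Longrightarrow> A x = scale l x \<Longrightarrow>
      B x = scale m x \<Longrightarrow> C x = scale n x \<Longrightarrow> H x = 0"
  shows "H v = 0"
proof (rule diag_at_kill[OF lin(1,4) \<Lambda> diag(1)])
  fix l assume l: "l \<in> \<Lambda>"
  define x where "x = pol (lagrange \<Lambda> l) A v"
  have x: "x \<in> U" "A x = scale l x" "diag_at \<Lambda> B x" "diag_at \<Lambda> C x"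
    unfolding x_def using pol_in_subspace[OF lin(1) U(1,2) \<open>v \<in> U\<close>]
      diag_at_eigen[OF lin(1) \<Lambda> diag(1) l] diag_at_pol[OF lin(2,1) comm(1)[symmetric] diag(2)]
      diag_at_pol[OF lin(3,1) comm(2)[symmetric] diag(3)] by auto
  have "H x = 0"
  proof (rule diag_at_kill[OF lin(2,4) \<Lambda> x(3)])
    fix m assume m: "m \<in> \<Lambda>"
    define y where "y = pol (lagrange \<Lambda> m) B x"
    have y: "y \<in> U" "B y = scale m y" "diag_at \<Lambda> C y" "A y = scale l y"
      unfolding y_def using pol_in_subspace[OF lin(2) U(1,3) x(1)]
        diag_at_eigen[OF lin(2) \<Lambda> x(3) m] diag_at_pol[OF lin(3,2) comm(3)[symmetric] x(4)]
        pol_commute[OF lin(2,1) comm(1)] x(2) by (auto simp: lin_simps[OF lin_pol[OF lin(2)]])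
    have "H y = 0"
    proof (rule diag_at_kill[OF lin(3,4) \<Lambda> y(3)])
      fix n assume n: "n \<in> \<Lambda>"
      show "H (pol (lagrange \<Lambda> n) C y) = 0"
        using pol_in_subspace[OF lin(3) U(1,4) y(1)] diag_at_eigen[OF lin(3) \<Lambda> y(3) n]
          pol_commute[OF lin(3,1) comm(2)] pol_commute[OF lin(3,2) comm(3)] y(2,4) l m n
        by (intro kill[of _ l m n]) (auto simp: lin_simps[OF lin_pol[OF lin(3)]])
    qed
    then show "H (pol (lagrange \<Lambda> m) B x) = 0" by (simp add: y_def)
  qed
  then show "H (pol (lagrange \<Lambda> l) A v) = 0" by (simp add: x_def)
qed

lemma funpow_uminus: "lin N \<Longrightarrow> ((\<lambda>v. - N v) ^^ k) v = scale ((- 1) ^ k) ((N ^^ k) v)"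
  by (induction k) (simp_all add: lin_simps)

end

section \<open>Extension of scalars to the algebraic closure\<close>

abbreviation ac_poly :: "'k::field poly \<Rightarrow> 'k alg_closure poly" where
  "ac_poly \<equiv> map_poly to_ac"

abbreviation ac_roots :: "'k::field poly \<Rightarrow> 'k alg_closure set" where
  "ac_roots f \<equiv> {l. poly (ac_poly f) l = 0}"

lemma ac_poly_simps:
  "ac_poly (p + q) = ac_poly p + ac_poly q" "ac_poly (p * q) = ac_poly p * ac_poly q"
  "ac_poly (pderiv p) = pderiv (ac_poly p)" "ac_poly 1 = 1"
  by (rule poly_eqI; simp add: coeff_map_poly coeff_mult coeff_pderiv to_ac_sum)+

text \<open>Peel off a root \<open>a\<close>: \<open>f = (X - a) g\<close>. Separability gives
  \<open>g(a)\<close> nonzero, so every root of \<open>g\<close> differs from \<open>a\<close> and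
  is a root of \<open>q / (X - a)\<close>; the Bezout identity for \<open>f\<close> yields one for
  \<open>g\<close>.\<close>

lemma separable_dvd:
  fixes f q :: "'c::alg_closed_field poly"
  assumes "u * pderiv f + w * f = 1" and "\<And>l. poly f l = 0 \<Longrightarrow> poly q l = 0"
  shows "f dvd q"
  using assms
proof (induction "degree f" arbitrary: f q u w)
  case 0
  then obtain c where "f = [:c:]" by (metis degree_eq_zeroE)
  then show ?case using 0 dvdI[of q "[:c:]" "smult (inverse c) q"] by (cases "c = 0") auto
next
  case (Suc n)
  then obtain a where a: "poly f a = 0" using alg_closed_imp_poly_has_root[of f] by auto
  then obtain g where g: "f = [:- a, 1:] * g" by (auto simp: poly_eq_0_iff_dvd)
  obtain r where r: "q = [:- a, 1:] * r" using Suc.prems(2)[OF a] by (auto simp: poly_eq_0_iff_dvd)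
  have pd: "pderiv f = g + [:- a, 1:] * pderiv g" unfolding g pderiv_mult by (simp add: pderiv_pCons)
  have "poly (u * pderiv f + w * f) a = 1" using Suc.prems(1) by simp
  then have ga: "poly g a \<noteq> 0" using a by (auto simp: pd)
  have "g \<noteq> 0" using ga by auto
  then have "degree f = Suc (degree g)" unfolding g by (subst degree_mult_eq) auto
  moreover have "(u * [:- a, 1:]) * pderiv g + (u + w * [:- a, 1:]) * g = 1"
    using Suc.prems(1) unfolding pd by (simp only: g) (simp only: ring_distribs ac_simps)
  moreover have "poly r l = 0" if "poly g l = 0" for l
    using Suc.prems(2)[of l] that ga unfolding g r by auto
  ultimately have "g dvd r" using Suc.hyps by simp
  then show ?case unfolding g r by (rule mult_dvd_mono[OF dvd_refl])
qed

global_interpretation pw: endo_space "\<lambda>(c :: 'c::field) (\<beta> :: 'x \<Rightarrow> 'c) x. c * \<beta> x"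
  by unfold_locales (auto simp: algebra_simps)

lemma pw_lin_precomp: "pw.lin (\<lambda>\<beta> x. \<beta> (g x))"
  by (rule pw.linI) auto

lemma funpow_precomp:
  fixes g :: "'x \<Rightarrow> 'x"
  shows "((\<lambda>\<beta> x. \<beta> (g x)) ^^ k) \<beta> x = \<beta> ((g ^^ k) x)"
  by (induction k arbitrary: x) (simp_all add: funpow_swap1[of g])

lemma sum_apply: "(\<Sum>i\<in>A. (h i :: 'x \<Rightarrow> 'c::comm_monoid_add)) x = (\<Sum>i\<in>A. h i x)"
  by (induction A rule: infinite_finite_induct) auto

lemma pw_pol_apply: "pw.pol p A \<beta> x = (\<Sum>i\<le>degree p. coeff p i * (A ^^ i) \<beta> x)"
  by (simp add: pw.pol_def sum_apply)

context fd_space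
begin

lemma pw_pol_ac_poly:
  assumes "lin L" and "\<And>i. \<beta> ((g ^^ i) x) = to_ac (crd (L ((E ^^ i) y)) a)"
  shows "pw.pol (ac_poly f) (\<lambda>\<beta> x. \<beta> (g x)) \<beta> x = to_ac (crd (L (pol f E y)) a)"
proof -
  have "pw.pol (ac_poly f) (\<lambda>\<beta> x. \<beta> (g x)) \<beta> x
      = (\<Sum>i\<le>degree f. to_ac (coeff f i) * to_ac (crd (L ((E ^^ i) y)) a))"
    unfolding pw.pol_altdef[OF map_poly_degree_leq]
    by (simp add: sum_apply funpow_precomp assms(2) coeff_map_poly)
  then show ?thesis
    by (simp add: pol_def lin_simps[OF assms(1)] crd_simps to_ac_sum)
qed

text \<open>Along each orbit of \<open>g\<close> the values of \<open>\<beta>\<close> are a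
  coordinate of \<open>L ((E ^^ i) y)\<close>, so \<open>f(E) = 0\<close> makes \<open>f\<close>
  kill the precomposition at \<open>\<beta>\<close>. Every polynomial vanishing at the roots of the
  separable \<open>f\<close> is a multiple of \<open>f\<close>.\<close>

lemma pw_diag_at:
  assumes "u * pderiv f + w * f = 1" and "\<And>v. pol f E v = 0"
    and "\<And>x. \<exists>L y. lin L \<and> (\<forall>i. \<beta> ((g ^^ i) x) = to_ac (crd (L ((E ^^ i) y)) a))"
  shows "pw.diag_at (ac_roots f) (\<lambda>\<beta> x. \<beta> (g x)) \<beta>"
  unfolding pw.diag_at_def
proof (intro allI impI)
  fix q assume q: "\<forall>l\<in>ac_roots f. poly q l = 0"
  have "ac_poly u * pderiv (ac_poly f) + ac_poly w * ac_poly f = 1"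
    by (simp only: ac_poly_simps[symmetric] assms(1))
  then have "ac_poly f dvd q" using separable_dvd q by blast
  moreover have "pw.pol (ac_poly f) (\<lambda>\<beta> x. \<beta> (g x)) \<beta> = 0"
  proof
    fix x
    obtain L y where Ly: "lin L" "\<And>i. \<beta> ((g ^^ i) x) = to_ac (crd (L ((E ^^ i) y)) a)"
      using assms(3)[of x] by blast
    show "pw.pol (ac_poly f) (\<lambda>\<beta> x. \<beta> (g x)) \<beta> x = 0 x"
      using pw_pol_ac_poly[OF Ly] assms(2) by (simp add: lin_simps[OF Ly(1)] crd_simps)
  qed
  ultimately show "pw.pol q (\<lambda>\<beta> x. \<beta> (g x)) \<beta> = 0"
    by (rule pw.pol_dvd[OF pw_lin_precomp])
qed

end

lemma finite_ac_roots:
  assumes "u * pderiv f + w * f = 1"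
  shows "finite (ac_roots f)"
proof -
  have "ac_poly u * pderiv (ac_poly f) + ac_poly w * ac_poly f = 1"
    by (simp only: ac_poly_simps[symmetric] assms)
  then have "ac_poly f \<noteq> 0" by auto
  then show ?thesis by (rule poly_roots_finite)
qed

section \<open>Semisimple parts of derivations, replicas and eigenvalue multiplicities\<close>

context fd_space
begin

text \<open>\<open>S0\<close>, \<open>S1\<close>, \<open>S2\<close> let the semisimple part act on the product and on the two factors of the
  bilinear map \<open>m\<close>; they commute and are diagonalizable over the algebraic closure. The claim is that
  \<open>Q = S1 + S2 - S0\<close> kills \<open>m\<close>, and there \<open>Q\<close> is a sum of three commuting nilpotent operators.\<close>

lemma derivation_semisimple_part:
  assumes m: "\<And>b. lin (m b)" "\<And>c. lin (\<lambda>b. m b c)" and D: "lin D"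
    and der: "\<And>b c. D (m b c) = m (D b) c + m b (D c)"
    and uw: "u * pderiv f + w * f = 1" and f: "\<And>v. pol f (pol s D) v = 0"
    and k: "\<And>v. ((\<lambda>v. D v - pol s D v) ^^ k) v = 0"
  shows "pol s D (m b c) = m (pol s D b) c + m b (pol s D c)"
proof -
  define e M where "e = pol s D" and "M = (\<lambda>v. D v - e v)"
  have e: "lin e" and eD: "e (D v) = D (e v)" and M: "lin M" for v
    unfolding M_def e_def using pol_commute[OF D D] lin_diff[OF D lin_pol[OF D]]
    by (simp_all add: lin_pol D)
  \<comment> \<open>The index \<open>(i, j, b, c)\<close> stands for
    \<open>(D ^^ i) ((e ^^ j) (m b c))\<close>, of which \<open>\<gamma>\<close> takes a coordinate.
    Applying \<open>D\<close> or \<open>e\<close> to the product is thus a shift of \<open>i\<close>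
    or \<open>j\<close>; the other four maps act on the factors.\<close>
  define gT0 gS0 gT1 gS1 gT2 gS2 :: "nat \<times> nat \<times> 'v \<times> 'v \<Rightarrow> nat \<times> nat \<times> 'v \<times> 'v"
    where "gT0 = (\<lambda>(i, j, b, c). (Suc i, j, b, c))" and "gS0 = (\<lambda>(i, j, b, c). (i, Suc j, b, c))"
      and "gT1 = (\<lambda>(i, j, b, c). (i, j, D b, c))" and "gS1 = (\<lambda>(i, j, b, c). (i, j, e b, c))"
      and "gT2 = (\<lambda>(i, j, b, c). (i, j, b, D c))" and "gS2 = (\<lambda>(i, j, b, c). (i, j, b, e c))"
  note g = gT0_def gS0_def gT1_def gS1_def gT2_def gS2_def
  define S0 S1 S2 :: "(nat \<times> nat \<times> 'v \<times> 'v \<Rightarrow> 'k alg_closure) \<Rightarrow> _"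
    where "S0 = (\<lambda>\<beta> x. \<beta> (gS0 x))" and "S1 = (\<lambda>\<beta> x. \<beta> (gS1 x))" and "S2 = (\<lambda>\<beta> x. \<beta> (gS2 x))"
  define N0 N1 N2 :: "(nat \<times> nat \<times> 'v \<times> 'v \<Rightarrow> 'k alg_closure) \<Rightarrow> _"
    where "N0 = (\<lambda>\<beta>. (\<lambda>x. \<beta> (gT0 x)) - (\<lambda>x. \<beta> (gS0 x)))"
      and "N1 = (\<lambda>\<beta>. (\<lambda>x. \<beta> (gT1 x)) - (\<lambda>x. \<beta> (gS1 x)))"
      and "N2 = (\<lambda>\<beta>. (\<lambda>x. \<beta> (gT2 x)) - (\<lambda>x. \<beta> (gS2 x)))"
  have linS: "pw.lin S0" "pw.lin S1" "pw.lin S2"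
    unfolding S0_def S1_def S2_def by (rule pw_lin_precomp)+
  have linN: "pw.lin N0" "pw.lin N1" "pw.lin N2"
    unfolding N0_def N1_def N2_def by (rule pw.lin_diff[OF pw_lin_precomp pw_lin_precomp])+
  define Q where "Q \<beta> = S1 \<beta> + S2 \<beta> - S0 \<beta>" for \<beta>
  have linQ: "pw.lin Q"
    unfolding Q_def by (rule pw.lin_diff[OF pw.lin_add[OF linS(2,3)] linS(1)])
  have SS: "S0 (S1 \<beta>) = S1 (S0 \<beta>)" "S0 (S2 \<beta>) = S2 (S0 \<beta>)" "S1 (S2 \<beta>) = S2 (S1 \<beta>)" for \<beta>
    by (auto simp: S0_def S1_def S2_def g)
  have SQ: "S0 (Q \<beta>) = Q (S0 \<beta>)" "S1 (Q \<beta>) = Q (S1 \<beta>)" "S2 (Q \<beta>) = Q (S2 \<beta>)" for \<beta>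
    by (simp_all only: Q_def pw.lin_simps[OF linS(1)] pw.lin_simps[OF linS(2)]
        pw.lin_simps[OF linS(3)] SS)
  have NN: "N0 (N1 \<beta>) = N1 (N0 \<beta>)" "N0 (N2 \<beta>) = N2 (N0 \<beta>)" "N1 (N2 \<beta>) = N2 (N1 \<beta>)" for \<beta>
    by (auto simp: N0_def N1_def N2_def g fun_eq_iff)
  have "crd (e (m b c)) a = crd (m (e b) c + m b (e c)) a" for a
  proof -
    define \<gamma> :: "nat \<times> nat \<times> 'v \<times> 'v \<Rightarrow> 'k alg_closure"
      where "\<gamma> = (\<lambda>(i, j, b, c). to_ac (crd ((D ^^ i) ((e ^^ j) (m b c))) a))"
    note lD = lin_simps[OF lin_funpow[OF D]] and le = lin_simps[OF lin_funpow[OF e]]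
    have De: "(D ^^ i) ((e ^^ j) (D v)) = D ((D ^^ i) ((e ^^ j) v))"
      "(D ^^ i) ((e ^^ j) (e v)) = (D ^^ i) (e ((e ^^ j) v))" for i j v
      using lin_funpow_commute[of D e j v] eD by (simp_all add: funpow_swap1)
    have n0: "(N0 ^^ n) \<gamma> (i, j, b, c) = to_ac (crd ((D ^^ i) ((e ^^ j) ((M ^^ n) (m b c)))) a)"
      for n i j b c
    proof (induction n arbitrary: i j)
      case (Suc n)
      have "(N0 ^^ Suc n) \<gamma> (i, j, b, c) = (N0 ^^ n) \<gamma> (Suc i, j, b, c) - (N0 ^^ n) \<gamma> (i, Suc j, b, c)"
        by (simp add: N0_def g)
      then show ?case
        unfolding Suc.IH by (simp add: M_def lD le crd_simps De flip: to_ac_diff)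
    qed (simp add: \<gamma>_def)
    have n1: "(N1 ^^ n) \<gamma> (i, j, b, c) = \<gamma> (i, j, (M ^^ n) b, c)" for n i j b c
    proof (induction n arbitrary: b)
      case (Suc n)
      have "(N1 ^^ Suc n) \<gamma> (i, j, b, c) = \<gamma> (i, j, (M ^^ n) (D b), c) - \<gamma> (i, j, (M ^^ n) (e b), c)"
        by (simp add: N1_def[THEN fun_cong] g Suc.IH)
      also have "\<dots> = \<gamma> (i, j, (M ^^ n) (D b - e b), c)"
        by (simp add: \<gamma>_def lD le crd_simps lin_simps[OF lin_funpow[OF M]] lin_simps[OF m(2)])
      finally show ?case by (simp only: funpow_Suc_right comp_apply M_def)
    qed simp
    have n2: "(N2 ^^ n) \<gamma> (i, j, b, c) = \<gamma> (i, j, b, (M ^^ n) c)" for n i j b c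
    proof (induction n arbitrary: c)
      case (Suc n)
      have "(N2 ^^ Suc n) \<gamma> (i, j, b, c) = \<gamma> (i, j, b, (M ^^ n) (D c)) - \<gamma> (i, j, b, (M ^^ n) (e c))"
        by (simp add: N2_def[THEN fun_cong] g Suc.IH)
      also have "\<dots> = \<gamma> (i, j, b, (M ^^ n) (D c - e c))"
        by (simp add: \<gamma>_def lD le crd_simps lin_simps[OF lin_funpow[OF M]] lin_simps[OF m(1)])
      finally show ?case by (simp only: funpow_Suc_right comp_apply M_def)
    qed simp
    have Mk: "(M ^^ k) v = 0" for v unfolding M_def e_def by (rule k)
    have nil: "(N0 ^^ k) \<gamma> = 0" "((\<lambda>\<beta>. - N1 \<beta>) ^^ k) \<gamma> = 0" "((\<lambda>\<beta>. - N2 \<beta>) ^^ k) \<gamma> = 0"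
    proof -
      have "\<gamma> (i, j, 0, c) = 0" "\<gamma> (i, j, b, 0) = 0" for i j b c
        by (simp_all add: \<gamma>_def lD le crd_simps lin_simps[OF m(1)] lin_simps[OF m(2)])
      then have "(N0 ^^ k) \<gamma> (i, j, b, c) = 0" "(N1 ^^ k) \<gamma> (i, j, b, c) = 0"
        "(N2 ^^ k) \<gamma> (i, j, b, c) = 0" for i j b c
        by (simp_all add: n0 n1 n2 Mk lD le crd_simps)
      then have *: "(N0 ^^ k) \<gamma> = 0" "(N1 ^^ k) \<gamma> = 0" "(N2 ^^ k) \<gamma> = 0"
        by (simp_all add: fun_eq_iff)
      show "(N0 ^^ k) \<gamma> = 0" by (rule *)
      show "((\<lambda>\<beta>. - N1 \<beta>) ^^ k) \<gamma> = 0" "((\<lambda>\<beta>. - N2 \<beta>) ^^ k) \<gamma> = 0"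
        by (simp_all add: pw.funpow_uminus linN * fun_eq_iff)
    qed
    \<comment> \<open>\<open>R = (T0 - T1 - T2) + Q\<close>, where \<open>T0\<close>,
      \<open>T1\<close>, \<open>T2\<close> are the precompositions with \<open>gT0\<close>,
      \<open>gT1\<close>, \<open>gT2\<close>. The bracket vanishes on \<open>W\<close>, which
      encodes the derivation rule for \<open>D\<close>, so \<open>Q\<close> inherits the nilpotency
      of \<open>R\<close> at \<open>\<gamma>\<close>.\<close>
    define R where "R \<beta> = N0 \<beta> + (- N1 \<beta> + - N2 \<beta>)" for \<beta>
    have N12: "((\<lambda>\<beta>. - N1 \<beta> + - N2 \<beta>) ^^ (k + k)) \<gamma> = 0"
      by (rule pw.nilpotent_add[OF pw.lin_uminus[OF linN(2)] pw.lin_uminus[OF linN(3)] _ nil(2,3)])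
        (simp add: pw.lin_simps linN NN)
    have Rk: "(R ^^ (k + (k + k))) \<gamma> = 0"
      unfolding R_def
      by (rule pw.nilpotent_add[OF linN(1)
            pw.lin_add[OF pw.lin_uminus[OF linN(2)] pw.lin_uminus[OF linN(3)]] _ nil(1) N12])
        (simp add: pw.lin_simps linN NN fun_eq_iff)
    define W :: "(nat \<times> nat \<times> 'v \<times> 'v \<Rightarrow> 'k alg_closure) set"
      where "W = {\<beta>. \<forall>i j b c. \<beta> (Suc i, j, b, c) = \<beta> (i, j, D b, c) + \<beta> (i, j, b, D c)}"
    have RQ: "R \<beta> = Q \<beta>" "Q \<beta> \<in> W" if "\<beta> \<in> W" for \<beta>
      using that eD
      by (auto simp: W_def R_def Q_def N0_def N1_def N2_def S0_def S1_def S2_def g fun_eq_iff)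
    have "\<gamma> \<in> W"
    proof -
      have "(D ^^ i) ((e ^^ j) (m (D b) c)) + (D ^^ i) ((e ^^ j) (m b (D c)))
          = (D ^^ Suc i) ((e ^^ j) (m b c))" for i j b c
        by (simp add: De flip: lD le der)
      then show ?thesis by (simp add: W_def \<gamma>_def flip: to_ac_add crd_simps)
    qed
    then have "(Q ^^ n) \<gamma> = (R ^^ n) \<gamma> \<and> (Q ^^ n) \<gamma> \<in> W" for n
    proof (induction n)
      case (Suc n)
      then have "(Q ^^ n) \<gamma> = (R ^^ n) \<gamma>" "(R ^^ n) \<gamma> \<in> W" by metis+
      then show ?case using RQ[of "(R ^^ n) \<gamma>"] by simp
    qed simp
    then have Qk: "(Q ^^ (3 * k)) \<gamma> = 0" using Rk by (simp add: numeral_3_eq_3)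
    have diag: "pw.diag_at (ac_roots f) S0 \<gamma>"
      "pw.diag_at (ac_roots f) S1 \<gamma>"
      "pw.diag_at (ac_roots f) S2 \<gamma>"
      unfolding S0_def S1_def S2_def
    proof -
      have p0: "(gS0 ^^ n) (i, j, b, c) = (i, j + n, b, c)"
        and p1: "(gS1 ^^ n) (i, j, b, c) = (i, j, (e ^^ n) b, c)"
        and p2: "(gS2 ^^ n) (i, j, b, c) = (i, j, b, (e ^^ n) c)" for n i j b c
        by (induction n) (simp_all add: g)
      note l1 = lin_compose[OF lin_compose[OF lin_funpow[OF D] lin_funpow[OF e]] m(1)]
        and l2 = lin_compose[OF lin_compose[OF lin_funpow[OF D] lin_funpow[OF e]] m(2)]
      note dI = pw_diag_at[OF uw f[folded e_def]]
      show "pw.diag_at (ac_roots f) (\<lambda>\<beta> x. \<beta> (gS0 x)) \<gamma>"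
      proof (rule dI, clarify)
        show "\<exists>L y. lin L \<and> (\<forall>n. \<gamma> ((gS0 ^^ n) (i, j, b, c)) = to_ac (crd (L ((e ^^ n) y)) a))"
          for i j b c
          using lin_compose[OF lin_funpow[OF D] lin_funpow[OF e]]
          by (intro exI[of _ "\<lambda>v. (D ^^ i) ((e ^^ j) v)"] exI[of _ "m b c"])
            (simp add: p0 \<gamma>_def funpow_add)
      qed
      show "pw.diag_at (ac_roots f) (\<lambda>\<beta> x. \<beta> (gS1 x)) \<gamma>"
        using l2 by (intro dI, clarify, intro exI conjI allI) (assumption, unfold p1 \<gamma>_def prod.case, rule refl)
      show "pw.diag_at (ac_roots f) (\<lambda>\<beta> x. \<beta> (gS2 x)) \<gamma>"
        using l1 by (intro dI, clarify, intro exI conjI allI) (assumption, unfold p2 \<gamma>_def prod.case, rule refl)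
    qed
    have Qp: "(Q ^^ n) (A \<beta>) = A ((Q ^^ n) \<beta>)" if "\<And>\<beta>. A (Q \<beta>) = Q (A \<beta>)" for A n \<beta>
      by (induction n) (simp_all add: that)
    \<comment> \<open>On a joint eigenvector \<open>Q\<close> is multiplication by
      \<open>m' + n - l\<close>. A power of this scalar annihilates the eigenvector, so already the
      scalar does.\<close>
    have "Q \<gamma> = 0"
    proof (rule pw.joint_eigenvectors_kill[OF linS linQ SS finite_ac_roots[OF uw] diag,
          where U = "{\<beta>. (Q ^^ (3 * k)) \<beta> = 0}"])
      show "pw.subspace {\<beta>. (Q ^^ (3 * k)) \<beta> = 0}" by (rule pw.subspace_ker[OF pw.lin_funpow[OF linQ]])
      show "S0 x \<in> {\<beta>. (Q ^^ (3 * k)) \<beta> = 0}" "S1 x \<in> {\<beta>. (Q ^^ (3 * k)) \<beta> = 0}"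
        "S2 x \<in> {\<beta>. (Q ^^ (3 * k)) \<beta> = 0}" if "x \<in> {\<beta>. (Q ^^ (3 * k)) \<beta> = 0}" for x
        using that by (simp_all add: Qp SQ pw.lin_simps linS flip: zero_fun_def)
      show "\<gamma> \<in> {\<beta>. (Q ^^ (3 * k)) \<beta> = 0}" using Qk by simp
      fix x l m' n
      assume x: "x \<in> {\<beta>. (Q ^^ (3 * k)) \<beta> = 0}"
        and "S0 x = (\<lambda>y. l * x y)" "S1 x = (\<lambda>y. m' * x y)" "S2 x = (\<lambda>y. n * x y)"
      then have Qx: "Q x = (\<lambda>y. (m' + n - l) * x y)"
        by (simp add: Q_def fun_eq_iff algebra_simps)
      have "(Q ^^ i) x = (\<lambda>y. (m' + n - l) ^ i * x y)" for i
      proof (induction i)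
        case (Suc i)
        then have "(Q ^^ Suc i) x = Q (\<lambda>y. (m' + n - l) ^ i * x y)" by simp
        also have "\<dots> = (\<lambda>y. (m' + n - l) ^ i * ((m' + n - l) * x y))"
          unfolding pw.lin_simps(2)[OF linQ] Qx ..
        finally show ?case by (simp add: ac_simps)
      qed simp
      from this[of "3 * k"] x have "(\<lambda>y. (m' + n - l) ^ (3 * k) * x y) = 0" by simp
      then have "(m' + n - l) ^ (3 * k) * x y = 0" for y by (metis zero_fun_apply)
      then have "(m' + n - l) * x y = 0" for y by (metis mult_eq_0_iff power_not_zero)
      then show "Q x = 0" unfolding Qx zero_fun_def by (rule ext)
    qed
    then have "Q \<gamma> (0, 0, b, c) = 0" by simp
    then show ?thesis
      by (simp add: Q_def S0_def S1_def S2_def g \<gamma>_def crd_simps flip: to_ac_add to_ac_diff)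
  qed
  then show ?thesis
    using crd_eq_0_imp[of "e (m b c) - (m (e b) c + m b (e c))"] by (simp add: crd_simps e_def)
qed

text \<open>The replicas of \<open>E\<close>, i.e. the polynomials \<open>p\<close> in \<open>E\<close> acting on the eigenvalues of \<open>E\<close> by
  an additive map, inherit the derivation rule. As they live over the algebraic closure, the rule is
  stated for the coordinates of the values of a linear map \<open>L\<close>.\<close>

lemma derivation_replica:
  assumes m: "\<And>b. lin (m b)" "\<And>c. lin (\<lambda>b. m b c)" and L: "lin L" and E: "lin E"
    and der: "\<And>b c. E (m b c) = m (E b) c + m b (E c)"
    and uw: "u * pderiv f + w * f = 1" and f: "\<And>v. pol f E v = 0"
    and add: "\<And>x y. \<phi> (x + y) = \<phi> x + \<phi> y"
    and p: "\<And>l. poly (ac_poly f) l = 0 \<Longrightarrow> poly p l = \<phi> l"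
  shows "(\<Sum>i\<le>degree p. coeff p i * to_ac (crd (L ((E ^^ i) (m b c))) a))
    = (\<Sum>i\<le>degree p. coeff p i * to_ac (crd (L (m ((E ^^ i) b) c)) a))
    + (\<Sum>i\<le>degree p. coeff p i * to_ac (crd (L (m b ((E ^^ i) c))) a))"
proof -
  define g0 g1 g2 :: "nat \<times> 'v \<times> 'v \<Rightarrow> nat \<times> 'v \<times> 'v"
    where "g0 = (\<lambda>(j, b, c). (Suc j, b, c))" and "g1 = (\<lambda>(j, b, c). (j, E b, c))"
      and "g2 = (\<lambda>(j, b, c). (j, b, E c))"
  note g = g0_def g1_def g2_def
  define S0 S1 S2 :: "(nat \<times> 'v \<times> 'v \<Rightarrow> 'k alg_closure) \<Rightarrow> nat \<times> 'v \<times> 'v \<Rightarrow> 'k alg_closure"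
    where "S0 = (\<lambda>\<beta> x. \<beta> (g0 x))" and "S1 = (\<lambda>\<beta> x. \<beta> (g1 x))" and "S2 = (\<lambda>\<beta> x. \<beta> (g2 x))"
  have linS: "pw.lin S0" "pw.lin S1" "pw.lin S2"
    unfolding S0_def S1_def S2_def by (rule pw_lin_precomp)+
  have SS: "S0 (S1 \<beta>) = S1 (S0 \<beta>)" "S0 (S2 \<beta>) = S2 (S0 \<beta>)" "S1 (S2 \<beta>) = S2 (S1 \<beta>)" for \<beta>
    by (auto simp: S0_def S1_def S2_def g)
  define H where "H \<beta> = pw.pol p S0 \<beta> - (pw.pol p S1 \<beta> + pw.pol p S2 \<beta>)" for \<beta>
  have linH: "pw.lin H" unfolding H_def
    by (rule pw.lin_diff[OF pw.lin_pol[OF linS(1)] pw.lin_add[OF pw.lin_pol[OF linS(2)] pw.lin_pol[OF linS(3)]]])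
  define U where "U = {\<beta>. S0 \<beta> = S1 \<beta> + S2 \<beta>}"
  define \<gamma> :: "nat \<times> 'v \<times> 'v \<Rightarrow> 'k alg_closure"
    where "\<gamma> = (\<lambda>(j, b, c). to_ac (crd (L ((E ^^ j) (m b c))) a))"
  have p0: "(g0 ^^ n) (j, b, c) = (j + n, b, c)" and p1: "(g1 ^^ n) (j, b, c) = (j, (E ^^ n) b, c)"
    and p2: "(g2 ^^ n) (j, b, c) = (j, b, (E ^^ n) c)" for n j b c
    by (induction n) (simp_all add: g)
  note l0 = lin_compose[OF L lin_funpow[OF E]]
  have "H \<gamma> = 0"
  proof (rule pw.joint_eigenvectors_kill[OF linS linH SS finite_ac_roots[OF uw], where U = U])
    show "pw.diag_at (ac_roots f) S0 \<gamma>" unfolding S0_def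
    proof (rule pw_diag_at[OF uw f], clarify)
      show "\<exists>L y. lin L \<and> (\<forall>n. \<gamma> ((g0 ^^ n) (j, b, c)) = to_ac (crd (L ((E ^^ n) y)) a))" for j b c
        by (intro exI[of _ "\<lambda>v. L ((E ^^ j) v)"] exI[of _ "m b c"])
          (simp add: p0 \<gamma>_def funpow_add l0)
    qed
    show "pw.diag_at (ac_roots f) S1 \<gamma>" unfolding S1_def
      using lin_compose[OF l0 m(2)]
      by (intro pw_diag_at[OF uw f], clarify, intro exI conjI allI) (assumption, unfold p1 \<gamma>_def prod.case, rule refl)
    show "pw.diag_at (ac_roots f) S2 \<gamma>" unfolding S2_def
      using lin_compose[OF l0 m(1)]
      by (intro pw_diag_at[OF uw f], clarify, intro exI conjI allI) (assumption, unfold p2 \<gamma>_def prod.case, rule refl)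
    show "pw.subspace U"
      using pw.subspace_ker[OF pw.lin_diff[OF linS(1) pw.lin_add[OF linS(2,3)]]]
      by (simp add: U_def algebra_simps)
    show "S0 x \<in> U" "S1 x \<in> U" "S2 x \<in> U" if "x \<in> U" for x
    proof -
      have x: "S0 x = S1 x + S2 x" using that by (simp add: U_def)
      have *: "S0 (S0 x) = S0 (S1 x) + S0 (S2 x)" "S1 (S0 x) = S1 (S1 x) + S1 (S2 x)"
        "S2 (S0 x) = S2 (S1 x) + S2 (S2 x)"
        unfolding x by (rule pw.lin_simps(1) linS)+
      show "S0 x \<in> U" "S1 x \<in> U" "S2 x \<in> U"
        unfolding U_def mem_Collect_eq using * by (simp_all only: SS)
    qed
    show "\<gamma> \<in> U"
      by (auto simp: U_def S0_def S1_def S2_def g \<gamma>_def fun_eq_iff der funpow_swap1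
          lin_simps[OF l0] crd_simps)
    fix x l m' n
    assume x: "x \<in> U" and l: "l \<in> ac_roots f" "m' \<in> ac_roots f"
        "n \<in> ac_roots f"
      and ev: "S0 x = (\<lambda>y. l * x y)" "S1 x = (\<lambda>y. m' * x y)" "S2 x = (\<lambda>y. n * x y)"
    have "(l - (m' + n)) * x y = 0" for y
      using x fun_cong[of "\<lambda>y. l * x y" "(\<lambda>y. m' * x y) + (\<lambda>y. n * x y)" y]
      by (simp add: U_def ev algebra_simps)
    \<comment> \<open>The derivation rule in \<open>U\<close> forces \<open>l = m' + n\<close> on
      nonzero joint eigenvectors, and additivity of \<open>\<phi>\<close> carries this over to the
      values of \<open>p\<close>.\<close>
    then have "l = m' + n \<or> x = 0" by (metis eq_iff_diff_eq_0 ext mult_eq_0_iff zero_fun_apply)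
    moreover have "H x = (\<lambda>y. (poly p l - (poly p m' + poly p n)) * x y)"
      by (simp add: H_def pw.pol_eigen[OF linS(1) ev(1)] pw.pol_eigen[OF linS(2) ev(2)]
          pw.pol_eigen[OF linS(3) ev(3)] fun_eq_iff algebra_simps)
    ultimately show "H x = 0" using l p add by (auto simp: fun_eq_iff)
  qed
  then have "H \<gamma> (0, b, c) = 0" by simp
  then show ?thesis
    by (simp add: H_def pw_pol_apply S0_def S1_def S2_def funpow_precomp p0 p1 p2 \<gamma>_def)
qed

text \<open>\<open>mult l\<close> is the multiplicity of the eigenvalue \<open>l\<close>, obtained
  as the trace of the spectral projection given by \<open>lagrange \<Lambda> l\<close>. This is an
  idempotent matrix over the closure, so its trace is a natural number and vanishes only with the
  projection.\<close>

lemma trace_weights: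
  assumes E: "lin E" and uw: "u * pderiv f + w * f = 1" and f: "\<And>v. pol f E v = 0"
  obtains mult where
    "\<And>q. (\<Sum>i\<le>degree q. coeff q i * to_ac (trace (E ^^ i)))
      = (\<Sum>l | poly (ac_poly f) l = 0. of_nat (mult l) * poly q l)"
    "\<And>v. \<forall>l. poly (ac_poly f) l = 0 \<longrightarrow> l \<noteq> 0 \<longrightarrow> mult l = 0 \<Longrightarrow> E v = 0"
proof -
  define \<Lambda> where "\<Lambda> = ac_roots f"
  have \<Lambda>: "finite \<Lambda>" unfolding \<Lambda>_def by (rule finite_ac_roots[OF uw])
  define A :: "('v \<Rightarrow> 'k alg_closure) \<Rightarrow> 'v \<Rightarrow> 'k alg_closure" where "A = (\<lambda>\<beta> x. \<beta> (E x))"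
  have A: "pw.lin A" unfolding A_def by (rule pw_lin_precomp)
  \<comment> \<open>\<open>P q b c\<close> is the entry in row \<open>b\<close> and column
    \<open>c\<close> of the matrix of \<open>q(E)\<close>, where \<open>q\<close> has coefficients
    in the closure.\<close>
  define P where "P q b = pw.pol q A (\<lambda>v. to_ac (crd v b))" for q b
  have P: "P q b v = (\<Sum>i\<le>degree q. coeff q i * to_ac (crd ((E ^^ i) v) b))" for q b v
    by (simp add: P_def pw_pol_apply A_def funpow_precomp)
  have diag: "pw.diag_at \<Lambda> A (\<lambda>v. to_ac (crd v b))" for b
    unfolding \<Lambda>_def A_def
    by (rule pw_diag_at[OF uw f, where a = b]) (auto intro!: exI[of _ "\<lambda>v. v"] lin_id)
  have expand: "P q b c = (\<Sum>l\<in>\<Lambda>. poly q l * P (lagrange \<Lambda> l) b c)" for q b c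
    using fun_cong[OF pw.diag_at_expand[OF A \<Lambda> diag, of q b], of c]
    by (simp add: P_def sum_apply)
  have P_cong: "P q b c = P r b c" if "\<And>l. l \<in> \<Lambda> \<Longrightarrow> poly q l = poly r l" for q r b c
    unfolding expand[of q] expand[of r] by (rule sum.cong[OF refl]) (simp add: that)
  have lag: "poly (lagrange \<Lambda> l * lagrange \<Lambda> l) x = poly (lagrange \<Lambda> l) x" if "x \<in> \<Lambda>" for x l
    using that by (simp add: poly_lagrange \<Lambda>)
  have mat: "(\<Sum>k\<in>Basis. P q b k * P r k c) = P (r * q) b c" for q r b c
  proof -
    have "P q b v = (\<Sum>k\<in>Basis. to_ac (crd v k) * P q b k)" for v
    proof -
      have "crd ((E ^^ i) v) b = (\<Sum>k\<in>Basis. crd v k * crd ((E ^^ i) k) b)" for i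
        by (rule crd_lin[OF lin_funpow[OF E]])
      then have "P q b v = (\<Sum>i\<le>degree q. \<Sum>k\<in>Basis. to_ac (crd v k) * (coeff q i * to_ac (crd ((E ^^ i) k) b)))"
        unfolding P by (simp add: to_ac_sum sum_distrib_left ac_simps)
      also have "\<dots> = (\<Sum>k\<in>Basis. to_ac (crd v k) * P q b k)"
        unfolding P sum_distrib_left by (rule sum.swap)
      finally show ?thesis .
    qed
    note exp = this
    have "P (r * q) b c = (\<Sum>i\<le>degree r. coeff r i * P q b ((E ^^ i) c))"
      unfolding P_def pw.pol_mult[OF A] by (subst pw_pol_apply) (simp add: A_def funpow_precomp)
    also have "\<dots> = (\<Sum>i\<le>degree r. \<Sum>k\<in>Basis. P q b k * (coeff r i * to_ac (crd ((E ^^ i) c) k)))"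
      by (subst exp) (simp add: sum_distrib_left ac_simps)
    also have "\<dots> = (\<Sum>k\<in>Basis. P q b k * P r k c)"
      unfolding P[of r] sum_distrib_left by (rule sum.swap)
    finally show ?thesis by simp
  qed
  have "\<exists>n. (\<Sum>b\<in>Basis. P (lagrange \<Lambda> l) b b) = of_nat n \<and>
      (n = 0 \<longrightarrow> (\<forall>b\<in>Basis. \<forall>c\<in>Basis. P (lagrange \<Lambda> l) b c = 0))" for l
    by (rule idempotent_matrix_trace[OF finite_Basis]) (simp add: mat P_cong[OF lag])
  then obtain mult where mult: "\<And>l. (\<Sum>b\<in>Basis. P (lagrange \<Lambda> l) b b) = of_nat (mult l)"
    "\<And>l b c. mult l = 0 \<Longrightarrow> b \<in> Basis \<Longrightarrow> c \<in> Basis \<Longrightarrow> P (lagrange \<Lambda> l) b c = 0"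
    by metis
  show thesis
  proof (rule that)
    fix q
    have "(\<Sum>i\<le>degree q. coeff q i * to_ac (trace (E ^^ i))) = (\<Sum>b\<in>Basis. P q b b)"
      unfolding P trace_def to_ac_sum sum_distrib_left by (rule sum.swap)
    also have "\<dots> = (\<Sum>l\<in>\<Lambda>. \<Sum>b\<in>Basis. poly q l * P (lagrange \<Lambda> l) b b)"
      by (subst expand) (rule sum.swap)
    also have "\<dots> = (\<Sum>l\<in>\<Lambda>. of_nat (mult l) * poly q l)"
      by (simp add: sum_distrib_left[symmetric] mult(1) mult.commute)
    finally show "(\<Sum>i\<le>degree q. coeff q i * to_ac (trace (E ^^ i)))
      = (\<Sum>l | poly (ac_poly f) l = 0. of_nat (mult l) * poly q l)" unfolding \<Lambda>_def .
  next
    fix v assume *: "\<forall>l. poly (ac_poly f) l = 0 \<longrightarrow> l \<noteq> 0 \<longrightarrow> mult l = 0"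
    have "crd (E c) b = 0" if "b \<in> Basis" "c \<in> Basis" for b c
    proof -
      have "P [:0, 1:] b c = 0"
        unfolding expand[of "[:0, 1:]"]
        using * mult(2)[OF _ that] by (intro sum.neutral ballI) (auto simp: \<Lambda>_def)
      then show ?thesis by (simp add: P)
    qed
    then show "E v = 0" using crd_eq_0_imp lin_eq_0_on_Basis[OF E] by metis
  qed
qed

end

text \<open>The field is a rational vector space, in which \<open>a\<close> is part of a basis. In
  Cartan's criterion such functionals take the place of complex conjugation.\<close>

lemma ex_rational_functional:
  fixes a :: "'c::field_char_0"
  assumes "a \<noteq> 0"
  obtains \<psi> :: "'c \<Rightarrow> rat" where "\<And>x y. \<psi> (x + y) = \<psi> x + \<psi> y"
    "\<And>q x. \<psi> (of_rat q * x) = q * \<psi> x" "\<psi> a = 1"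
proof -
  interpret A: vector_space "\<lambda>(q :: rat) (x :: 'c). of_rat q * x"
    by unfold_locales (simp_all add: algebra_simps of_rat_add of_rat_mult)
  interpret B: vector_space "\<lambda>(q :: rat) (x :: rat). q * x"
    by unfold_locales (simp_all add: algebra_simps)
  interpret vector_space_pair "\<lambda>(q :: rat) (x :: 'c). of_rat q * x" "\<lambda>(q :: rat) (x :: rat). q * x" ..
  have "A.independent {a}" using assms by (simp add: A.dependent_single)
  then obtain \<psi> where "Vector_Spaces.linear (\<lambda>q x. of_rat q * x) (\<lambda>q x. q * x) \<psi>"
      and \<psi>a: "\<psi> a = 1"
    using linear_independent_extend[of "{a}" "\<lambda>_. 1"] by auto
  then interpret Vector_Spaces.linear "\<lambda>(q :: rat) (x :: 'c). of_rat q * x" "\<lambda>(q :: rat) (x :: rat). q * x" \<psi>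
    by simp
  show thesis by (rule that[of \<psi>]) (simp_all add: add scale \<psi>a)
qed

section \<open>Frattini ideal and nilradical\<close>

locale fd_leibniz = leibniz_algebra scale br + finite_dimensional_vector_space scale Basis
  for scale :: "'f::field_char_0 \<Rightarrow> 'a::ab_group_add \<Rightarrow> 'a" and br :: "'a \<Rightarrow> 'a \<Rightarrow> 'a" and Basis
begin

sublocale fd_space scale Basis ..

lemma br_lin: "lin (\<lambda>v. br v x)" "lin (br x)"
  using linear_br_left[of x] linear_br_right[of x] by simp_all

abbreviation R :: "'a \<Rightarrow> 'a \<Rightarrow> 'a" where "R x \<equiv> \<lambda>v. br v x"

lemmas br_more = lin_simps[OF br_lin(1)] lin_simps[OF br_lin(2)]

lemma br_derivation: "br (br x y) z = br (br x z) y + br x (br y z)"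
  by (simp add: leibniz)

lemma square_in_kernel: "br x x \<in> leibniz_kernel"
  unfolding leibniz_kernel_def by (rule span_base) blast

lemma br_anticomm_kernel: "br x y + br y x \<in> leibniz_kernel"
proof -
  have "br (x + y) (x + y) - br x x - br y y = br x y + br y x" by (simp add: br_simps)
  then show ?thesis
    by (metis square_in_kernel subspace_leibniz_kernel subspace_diff)
qed

lemma subspace_br_span: "subspace (br_span A B)"
  by (simp add: br_span_def)

lemma br_span_mem: "a \<in> A \<Longrightarrow> b \<in> B \<Longrightarrow> br a b \<in> br_span A B"
  unfolding br_span_def by (rule span_base) blast

lemma br_span_subset:
  "subspace W \<Longrightarrow> (\<And>a b. a \<in> A \<Longrightarrow> b \<in> B \<Longrightarrow> br a b \<in> W) \<Longrightarrow> br_span A B \<subseteq> W"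
  unfolding br_span_def by (rule span_minimal) auto

lemma abelian_iff: "abelian A \<longleftrightarrow> (\<forall>x\<in>A. \<forall>y\<in>A. br x y = 0)"
proof
  show "abelian A \<Longrightarrow> \<forall>x\<in>A. \<forall>y\<in>A. br x y = 0"
    using br_span_mem[of _ A _ A] unfolding abelian_def by blast
  assume "\<forall>x\<in>A. \<forall>y\<in>A. br x y = 0"
  then have "br_span A A \<subseteq> {0}" by (intro br_span_subset) (auto simp: subspace_single_0)
  then show "abelian A" unfolding abelian_def using subspace_0[OF subspace_br_span] by blast
qed

lemma abelian_imp_nilpotent: "abelian A \<Longrightarrow> nilpotent A"
  unfolding nilpotent_def abelian_def by (rule exI[of _ 1]) simp

lemma ideal_subspace: "ideal J \<Longrightarrow> subspace J"
  and ideal_br: "ideal J \<Longrightarrow> x \<in> J \<Longrightarrow> br x y \<in> J" "ideal J \<Longrightarrow> x \<in> J \<Longrightarrow> br y x \<in> J"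
  by (simp_all add: ideal_def)

lemma ideal_plus:
  assumes "ideal A" "ideal B"
  shows "ideal {a + b | a b. a \<in> A \<and> b \<in> B}"
  unfolding ideal_def
proof (intro conjI ballI allI)
  show "subspace {a + b | a b. a \<in> A \<and> b \<in> B}"
    using assms by (intro subspace_sums ideal_subspace)
  fix x y assume "x \<in> {a + b | a b. a \<in> A \<and> b \<in> B}"
  then obtain a b where x: "x = a + b" "a \<in> A" "b \<in> B" by blast
  have "br x y = br a y + br b y" "br y x = br y a + br y b" by (simp_all add: x br_simps)
  then show "br x y \<in> {a + b | a b. a \<in> A \<and> b \<in> B}" "br y x \<in> {a + b | a b. a \<in> A \<and> b \<in> B}"
    using ideal_br[OF assms(1) x(2)] ideal_br[OF assms(2) x(3)] by blast+
qed

lemma ideal_Int: "ideal A \<Longrightarrow> ideal B \<Longrightarrow> ideal (A \<inter> B)"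
  by (auto simp: ideal_def subspace_inter)

lemma ideal_0: "ideal {0}"
  by (simp add: ideal_def br_simps)

lemma ideal_derived: "ideal J \<Longrightarrow> ideal (br_span J J)"
proof -
  assume J: "ideal J"
  have "br_span J J \<subseteq> {v. \<forall>y. br v y \<in> br_span J J \<and> br y v \<in> br_span J J}"
  proof (rule br_span_subset)
    show "subspace {v. \<forall>y. br v y \<in> br_span J J \<and> br y v \<in> br_span J J}"
      using subspace_br_span[of J J] unfolding subspace_def by (simp add: br_simps)
    show "br a b \<in> {v. \<forall>y. br v y \<in> br_span J J \<and> br y v \<in> br_span J J}"
      if "a \<in> J" "b \<in> J" for a b
      using that ideal_br[OF J] unfolding mem_Collect_eq br_derivation[of a b] leibniz[of _ a b]
      by (intro allI conjI subspace_add subspace_diff subspace_br_span br_span_mem)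
  qed
  then show ?thesis unfolding ideal_def using subspace_br_span by blast
qed

lemma subspace_lower_central: "subspace A \<Longrightarrow> subspace (lower_central A k)"
  by (cases k) (simp_all add: subspace_br_span)

lemma lower_central_right:
  assumes "ideal A"
  shows "x \<in> lower_central A k \<Longrightarrow> br x y \<in> lower_central A k"
proof (induction k arbitrary: x y)
  case (Suc k)
  have "lower_central A (Suc k) \<subseteq> {v. \<forall>y. br v y \<in> lower_central A (Suc k)}"
    unfolding lower_central.simps(2)
  proof (rule br_span_subset)
    show "subspace {v. \<forall>y. br v y \<in> br_span (lower_central A k) A}"
      using subspace_br_span[of "lower_central A k" A] unfolding subspace_def by (simp add: br_simps)
    show "br a b \<in> {v. \<forall>y. br v y \<in> br_span (lower_central A k) A}"
      if "a \<in> lower_central A k" "b \<in> A" for a b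
      using that Suc.IH ideal_br[OF assms] unfolding mem_Collect_eq br_derivation[of a b]
      by (intro allI subspace_add subspace_br_span br_span_mem)
  qed
  then show ?case using Suc.prems by blast
qed (use assms in \<open>simp add: ideal_br\<close>)

text \<open>Only left-normed products occur in the lower central series, and such a product with \<open>i\<close>
  entries in \<open>A\<close> and \<open>j\<close> entries in \<open>B\<close> lies in \<open>A\<^sup>i \<inter> B\<^sup>j\<close>.\<close>

lemma nilpotent_plus:
  assumes A: "ideal A" "nilpotent A" and B: "ideal B" "nilpotent B"
  shows "nilpotent {a + b | a b. a \<in> A \<and> b \<in> B}"
proof -
  \<comment> \<open>The power of \<open>C\<close> with exponent \<open>i\<close>, power zero being
    the whole algebra; the shift by one undoes the indexing of \<open>lower_central\<close> from
    0.\<close>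
  define P where "P C i = (case i of 0 \<Rightarrow> UNIV | Suc i \<Rightarrow> lower_central C i)" for C i
  have P_right: "br x y \<in> P C i" if "ideal C" "x \<in> P C i" for C i x y
    using that by (cases i) (auto simp: P_def lower_central_right)
  have P_step: "br x y \<in> P C (Suc i)" if "ideal C" "x \<in> P C i" "y \<in> C" for C i x y
    using that by (cases i) (auto simp: P_def ideal_br intro: br_span_mem)
  define G where "G n = \<Union>{P A i \<inter> P B j | i j. i + j = n}" for n
  have GI: "x \<in> G n" if "x \<in> P A i" "x \<in> P B j" "i + j = n" for x i j n
    using that unfolding G_def by blast
  let ?S = "{a + b | a b. a \<in> A \<and> b \<in> B}"
  have "lower_central ?S n \<subseteq> span (G (Suc n))" for n
  proof (induction n)
    case 0
    have "a \<in> G (Suc 0)" if "a \<in> A \<or> a \<in> B" for a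
      using that
      by (auto simp: P_def intro: GI[of a 1 0] GI[of a 0 1])
    then show ?case by (auto intro!: span_add intro: span_base)
  next
    case (Suc n)
    have step: "br x a \<in> span (G (Suc (Suc n)))" if "x \<in> span (G (Suc n))" "a \<in> A \<or> a \<in> B" for x a
      using that(1)
    proof (induction rule: span_induct_alt)
      case (step c x y)
      then obtain i j where ij: "i + j = Suc n" "x \<in> P A i" "x \<in> P B j" unfolding G_def by blast
      then have "br x a \<in> P A (Suc i) \<inter> P B j \<or> br x a \<in> P A i \<inter> P B (Suc j)"
        using that(2) A(1) B(1) P_right P_step by blast
      then have "br x a \<in> G (Suc (Suc n))"
        using ij(1) GI[of "br x a" "Suc i" j] GI[of "br x a" i "Suc j"] by auto
      then have "br x a \<in> span (G (Suc (Suc n)))" by (rule span_base)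
      then show ?case using step by (simp add: br_simps span_add span_scale)
    qed (simp add: br_simps span_zero)
    show ?case unfolding lower_central.simps
    proof (rule br_span_subset)
      fix x s assume x: "x \<in> lower_central ?S n" and "s \<in> ?S"
      then obtain a b where "s = a + b" "a \<in> A" "b \<in> B" by blast
      then show "br x s \<in> span (G (Suc (Suc n)))"
        using step[of x a] step[of x b] x Suc.IH by (auto simp: br_simps intro!: span_add)
    qed simp
  qed
  note sub = this
  have zero: "P C i \<subseteq> {0}" if "lower_central C k = {0}" "k < i" for C k i
  proof -
    have "lower_central C (k + d) = {0}" for d
    proof (induction d)
      case (Suc d)
      have "br_span {0} C \<subseteq> {0}" by (rule br_span_subset) (auto simp: br_simps subspace_single_0)
      then show ?case using Suc subspace_0[OF subspace_br_span] by auto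
    qed (use that in simp)
    from this[of "i - Suc k"] show ?thesis using that(2) by (cases i) (auto simp: P_def)
  qed
  obtain k l where kl: "lower_central A k = {0}" "lower_central B l = {0}"
    using A(2) B(2) unfolding nilpotent_def by blast
  \<comment> \<open>Among \<open>k + l + 2\<close> factors at least \<open>k + 1\<close> belong to
    \<open>A\<close> or at least \<open>l + 1\<close> to \<open>B\<close>.\<close>
  have "G (Suc (k + l + 1)) \<subseteq> {0}"
  proof
    fix x assume "x \<in> G (Suc (k + l + 1))"
    then obtain i j where ij: "i + j = Suc (k + l + 1)" "x \<in> P A i" "x \<in> P B j" unfolding G_def by blast
    then have "k < i \<or> l < j" by linarith
    then show "x \<in> {0}" using zero[OF kl(1), of i] zero[OF kl(2), of j] ij(2,3) by blast
  qed
  then have "lower_central ?S (k + l + 1) \<subseteq> {0}"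
    using sub[of "k + l + 1"] span_mono[of "G (Suc (k + l + 1))" "{0}"] by (auto simp: span_0)
  moreover have "0 \<in> lower_central ?S (k + l + 1)"
    using A(1) B(1) by (intro subspace_0 subspace_lower_central subspace_sums ideal_subspace)
  ultimately show ?thesis unfolding nilpotent_def by blast
qed

lemma nilradical_greatest: "ideal nilradical \<and> nilpotent nilradical \<and>
  (\<forall>J. ideal J \<and> nilpotent J \<longrightarrow> J \<subseteq> nilradical)"
proof -
  let ?P = "\<lambda>J. ideal J \<and> nilpotent J"
  have "?P {0}" using ideal_0 abelian_imp_nilpotent by (simp add: abelian_iff br_simps)
  then obtain N where N: "?P N" "\<And>J. ?P J \<Longrightarrow> dim J \<le> dim N"
    using ex_has_greatest_nat[of ?P _ dim "Suc dimension"] dim_subset_UNIV by (metis le_imp_less_Suc)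
  have "J \<subseteq> N" if J: "?P J" for J
  proof -
    let ?S = "{a + b | a b. a \<in> N \<and> b \<in> J}"
    have S: "?P ?S" using N(1) J by (simp add: ideal_plus nilpotent_plus)
    have 0: "0 \<in> N" "0 \<in> J" using N(1) J by (auto intro: subspace_0 ideal_subspace)
    have "N \<subseteq> ?S" "J \<subseteq> ?S" using 0 by force+
    moreover have "?S = N"
      using subspace_dim_equal[of N ?S] N(2)[OF S] N(1) S \<open>N \<subseteq> ?S\<close> ideal_subspace by auto
    ultimately show ?thesis by simp
  qed
  moreover from this have "nilradical = N"
    unfolding nilradical_def by (intro Greatest_equality) (use N in auto)
  ultimately show ?thesis using N(1) by blast
qed

lemmas ideal_nilradical = nilradical_greatest[THEN conjunct1]

lemma nilpotent_nilradical: "nilpotent nilradical"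
  and nilpotent_ideal_le: "ideal J \<Longrightarrow> nilpotent J \<Longrightarrow> J \<subseteq> nilradical"
  using nilradical_greatest by blast+

lemma abelian_ideal_le: "ideal J \<Longrightarrow> abelian J \<Longrightarrow> J \<subseteq> nilradical"
  by (simp add: nilpotent_ideal_le abelian_imp_nilpotent)

lemma kernel_le_nilradical: "leibniz_kernel \<subseteq> nilradical"
  by (rule abelian_ideal_le[OF ideal_leibniz_kernel]) (simp add: abelian_iff br_leibniz_kernel_right)

lemma frattini_greatest: "ideal frattini_ideal" "maximal_subalgebra M \<Longrightarrow> frattini_ideal \<subseteq> M"
  "ideal J \<Longrightarrow> (\<And>M. maximal_subalgebra M \<Longrightarrow> J \<subseteq> M) \<Longrightarrow> J \<subseteq> frattini_ideal"
proof -
  let ?F = "{J. ideal J \<and> (\<forall>M. maximal_subalgebra M \<longrightarrow> J \<subseteq> M)}"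
  show "J \<subseteq> frattini_ideal" if "ideal J" "\<And>M. maximal_subalgebra M \<Longrightarrow> J \<subseteq> M" for J
    using that unfolding frattini_ideal_eq by (auto intro: span_base)
  show "frattini_ideal \<subseteq> M" if "maximal_subalgebra M" for M
    using that unfolding frattini_ideal_eq
    by (intro span_minimal) (auto simp: maximal_subalgebra_def subalgebra_def)
  have "span (\<Union>?F) \<subseteq> {v. \<forall>y. br v y \<in> span (\<Union>?F) \<and> br y v \<in> span (\<Union>?F)}"
  proof (rule span_minimal)
    show "\<Union>?F \<subseteq> {v. \<forall>y. br v y \<in> span (\<Union>?F) \<and> br y v \<in> span (\<Union>?F)}"
      by (auto intro!: span_base dest: ideal_br)
    show "subspace {v. \<forall>y. br v y \<in> span (\<Union>?F) \<and> br y v \<in> span (\<Union>?F)}"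
      unfolding subspace_def by (simp add: br_simps span_zero span_add span_scale)
  qed
  then show "ideal frattini_ideal" unfolding frattini_ideal_eq ideal_def by blast
qed

lemma subalgebra_plus_ideal:
  assumes "subalgebra M" "ideal J"
  shows "subalgebra {m + j | m j. m \<in> M \<and> j \<in> J}"
  unfolding subalgebra_def
proof (intro conjI ballI)
  show "subspace {m + j | m j. m \<in> M \<and> j \<in> J}"
    using assms by (intro subspace_sums) (auto simp: subalgebra_def ideal_subspace)
  fix x y assume "x \<in> {m + j | m j. m \<in> M \<and> j \<in> J}" "y \<in> {m + j | m j. m \<in> M \<and> j \<in> J}"
  then obtain m j m' j' where x: "x = m + j" "m \<in> M" "j \<in> J" and y: "y = m' + j'" "m' \<in> M" "j' \<in> J"
    by blast
  have "br x y = br m m' + (br m j' + br j y)" by (simp add: x y br_simps)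
  moreover have "br m m' \<in> M" using x y assms(1) by (simp add: subalgebra_def)
  moreover have "br m j' + br j y \<in> J"
    using x y assms(2) by (intro subspace_add ideal_subspace ideal_br)
  ultimately show "br x y \<in> {m + j | m j. m \<in> M \<and> j \<in> J}" by blast
qed

lemma maximal_subalgebraD:
  assumes "maximal_subalgebra M"
  shows "subalgebra M" "M \<noteq> UNIV" "\<And>K. subalgebra K \<Longrightarrow> M \<subseteq> K \<Longrightarrow> K = M \<or> K = UNIV"
  using assms by (simp_all add: maximal_subalgebra_def)

lemma maximal_plus_ideal:
  assumes "maximal_subalgebra M" "ideal J" "\<not> J \<subseteq> M"
  shows "\<exists>m\<in>M. \<exists>j\<in>J. v = m + j"
proof -
  define K where "K = {m + j | m j. m \<in> M \<and> j \<in> J}"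
  have M: "subalgebra M" using assms(1) by (rule maximal_subalgebraD)
  have 0: "0 \<in> M" "0 \<in> J"
    using M assms(2) by (auto simp: subalgebra_def intro: subspace_0 ideal_subspace)
  have "M \<subseteq> K" "J \<subseteq> K" using 0 unfolding K_def by force+
  moreover have "subalgebra K" unfolding K_def using M assms(2) by (rule subalgebra_plus_ideal)
  ultimately have "K = UNIV" using maximal_subalgebraD(3)[OF assms(1), of K] assms(3) by auto
  then show ?thesis unfolding K_def by blast
qed

lemma br_lower_central:
  "x \<in> lower_central A i \<Longrightarrow> y \<in> lower_central A j \<Longrightarrow> subspace A \<Longrightarrow>
    br x y \<in> lower_central A (Suc (i + j))"
proof (induction j arbitrary: i x y)
  case 0
  then show ?case by (simp add: br_span_mem)
next
  case (Suc j)
  have "lower_central A (Suc j) \<subseteq> {y. br x y \<in> lower_central A (Suc (i + Suc j))}"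
    unfolding lower_central.simps(2)[of A j]
  proof (rule br_span_subset)
    show "subspace {y. br x y \<in> lower_central A (Suc (i + Suc j))}"
      by (rule subspace_vimage[OF br_lin(2) subspace_lower_central[OF Suc.prems(3)]])
    fix a b assume ab: "a \<in> lower_central A j" "b \<in> A"
    have "br x b \<in> lower_central A (Suc i)" using Suc.prems(1) ab(2) by (simp add: br_span_mem)
    then have "br (br x b) a \<in> lower_central A (Suc (i + Suc j))"
      using Suc.IH[of "br x b" "Suc i" a] ab(1) Suc.prems(3) by simp
    moreover have "br (br x a) b \<in> lower_central A (Suc (i + Suc j))"
      using Suc.IH[OF Suc.prems(1) ab(1) Suc.prems(3)] ab(2) by (simp add: br_span_mem)
    ultimately show "br a b \<in> {y. br x y \<in> lower_central A (Suc (i + Suc j))}"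
      using subspace_diff[OF subspace_lower_central[OF Suc.prems(3)]] by (simp only: leibniz mem_Collect_eq)
  qed
  then show ?case using Suc.prems(2) by blast
qed

text \<open>A subalgebra \<open>K\<close> of a nilpotent \<open>N\<close> with \<open>N = K + [N, N]\<close> is all of \<open>N\<close>.\<close>

lemma nilpotent_derived_le_maximal:
  assumes N: "ideal N" "nilpotent N" and M: "maximal_subalgebra M"
  shows "br_span N N \<subseteq> M"
proof (rule ccontr)
  assume nle: "\<not> br_span N N \<subseteq> M"
  have Msub: "subalgebra M" using M by (simp add: maximal_subalgebra_def)
  have sN: "subspace N" and sM: "subspace M"
    using N(1) Msub by (auto simp: ideal_subspace subalgebra_def)
  let ?K = "M \<inter> N"
  have lcN: "lower_central N n \<subseteq> N" for n
  proof (induction n)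
    case (Suc n)
    show ?case unfolding lower_central.simps using ideal_br[OF N(1)] by (intro br_span_subset sN)
  qed simp
  have main: "br_span N N \<subseteq> {k + c | k c. k \<in> ?K \<and> c \<in> lower_central N (Suc n)}" for n
  proof (induction n)
    case 0
    have "0 \<in> ?K" using sM sN by (simp add: subspace_0)
    then show ?case by force
  next
    case (Suc n)
    \<comment> \<open>\<open>L = M + [N, N]\<close> by maximality, hence
      \<open>N = K + [N, N]\<close>, and the induction hypothesis refines the second summand. When
      two such sums are multiplied, everything but the product from \<open>K\<close> falls one step
      deeper.\<close>
    have dec: "\<exists>k\<in>?K. \<exists>c\<in>lower_central N (Suc n). x = k + c" if x: "x \<in> N" for x
    proof -
      obtain m p where mp: "m \<in> M" "p \<in> br_span N N" "x = m + p"
        using maximal_plus_ideal[OF M ideal_derived[OF N(1)] nle] by blast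
      obtain k c where kc: "k \<in> ?K" "c \<in> lower_central N (Suc n)" "p = k + c" using mp(2) Suc by blast
      have "p \<in> N" using mp(2) lcN[of 1] by auto
      then have "m \<in> N" using x mp(3) subspace_diff[OF sN, of x p] by simp
      then have "m + k \<in> ?K" using mp(1) kc(1) sM sN by (auto intro: subspace_add)
      moreover have "x = (m + k) + c" using mp(3) kc(3) by simp
      ultimately show ?thesis using kc(2) by blast
    qed
    show ?case
    proof (rule br_span_subset)
      show "subspace {k + c | k c. k \<in> ?K \<and> c \<in> lower_central N (Suc (Suc n))}"
        by (intro subspace_sums subspace_inter sM sN subspace_lower_central)
      fix x y assume xy: "x \<in> N" "y \<in> N"
      obtain k c where k: "k \<in> ?K" "c \<in> lower_central N (Suc n)" "x = k + c" using dec xy(1) by blast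
      obtain k' c' where k': "k' \<in> ?K" "c' \<in> lower_central N (Suc n)" "y = k' + c'" using dec xy(2) by blast
      have "br x y = br k k' + (br k c' + br c y)" by (simp add: k(3) k'(3) br_simps)
      moreover have "br k k' \<in> ?K"
        using k(1) k'(1) Msub ideal_br[OF N(1)] by (auto simp: subalgebra_def)
      moreover have "br k c' \<in> lower_central N (Suc (Suc n))"
        using br_lower_central[of k N 0 c' "Suc n"] k(1) k'(2) sN by simp
      moreover have "br c y \<in> lower_central N (Suc (Suc n))"
        using k(2) xy(2) unfolding lower_central.simps(2)[of N "Suc n"] by (rule br_span_mem)
      ultimately show "br x y \<in> {k + c | k c. k \<in> ?K \<and> c \<in> lower_central N (Suc (Suc n))}"
        using subspace_add[OF subspace_lower_central[OF sN]] by blast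
    qed
  qed
  obtain k where "lower_central N k = {0}" using N(2) nilpotent_def by blast
  then have lc0: "lower_central N (Suc k) \<subseteq> {0}"
    unfolding lower_central.simps by (intro br_span_subset) (simp_all add: br_simps subspace_single_0)
  have "br_span N N \<subseteq> ?K"
  proof
    fix x assume "x \<in> br_span N N"
    then obtain h c where "h \<in> ?K" "c \<in> lower_central N (Suc k)" "x = h + c" using main[of k] by blast
    then show "x \<in> ?K" using lc0 by auto
  qed
  then show False using nle by blast
qed

lemma phi_free_imp_nilradical_abelian:
  assumes phi_free shows "abelian nilradical"
proof -
  have "br_span nilradical nilradical \<subseteq> frattini_ideal"
    using nilpotent_derived_le_maximal[OF ideal_nilradical nilpotent_nilradical]
    by (intro frattini_greatest ideal_derived ideal_nilradical)
  then show ?thesis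
    using assms subspace_0[OF subspace_br_span] unfolding phi_free_def abelian_def by blast
qed

text \<open>A subalgebra \<open>B\<close> of least dimension with \<open>A + B = L\<close> meets \<open>A\<close> trivially, as \<open>A \<inter> B\<close> is an
  ideal and could be cut down by a maximal subalgebra not containing it.\<close>

lemma phi_free_complement:
  assumes phi_free and A: "ideal A" "abelian A"
  obtains B where "subalgebra B" "A \<inter> B = {0}" "\<And>v. \<exists>a\<in>A. \<exists>b\<in>B. v = a + b"
proof -
  let ?P = "\<lambda>B. subalgebra B \<and> (\<forall>v. \<exists>a\<in>A. \<exists>b\<in>B. v = a + b)"
  have "?P UNIV"
    using subspace_0[OF ideal_subspace[OF A(1)]] by (force simp: subalgebra_def)
  then obtain B where B: "?P B" and min: "\<And>C. ?P C \<Longrightarrow> dim B \<le> dim C"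
    using ex_has_least_nat[of ?P UNIV dim] by blast
  have sB: "subspace B" and Bbr: "\<And>x y. x \<in> B \<Longrightarrow> y \<in> B \<Longrightarrow> br x y \<in> B"
    using B by (auto simp: subalgebra_def)
  have AB: "ideal (A \<inter> B)"
    unfolding ideal_def
  proof (intro conjI ballI allI)
    show "subspace (A \<inter> B)" using sB A(1) by (simp add: subspace_inter ideal_subspace)
    fix x y assume x: "x \<in> A \<inter> B"
    obtain a b where "a \<in> A" "b \<in> B" "y = a + b" using B by blast
    then have "br x y = br x b" "br y x = br b x"
      using x A(2) by (auto simp: br_simps abelian_iff)
    then show "br x y \<in> A \<inter> B" "br y x \<in> A \<inter> B"
      using x Bbr \<open>b \<in> B\<close> ideal_br[OF A(1)] by auto
  qed
  have "A \<inter> B = {0}"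
  proof (rule ccontr)
    assume "A \<inter> B \<noteq> {0}"
    then have "\<not> A \<inter> B \<subseteq> frattini_ideal"
      using assms(1) subspace_0[OF ideal_subspace[OF AB]] unfolding phi_free_def by blast
    then obtain M where M: "maximal_subalgebra M" "\<not> A \<inter> B \<subseteq> M" using frattini_greatest(3)[OF AB] by blast
    have Msub: "subalgebra M" using M(1) by (simp add: maximal_subalgebra_def)
    \<comment> \<open>\<open>L = M + (A \<inter> B)\<close> gives
      \<open>B = (M \<inter> B) + (A \<inter> B)\<close> by the modular law, and the second summand
      is absorbed by \<open>A\<close>.\<close>
    have "?P (M \<inter> B)"
    proof (intro conjI allI)
      show "subalgebra (M \<inter> B)" using Msub B by (auto simp: subalgebra_def subspace_inter)
      fix v
      obtain a b where ab: "a \<in> A" "b \<in> B" "v = a + b" using B by blast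
      obtain m c where mc: "m \<in> M" "c \<in> A \<inter> B" "b = m + c" using maximal_plus_ideal[OF M(1) AB M(2)] by blast
      have "m \<in> B" using subspace_diff[OF sB ab(2), of c] mc by simp
      moreover have "a + c \<in> A" using ab mc A(1) by (auto intro: subspace_add ideal_subspace)
      moreover have "v = (a + c) + m" using ab mc by simp
      ultimately show "\<exists>a\<in>A. \<exists>b\<in>M \<inter> B. v = a + b" using mc(1) by blast
    qed
    then have "dim B \<le> dim (M \<inter> B)" by (rule min)
    moreover have "subspace (M \<inter> B)" using Msub sB by (simp add: subalgebra_def subspace_inter)
    ultimately have "M \<inter> B = B" using subspace_dim_equal[of "M \<inter> B" B] sB by simp
    then show False using M(2) by blast
  qed
  then show thesis using that B by blast
qed

lemma lie_subalgebraI: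
  assumes "subalgebra S" "\<And>x. x \<in> S \<Longrightarrow> br x x = 0"
  shows "lie_subalgebra S"
proof -
  have S: "br x y \<in> S" "x + y \<in> S" if "x \<in> S" "y \<in> S" for x y
    using assms(1) that by (auto simp: subalgebra_def subspace_add)
  have anti: "br x y = - br y x" if "x \<in> S" "y \<in> S" for x y
    using assms(2)[OF S(2)[OF that]] assms(2) that by (simp add: br_simps add_eq_0_iff2)
  have "br x (br y z) + br y (br z x) + br z (br x y) = 0" if "x \<in> S" "y \<in> S" "z \<in> S" for x y z
    using leibniz[of x y z] anti[of "br x y" z] anti[of "br z x" y] anti[of x z] that S
    by (simp add: br_more)
  then show ?thesis using assms unfolding lie_subalgebra_def by blast
qed

end

section \<open>Fitting's lemma and Engel's theorem\<close>

context fd_space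
begin

lemma fitting:
  assumes T: "lin T"
  obtains r q where "\<And>v. (T ^^ r) (v - T (pol q T v)) = 0"
proof -
  obtain m where m: "m \<noteq> 0" "\<And>v. pol m T v = 0" using annihilating_poly[OF T] by blast
  obtain r u where u: "m = [:0, 1:] ^ r * u" "\<not> [:0, 1:] dvd u"
    using order_decomp[OF m(1), of 0] by auto
  have "poly u 0 \<noteq> 0" using u(2) by (simp add: poly_eq_0_iff_dvd)
  then obtain a c where ac: "a * [:0, 1:] ^ 1 + c * u = 1" using bezout_X_power by blast
  have "(T ^^ r) (v - T (pol a T v)) = 0" for v
  proof -
    have "v - T (pol a T v) = pol (c * u) T v"
    proof -
      have "v = pol ([:0, 1:] * a + c * u) T v" using ac by (simp add: mult.commute)
      then have "v = T (pol a T v) + pol (c * u) T v"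
        by (simp only: pol_add[OF T] pol_mult[OF T, of "[:0, 1:]"] pol_X)
      then show ?thesis by (metis add_diff_cancel_left')
    qed
    then have "(T ^^ r) (v - T (pol a T v)) = pol (c * m) T v"
      unfolding u(1) by (metis pol_X_power[OF T] pol_mult[OF T] mult.left_commute)
    then show ?thesis by (simp add: pol_mult[OF T] m(2) lin_simps[OF lin_pol[OF T]])
  qed
  then show thesis by (rule that)
qed

end

context fd_leibniz
begin

lemma dim_less: "subspace A \<Longrightarrow> subspace B \<Longrightarrow> A \<subseteq> B \<Longrightarrow> A \<noteq> B \<Longrightarrow> dim A < dim B"
  using subspace_dim_equal[of A B] dim_subset[of A B] by fastforce

lemma subbimoduleD:
  assumes "subbimodule S A"
  shows "subspace A" "\<And>a s. a \<in> A \<Longrightarrow> s \<in> S \<Longrightarrow> br a s \<in> A" "\<And>a s. a \<in> A \<Longrightarrow> s \<in> S \<Longrightarrow> br s a \<in> A"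
  using assms by (auto simp: subbimodule_def)

text \<open>The Lie algebra \<open>H\<close> acts by right multiplication on \<open>W / U\<close>.\<close>

lemma engel:
  assumes "subalgebra H" "\<And>h. h \<in> H \<Longrightarrow> br h h = 0"
    and "\<And>h v. h \<in> H \<Longrightarrow> \<exists>n. (R h ^^ n) v = 0"
    and "subspace U" "subspace W" "U \<subset> W"
    and "\<And>u h. u \<in> U \<Longrightarrow> h \<in> H \<Longrightarrow> br u h \<in> U" "\<And>w h. w \<in> W \<Longrightarrow> h \<in> H \<Longrightarrow> br w h \<in> W"
  shows "\<exists>w\<in>W - U. \<forall>h\<in>H. br w h \<in> U"
  using assms
proof (induction "dim H" arbitrary: H U W rule: less_induct)
  case less
  note H = less.prems(1) and alt = less.prems(2) and U = less.prems(4) and W = less.prems(5)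
  have sH: "subspace H" using H by (simp add: subalgebra_def)
  show ?case
  proof (cases "H = {0}")
    case True
    then show ?thesis using less.prems(6) subspace_0[OF U] by (auto simp: br_simps)
  next
    case False
    let ?P = "\<lambda>M. subalgebra M \<and> M \<subset> H"
    have "?P {0}" using False subspace_0[OF sH] by (auto simp: subalgebra_def br_simps subspace_single_0)
    then obtain M where M: "?P M" and max: "\<And>K. ?P K \<Longrightarrow> dim K \<le> dim M"
      using ex_has_greatest_nat[of ?P _ dim "Suc dimension"] dim_subset_UNIV by (metis le_imp_less_Suc)
    have sM: "subspace M" and Mbr: "\<And>x y. x \<in> M \<Longrightarrow> y \<in> M \<Longrightarrow> br x y \<in> M" and MH: "M \<subseteq> H"
      using M by (auto simp: subalgebra_def)
    have dM: "dim M < dim H" using M sM sH dim_less by blast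
    have IH: "\<exists>w\<in>W - U. \<forall>h\<in>M. br w h \<in> U"
      if "subspace U" "subspace W" "U \<subset> W" "\<And>u h. u \<in> U \<Longrightarrow> h \<in> M \<Longrightarrow> br u h \<in> U"
        "\<And>w h. w \<in> W \<Longrightarrow> h \<in> M \<Longrightarrow> br w h \<in> W" for U W
      using that MH M alt less.prems(3) by (intro less.hyps[OF dM]) auto
    \<comment> \<open>The induction hypothesis for \<open>M\<close> acting on \<open>H / M\<close>
      yields an element that normalizes \<open>M\<close>; by maximality it spans \<open>H\<close>
      together with \<open>M\<close>.\<close>
    have "\<exists>h\<in>H - M. \<forall>m\<in>M. br h m \<in> M"
      using sM sH M MH Mbr H by (intro IH) (auto simp: subalgebra_def)
    then obtain h where h: "h \<in> H" "h \<notin> M" "\<And>m. m \<in> M \<Longrightarrow> br h m \<in> M" by blast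
    define K where "K = {m + scale c h | m c. m \<in> M}"
    have KH: "K \<subseteq> H" unfolding K_def using MH h(1) sH by (auto intro: subspace_add subspace_scale)
    have sK: "subspace K"
    proof -
      have "K = {a + b | a b. a \<in> M \<and> b \<in> span {h}}" unfolding K_def by (auto simp: span_singleton)
      then show ?thesis using subspace_sums[OF sM subspace_span] by simp
    qed
    have "M \<subseteq> K" unfolding K_def using scale_zero_left[of h] by force
    have "h = 0 + scale 1 h" by simp
    then have "h \<in> K" unfolding K_def using subspace_0[OF sM] by blast
    have mh: "br m h \<in> M" if "m \<in> M" for m
    proof -
      have "br (m + h) (m + h) = 0" "br m m = 0" "br h h = 0"
        using that MH h(1) alt sH by (auto intro: subspace_add)
      then have "br m h = - br h m" by (simp add: br_simps add_eq_0_iff2)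
      then show ?thesis using h(3)[OF that] subspace_neg[OF sM] by simp
    qed
    have "subalgebra K"
      unfolding subalgebra_def
    proof (intro conjI ballI sK)
      fix x y assume "x \<in> K" "y \<in> K"
      then obtain m c m' c' where "x = m + scale c h" "y = m' + scale c' h" "m \<in> M" "m' \<in> M"
        unfolding K_def by blast
      then have "br x y = br m m' + scale c' (br m h) + scale c (br h m')"
        using alt[OF h(1)] by (simp add: br_simps)
      then have "br x y \<in> M"
        using \<open>m \<in> M\<close> \<open>m' \<in> M\<close> Mbr mh h(3) by (auto intro!: subspace_add[OF sM] subspace_scale[OF sM])
      then show "br x y \<in> K" using \<open>M \<subseteq> K\<close> by blast
    qed
    have "K = H"
    proof (rule ccontr)
      assume "K \<noteq> H"
      then have "dim K \<le> dim M" using max \<open>subalgebra K\<close> KH by blast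
      then show False
        using dim_less[OF sM sK \<open>M \<subseteq> K\<close>] h(2) \<open>h \<in> K\<close> by auto
    qed
    \<comment> \<open>The vectors killed by \<open>M\<close> modulo \<open>U\<close>; they are
      stable under \<open>h\<close> because \<open>h\<close> normalizes \<open>M\<close>. The last
      iterate of \<open>h\<close> on \<open>w\<close> outside \<open>U\<close> is then killed by
      \<open>H\<close> modulo \<open>U\<close>.\<close>
    define V where "V = {w \<in> W. \<forall>m\<in>M. br w m \<in> U}"
    obtain w where w: "w \<in> V" "w \<notin> U"
      using IH[OF U W less.prems(6)] less.prems(7,8) MH unfolding V_def by blast
    have Vh: "br x h \<in> V" if "x \<in> V" for x
      unfolding V_def
    proof (intro CollectI conjI ballI)
      show "br x h \<in> W" using that less.prems(8) h(1) unfolding V_def by blast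
      fix m assume "m \<in> M"
      then show "br (br x h) m \<in> U"
        unfolding br_derivation[of x h m]
        using that h(1,3) less.prems(7) unfolding V_def by (auto intro!: subspace_add[OF U])
    qed
    let ?T = "R h"
    obtain n where "(?T ^^ n) w = 0" using less.prems(3) h(1) by blast
    then have "\<exists>n. (?T ^^ n) w \<in> U" using subspace_0[OF U] by metis
    then obtain n where n: "(?T ^^ n) w \<in> U" "\<And>i. i < n \<Longrightarrow> (?T ^^ i) w \<notin> U"
      using exists_least_iff[of "\<lambda>n. (?T ^^ n) w \<in> U"] by blast
    then obtain i where i: "n = Suc i" using w(2) by (cases n) auto
    define x where "x = (?T ^^ i) w"
    have x: "x \<notin> U" "br x h \<in> U" using n i by (auto simp: x_def)
    have "(?T ^^ j) w \<in> V" for j by (induction j) (simp_all add: w(1) Vh)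
    then have xV: "x \<in> V" unfolding x_def by blast
    have "br x k \<in> U" if "k \<in> H" for k
    proof -
      have "k \<in> K" using that \<open>K = H\<close> by simp
      then obtain m c where "m \<in> M" "k = m + scale c h" unfolding K_def by blast
      then show ?thesis using xV x(2) unfolding V_def
        by (auto simp: br_simps intro!: subspace_add[OF U] subspace_scale[OF U])
    qed
    then show ?thesis using x(1) xV unfolding V_def by blast
  qed
qed

lemma engel_center:
  assumes "subalgebra H" "\<And>h. h \<in> H \<Longrightarrow> br h h = 0"
    and "\<And>h v. h \<in> H \<Longrightarrow> \<exists>n. (R h ^^ n) v = 0" and "H \<noteq> {0}"
  obtains w where "w \<in> H" "w \<noteq> 0" "\<And>h. h \<in> H \<Longrightarrow> br w h = 0"
proof -
  have "subspace H" using assms(1) by (simp add: subalgebra_def)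
  moreover from this have "{0} \<subset> H" using assms(4) subspace_0 by blast
  ultimately have "\<exists>w\<in>H - {0}. \<forall>h\<in>H. br w h \<in> {0}"
    using assms(1) by (intro engel[OF assms(1-3)]) (auto simp: subspace_single_0 br_simps subalgebra_def)
  then show thesis using that by blast
qed

lemma lie_antisym:
  assumes "lie_subalgebra S" "x \<in> S" "y \<in> S"
  shows "br x y = - br y x"
proof -
  have "subspace S" and *: "\<And>x. x \<in> S \<Longrightarrow> br x x = 0"
    using assms(1) by (auto simp: lie_subalgebra_def subalgebra_def)
  then have "br (x + y) (x + y) = 0" "br x x = 0" "br y y = 0"
    using assms(2,3) by (auto intro: subspace_add)
  then show ?thesis by (simp add: br_simps add_eq_0_iff2)
qed

lemma funpow_derivation_0:
  assumes "\<And>b c. D (br b c) = br (D b) c + br b (D c)" and D: "lin D"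
    and "(D ^^ i) b = 0" "(D ^^ j) c = 0"
  shows "(D ^^ (i + j)) (br b c) = 0"
  using assms(3,4)
proof (induction "i + j" arbitrary: i j b c)
  case 0
  then show ?case by (simp add: br_simps)
next
  case (Suc n)
  note lD = lin_simps[OF lin_funpow[OF D]]
  show ?case
  proof (cases "i = 0 \<or> j = 0")
    case True
    then have "br b c = 0" using Suc.prems by (auto simp: br_simps)
    then show ?thesis by (simp add: lD)
  next
    case False
    then obtain i' j' where ij: "i = Suc i'" "j = Suc j'" by (meson not0_implies_Suc)
    have "(D ^^ (i' + j)) (br (D b) c) = 0" "(D ^^ (i + j')) (br b (D c)) = 0"
      using Suc.hyps(1)[of i' j "D b" c] Suc.hyps(1)[of i j' b "D c"] Suc.hyps(2) Suc.prems
      by (simp_all add: ij funpow_swap1)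
    moreover have "i' + j = n" "i + j' = n" using Suc.hyps(2) ij by auto
    ultimately have "(D ^^ n) (D (br b c)) = 0" by (simp only: assms(1) lD) simp
    then show ?thesis unfolding Suc.hyps(2)[symmetric] funpow_Suc_right comp_apply .
  qed
qed

section \<open>Maximal subalgebras and \<phi>-freeness of almost reductive algebras\<close>

lemma subalgebra_le_maximal:
  assumes "subalgebra A" "A \<noteq> UNIV"
  obtains M where "maximal_subalgebra M" "A \<subseteq> M"
proof -
  let ?P = "\<lambda>M. subalgebra M \<and> M \<noteq> UNIV \<and> A \<subseteq> M"
  obtain M where M: "?P M" and max: "\<And>K. ?P K \<Longrightarrow> dim K \<le> dim M"
    using ex_has_greatest_nat[of ?P A dim "Suc dimension"] dim_subset_UNIV assms
    by (metis le_imp_less_Suc order_refl)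
  have "maximal_subalgebra M"
    unfolding maximal_subalgebra_def
  proof (intro conjI allI impI)
    fix K assume "subalgebra K \<and> M \<subseteq> K"
    then have K: "subalgebra K" "M \<subseteq> K" by auto
    show "K = M \<or> K = UNIV"
    proof (rule ccontr)
      assume ne: "\<not> ?thesis"
      have "A \<subseteq> K" using K(2) M by blast
      with ne have "dim K \<le> dim M" "dim M < dim K"
        using max[of K] dim_less[of M K] K M by (auto simp: subalgebra_def)
      then show False by simp
    qed
  qed (use M in auto)
  then show thesis using that M by blast
qed

text \<open>By Fitting's lemma \<open>L\<close> is the sum of the null component of a right multiplication by \<open>x\<close>, which
  is a subalgebra, and of \<open>[L, x]\<close>.\<close>

lemma frattini_nilpotent:
  assumes x: "x \<in> frattini_ideal"
  shows "\<exists>n. (R x ^^ n) v = 0"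
proof -
  let ?T = "R x"
  note T = br_lin(1)[of x]
  define A where "A = {v. \<exists>n. (?T ^^ n) v = 0}"
  have more: "(?T ^^ (n + k)) v = 0" if "(?T ^^ n) v = 0" for n k v
    using that by (simp add: add.commute[of n] funpow_add lin_simps[OF lin_funpow[OF T]])
  have "subalgebra A" unfolding subalgebra_def subspace_def
  proof (intro conjI ballI allI)
    show "0 \<in> A" unfolding A_def by (auto intro: exI[of _ 0])
    fix v w c assume "v \<in> A"
    then obtain n where n: "(?T ^^ n) v = 0" unfolding A_def by blast
    then show "scale c v \<in> A"
      unfolding A_def by (auto simp: lin_simps[OF lin_funpow[OF T]] intro!: exI[of _ n])
    assume "w \<in> A"
    then obtain k where k: "(?T ^^ k) w = 0" unfolding A_def by blast
    have "(?T ^^ (n + k)) (v + w) = 0"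
      using more[OF n, of k] more[OF k, of n] by (simp add: lin_simps[OF lin_funpow[OF T]] add.commute)
    then show "v + w \<in> A" unfolding A_def by blast
    have "(?T ^^ (n + k)) (br v w) = 0"
      by (rule funpow_derivation_0[OF br_derivation T n k])
    then show "br v w \<in> A" unfolding A_def by blast
  qed
  have "A = UNIV"
  proof (rule ccontr)
    assume "A \<noteq> UNIV"
    then obtain M where M: "maximal_subalgebra M" "A \<subseteq> M"
      using subalgebra_le_maximal \<open>subalgebra A\<close> by blast
    obtain r q where rq: "\<And>v. (?T ^^ r) (v - ?T (pol q ?T v)) = 0" using fitting[OF T] by blast
    have "v \<in> M" for v
    proof -
      have "v - ?T (pol q ?T v) \<in> M" using rq M(2) unfolding A_def by blast
      \<comment> \<open>A product with factor \<open>x\<close> lies in the Frattini ideal, hence in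
        \<open>M\<close>.\<close>
      moreover have "?T (pol q ?T v) \<in> M"
        using ideal_br(2)[OF frattini_greatest(1) x] frattini_greatest(2)[OF M(1)] by blast
      moreover have "subspace M" using maximal_subalgebraD(1)[OF M(1)] by (simp add: subalgebra_def)
      ultimately show ?thesis using subspace_add by fastforce
    qed
    then show False using maximal_subalgebraD(2)[OF M(1)] by blast
  qed
  then show ?thesis unfolding A_def by blast
qed

text \<open>Membership in the span of the other summands kills the component of \<open>n\<close> in
  \<open>A\<close>. The family is an arbitrary set, but \<open>n\<close> lives in finitely many
  summands, whose components are removed one at a time.\<close>

lemma direct_sum_of_eq_0:
  assumes "direct_sum_of \<A> N" "n \<in> N" and "\<And>A. A \<in> \<A> \<Longrightarrow> n \<in> span (\<Union>(\<A> - {A}))"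
    and sub: "\<And>A. A \<in> \<A> \<Longrightarrow> subspace A"
  shows "n = 0"
proof -
  have "n \<in> span (\<Union>\<A>)" using assms(1,2) by (simp add: direct_sum_of_def)
  then obtain T where T: "finite T" "T \<subseteq> \<Union>\<A>" "n \<in> span T"
    unfolding span_explicit by (auto intro: span_sum span_scale span_base)
  then obtain \<F> where "finite \<F>" "\<F> \<subseteq> \<A>" "T \<subseteq> \<Union>\<F>" by (meson finite_subset_Union)
  then have "finite \<F>" "\<F> \<subseteq> \<A>" "n \<in> span (\<Union>\<F>)" using T(3) span_mono by blast+
  then show ?thesis
  proof (induction \<F> rule: finite_induct)
    case (insert A \<F>)
    have "span (\<Union>(insert A \<F>)) = {x + y | x y. x \<in> span A \<and> y \<in> span (\<Union>\<F>)}"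
      by (simp add: span_Un)
    moreover have "span A = A" using sub insert.prems(1) by (simp add: span_eq_iff)
    ultimately obtain a y where ay: "a \<in> A" "y \<in> span (\<Union>\<F>)" "n = a + y"
      using insert.prems(2) by auto
    have "span (\<Union>\<F>) \<subseteq> span (\<Union>(\<A> - {A}))" using insert by (intro span_mono) auto
    then have "a \<in> span (\<Union>(\<A> - {A}))"
      using ay assms(3)[of A] insert.prems(1) span_diff[of n _ y] by auto
    then have "a = 0" using ay(1) assms(1) insert.prems(1) unfolding direct_sum_of_def by blast
    then show ?case using ay insert by simp
  qed simp
qed

lemma almost_reductive_phi_free:
  assumes almost_reductive "abelian nilradical"
  shows phi_free
proof -
  obtain S where S: "lie_subalgebra S" and NS: "nilradical \<inter> S = {0}"
    and dec: "{n + s | n s. n \<in> nilradical \<and> s \<in> S} = UNIV" and cr: "completely_reducible S nilradical"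
    using assms(1) unfolding almost_reductive_def by blast
  obtain \<A> where irr: "\<And>A. A \<in> \<A> \<Longrightarrow> irreducible_subbimodule S A" and ds: "direct_sum_of \<A> nilradical"
    using cr unfolding completely_reducible_def by blast
  have sS: "subspace S" and Sbr: "\<And>x y. x \<in> S \<Longrightarrow> y \<in> S \<Longrightarrow> br x y \<in> S" and SS: "subalgebra S"
    using S by (auto simp: lie_subalgebra_def subalgebra_def)
  have sN: "subspace nilradical" by (rule ideal_subspace[OF ideal_nilradical])
  have Nab: "br x y = 0" if "x \<in> nilradical" "y \<in> nilradical" for x y
    using assms(2) that by (simp add: abelian_iff)
  have sA: "subbimodule S A" if "A \<in> \<A>" for A
    using irr[OF that] by (simp add: irreducible_subbimodule_def)
  have spanN: "span (\<Union>\<B>) \<subseteq> nilradical" if "\<B> \<subseteq> \<A>" for \<B>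
    using that ds span_mono[of "\<Union>\<B>" "\<Union>\<A>"] unfolding direct_sum_of_def by blast
  have ideal_span: "ideal (span (\<Union>\<B>))" if \<B>: "\<B> \<subseteq> \<A>" for \<B>
    unfolding ideal_def
  proof (intro conjI ballI allI)
    have act: "br x s \<in> span (\<Union>\<B>) \<and> br s x \<in> span (\<Union>\<B>)" if "x \<in> span (\<Union>\<B>)" "s \<in> S" for x s
      using that(1)
    proof (induction rule: span_induct_alt)
      case (step c x y)
      then obtain A where A: "A \<in> \<B>" "x \<in> A" by blast
      then have "br x s \<in> A" "br s x \<in> A" using subbimoduleD(2,3)[OF sA] \<B> that(2) by auto
      then have "br x s \<in> span (\<Union>\<B>)" "br s x \<in> span (\<Union>\<B>)" using A(1) by (auto intro: span_base)
      then show ?case using step by (simp add: br_simps span_add span_scale)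
    qed (simp add: br_simps span_zero)
    fix x y assume x: "x \<in> span (\<Union>\<B>)"
    obtain n s where "y = n + s" "n \<in> nilradical" "s \<in> S" using dec by blast
    then show "br x y \<in> span (\<Union>\<B>)" "br y x \<in> span (\<Union>\<B>)"
      using act[OF x] Nab x spanN[OF \<B>] by (auto simp: br_simps)
  qed simp
  let ?R = "\<lambda>A. span (\<Union>(\<A> - {A}))"
  \<comment> \<open>\<open>S\<close> together with all summands but \<open>A\<close>. A subalgebra
    above it meets \<open>A\<close> in a subbimodule, which is \<open>{0}\<close> or
    \<open>A\<close> by irreducibility; this gives maximality. All these subalgebras together
    intersect in \<open>S\<close>.\<close>
  let ?M = "\<lambda>A. {s + n | s n. s \<in> S \<and> n \<in> ?R A}"
  have max: "maximal_subalgebra (?M A)" if A: "A \<in> \<A>" for A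
    unfolding maximal_subalgebra_def
  proof (intro conjI allI impI)
    have A0: "A \<inter> ?R A = {0}" using ds A by (simp add: direct_sum_of_def)
    have AN: "A \<subseteq> nilradical" using spanN[of "{A}"] A span_superset[of A] by auto
    have sA': "subspace A" using subbimoduleD(1)[OF sA[OF A]] .
    have id: "ideal (?R A)" by (rule ideal_span) blast
    show "subalgebra (?M A)" by (rule subalgebra_plus_ideal[OF SS id])
    show "?M A \<noteq> UNIV"
    proof
      assume "?M A = UNIV"
      obtain a where a: "a \<in> A" "a \<noteq> 0"
        using irr[OF A] subspace_0[OF sA'] unfolding irreducible_subbimodule_def by blast
      then obtain s n where sn: "a = s + n" "s \<in> S" "n \<in> ?R A"
        using \<open>?M A = UNIV\<close> by blast
      then have "a - n \<in> nilradical" using a(1) AN spanN[of "\<A> - {A}"] subspace_diff[OF sN] by blast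
      then have "s \<in> nilradical \<inter> S" using sn by simp
      then have "s = 0" using NS by blast
      then show False using sn a A0 by auto
    qed
    fix K assume K: "subalgebra K \<and> ?M A \<subseteq> K"
    have sK: "subspace K" using K by (simp add: subalgebra_def)
    have SK: "S \<subseteq> ?M A" "?R A \<subseteq> ?M A"
      using span_zero subspace_0[OF sS] by force+
    have "S \<subseteq> K" using SK K by blast
    then have "subbimodule S (A \<inter> K)"
      using subbimoduleD[OF sA[OF A]] K by (auto simp: subbimodule_def subalgebra_def subspace_inter)
    then have "A \<inter> K = {0} \<or> A \<inter> K = A" using irr[OF A] unfolding irreducible_subbimodule_def by blast
    moreover have dec': "\<exists>m\<in>?M A. \<exists>a\<in>A. v = m + a" for v
    proof -
      obtain n s where ns: "v = n + s" "n \<in> nilradical" "s \<in> S" using dec by blast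
      have "nilradical = span (A \<union> \<Union>(\<A> - {A}))"
        using ds A unfolding direct_sum_of_def by (metis Union_insert insert_Diff)
      also have "\<dots> = {x + y | x y. x \<in> A \<and> y \<in> ?R A}"
        using sA' by (simp add: span_Un span_eq_iff[THEN iffD2])
      finally obtain a y where ay: "n = a + y" "a \<in> A" "y \<in> ?R A"
        using ns(2) by blast
      then have "s + y \<in> ?M A" "v = (s + y) + a" using ns by auto
      then show ?thesis using ay(2) by blast
    qed
    ultimately show "K = ?M A \<or> K = UNIV"
    proof (elim disjE)
      assume 0: "A \<inter> K = {0}"
      have "K \<subseteq> ?M A"
      proof
        fix v assume v: "v \<in> K"
        obtain m a where ma: "m \<in> ?M A" "a \<in> A" "v = m + a" using dec' by blast
        then have "a \<in> K" using subspace_diff[OF sK v, of m] K by auto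
        then have "a = 0" using 0 ma(2) by blast
        then show "v \<in> ?M A" using ma(1,3) by simp
      qed
      then show ?thesis using K by blast
    next
      assume A: "A \<inter> K = A"
      have "v \<in> K" for v
      proof -
        obtain m a where "m \<in> ?M A" "a \<in> A" "v = m + a" using dec' by blast
        then have "m \<in> K" "a \<in> K" using K A by blast+
        then show ?thesis using \<open>v = m + a\<close> subspace_add[OF sK] by simp
      qed
      then show ?thesis by blast
    qed
  qed
  let ?F = frattini_ideal
  have FS: "?F \<subseteq> S"
  proof
    fix x assume x: "x \<in> ?F"
    obtain n s where ns: "x = n + s" "n \<in> nilradical" "s \<in> S" using dec by blast
    have "n = 0"
    proof (rule direct_sum_of_eq_0[OF ds ns(2)])
      show "subspace A" if "A \<in> \<A>" for A by (rule subbimoduleD(1)[OF sA[OF that]])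
      fix A assume A: "A \<in> \<A>"
      then obtain s' n' where sn: "x = s' + n'" "s' \<in> S" "n' \<in> ?R A"
        using frattini_greatest(2)[OF max] x by blast
      then have "n - n' \<in> nilradical" using ns spanN[of "\<A> - {A}"] subspace_diff[OF sN] by blast
      moreover have "n - n' = s' - s" using ns sn by (simp add: algebra_simps)
      ultimately have "n - n' \<in> nilradical \<inter> S" using subspace_diff[OF sS sn(2) ns(3)] by simp
      then show "n \<in> ?R A" using NS sn(3) by auto
    qed
    then show "x \<in> S" using ns by simp
  qed
  note F = frattini_greatest(1)
  have "?F = {0}"
  proof (rule ccontr)
    assume "?F \<noteq> {0}"
    have "subalgebra ?F" using F by (auto simp: subalgebra_def ideal_def)
    moreover have "br h h = 0" if "h \<in> ?F" for h using that FS S by (auto simp: lie_subalgebra_def)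
    ultimately obtain w where w: "w \<in> ?F" "w \<noteq> 0" "\<And>h. h \<in> ?F \<Longrightarrow> br w h = 0"
      using engel_center[OF _ _ frattini_nilpotent \<open>?F \<noteq> {0}\<close>] by blast
    define Z where "Z = {w \<in> ?F. \<forall>h\<in>?F. br w h = 0}"
    have "ideal Z" unfolding ideal_def
    proof (intro conjI ballI allI)
      show "subspace Z" using ideal_subspace[OF F] unfolding Z_def subspace_def by (auto simp: br_simps)
      fix z y assume z: "z \<in> Z"
      then have "br (br z y) h = 0" if "h \<in> ?F" for h
        using that ideal_br[OF F] unfolding Z_def by (auto simp: br_derivation[of z y h] br_simps)
      moreover have "br (br y z) h = 0" if "h \<in> ?F" for h
      proof -
        \<comment> \<open>Both factors lie in the Frattini ideal and so in \<open>S\<close>, where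
          the product is antisymmetric; this settles the left multiples of \<open>z\<close>.\<close>
        have "br (br y h) z = - br z (br y h)"
          using that z ideal_br[OF F] FS unfolding Z_def by (intro lie_antisym[OF S]) auto
        then show ?thesis
          using that z ideal_br[OF F] unfolding Z_def by (auto simp: br_derivation[of y z h] br_simps)
      qed
      ultimately show "br z y \<in> Z" "br y z \<in> Z" using z ideal_br[OF F] unfolding Z_def by auto
    qed
    moreover have "abelian Z" unfolding Z_def abelian_iff by auto
    ultimately have "Z \<subseteq> nilradical" by (rule abelian_ideal_le)
    moreover have "w \<in> Z" using w unfolding Z_def by blast
    ultimately show False using w NS FS by blast
  qed
  then show ?thesis by (simp add: phi_free_def)
qed

end

text \<open>As \<open>N\<close> is abelian, the ideals contained in it are its \<open>S\<close>-subbimodules, so \<open>complement\<close> is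
  complete reducibility.\<close>

locale split_leibniz = fd_leibniz scale br Basis
  for scale :: "'f::field_char_0 \<Rightarrow> 'a::ab_group_add \<Rightarrow> 'a" and br :: "'a \<Rightarrow> 'a \<Rightarrow> 'a" and Basis +
  fixes N S :: "'a set"
  assumes N: "ideal N" "abelian N" and abelian_le: "ideal J \<Longrightarrow> abelian J \<Longrightarrow> J \<subseteq> N"
    and S: "lie_subalgebra S" and NS: "N \<inter> S = {0}"
    and split: "\<exists>n\<in>N. \<exists>s\<in>S. v = n + s"
    and complement: "ideal A \<Longrightarrow> A \<subseteq> N \<Longrightarrow>
      \<exists>C. ideal C \<and> C \<subseteq> N \<and> A \<inter> C = {0} \<and> (\<forall>n\<in>N. \<exists>a\<in>A. \<exists>c\<in>C. n = a + c)"

text \<open>A subalgebra \<open>S\<close> complementing the nilradical is Lie because squares lie in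
  the Leibniz kernel, which is inside the nilradical. For an ideal \<open>A\<close> inside the
  nilradical, a complementing subalgebra is intersected with the nilradical; as the latter is
  abelian, the result is an ideal.\<close>

lemma (in fd_leibniz) phi_free_split:
  assumes phi_free
  obtains S where "split_leibniz scale br Basis nilradical S"
proof -
  note ab = phi_free_imp_nilradical_abelian[OF assms]
  have Nab: "br x y = 0" if "x \<in> nilradical" "y \<in> nilradical" for x y
    using ab that by (simp add: abelian_iff)
  obtain S where S: "subalgebra S" "nilradical \<inter> S = {0}" "\<And>v. \<exists>a\<in>nilradical. \<exists>b\<in>S. v = a + b"
    using phi_free_complement[OF assms ideal_nilradical ab] by blast
  have "split_leibniz scale br Basis nilradical S"
  proof unfold_locales
    show "lie_subalgebra S"
    proof (rule lie_subalgebraI[OF S(1)])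
      fix x assume "x \<in> S"
      then have "br x x \<in> nilradical \<inter> S"
        using S(1) square_in_kernel kernel_le_nilradical unfolding subalgebra_def by blast
      then show "br x x = 0" using S(2) by blast
    qed
    show "\<exists>C. ideal C \<and> C \<subseteq> nilradical \<and> A \<inter> C = {0} \<and> (\<forall>n\<in>nilradical. \<exists>a\<in>A. \<exists>c\<in>C. n = a + c)"
      if A: "ideal A" "A \<subseteq> nilradical" for A
    proof -
      have "abelian A" using A(2) Nab unfolding abelian_iff by blast
      then obtain B where B: "subalgebra B" "A \<inter> B = {0}" "\<And>v. \<exists>a\<in>A. \<exists>b\<in>B. v = a + b"
        using phi_free_complement[OF assms A(1)] by blast
      have "ideal (nilradical \<inter> B)" unfolding ideal_def
      proof (intro conjI ballI allI)
        show "subspace (nilradical \<inter> B)"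
          using B(1) ideal_subspace[OF ideal_nilradical] by (simp add: subalgebra_def subspace_inter)
        fix x y assume x: "x \<in> nilradical \<inter> B"
        obtain a b where "y = a + b" "a \<in> A" "b \<in> B" using B(3) by blast
        then have "br x y = br x b" "br y x = br b x" using x A(2) Nab by (auto simp: br_simps)
        then show "br x y \<in> nilradical \<inter> B" "br y x \<in> nilradical \<inter> B"
          using x B(1) \<open>b \<in> B\<close> ideal_br[OF ideal_nilradical] by (auto simp: subalgebra_def)
      qed
      moreover have "\<exists>a\<in>A. \<exists>c\<in>nilradical \<inter> B. n = a + c" if n: "n \<in> nilradical" for n
      proof -
        obtain a b where ab: "a \<in> A" "b \<in> B" "n = a + b" using B(3) by blast
        then have "b \<in> nilradical"
          using subspace_diff[OF ideal_subspace[OF ideal_nilradical] n, of a] A(2) by auto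
        then show ?thesis using ab by blast
      qed
      ultimately show ?thesis
        using B(2) subspace_0[OF ideal_subspace[OF ideal_nilradical]]
        by (intro exI[of _ "nilradical \<inter> B"]) auto
    qed
  qed (use S ab ideal_nilradical abelian_ideal_le in auto)
  then show thesis by (rule that)
qed

section \<open>Complete reducibility of the nilradical\<close>

context split_leibniz
begin

lemma N_br: "x \<in> N \<Longrightarrow> y \<in> N \<Longrightarrow> br x y = 0"
  using N(2) by (simp add: abelian_iff)

lemma sN: "subspace N" and sS: "subspace S" and S_br: "x \<in> S \<Longrightarrow> y \<in> S \<Longrightarrow> br x y \<in> S"
  and subalgebra_S: "subalgebra S"
  using N(1) S by (auto simp: ideal_subspace lie_subalgebra_def subalgebra_def)

lemma ideal_if_subbimodule:
  assumes "subbimodule S A" "A \<subseteq> N" shows "ideal A"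
  unfolding ideal_def
proof (intro conjI ballI allI)
  show "subspace A" using assms(1) by (rule subbimoduleD)
  fix x y assume x: "x \<in> A"
  obtain n s where "n \<in> N" "s \<in> S" "y = n + s" using split by blast
  then show "br x y \<in> A" "br y x \<in> A"
    using subbimoduleD(2,3)[OF assms(1) x] N_br x assms(2) by (auto simp: br_simps)
qed

lemma ideal_imp_subbimodule: "ideal A \<Longrightarrow> subbimodule S A"
  by (auto simp: ideal_def subbimodule_def)

text \<open>A nonzero subbimodule \<open>A\<close> of least dimension is irreducible and is split
  off. Complements are given in \<open>N\<close>, whereas the induction runs through smaller ideals
  \<open>W\<close>; the modular law cuts the complement down to \<open>C \<inter> W\<close>.\<close>

lemma completely_reducible_N: "completely_reducible S N"
proof -
  have "completely_reducible S W" if "ideal W" "W \<subseteq> N" for W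
    using that
  proof (induction "dim W" arbitrary: W rule: less_induct)
    case less
    note sW = ideal_subspace[OF less.prems(1)]
    show ?case
    proof (cases "W = {0}")
      case True
      then show ?thesis unfolding completely_reducible_def direct_sum_of_def by (intro exI[of _ "{}"]) simp
    next
      case False
      let ?P = "\<lambda>A. subbimodule S A \<and> A \<noteq> {0} \<and> A \<subseteq> W"
      have "?P W" using False less.prems(1) by (simp add: ideal_imp_subbimodule)
      then obtain A where A: "?P A" and min: "\<And>B. ?P B \<Longrightarrow> dim A \<le> dim B"
        using ex_has_least_nat[of ?P W dim] by blast
      have sA: "subspace A" using A subbimoduleD by blast
      have irr: "irreducible_subbimodule S A"
        unfolding irreducible_subbimodule_def
      proof (intro conjI allI impI)
        fix B assume B: "subbimodule S B \<and> B \<subseteq> A"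
        show "B = {0} \<or> B = A"
        proof (rule ccontr)
          assume "\<not> ?thesis"
          then have "dim A \<le> dim B" "dim B < dim A"
            using min[of B] B A dim_less[of B A] sA subbimoduleD(1) by auto
          then show False by simp
        qed
      qed (use A in auto)
      have "ideal A" using A less.prems(2) by (intro ideal_if_subbimodule) auto
      have "A \<subseteq> N" using A less.prems(2) by blast
      obtain C where "ideal C \<and> C \<subseteq> N \<and> A \<inter> C = {0} \<and> (\<forall>n\<in>N. \<exists>a\<in>A. \<exists>c\<in>C. n = a + c)"
        using complement[OF \<open>ideal A\<close> \<open>A \<subseteq> N\<close>] by (rule exE)
      then have C: "ideal C" "C \<subseteq> N" "A \<inter> C = {0}" "\<And>n. n \<in> N \<Longrightarrow> \<exists>a\<in>A. \<exists>c\<in>C. n = a + c"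
        by auto
      let ?V = "C \<inter> W"
      have sV: "subspace ?V" using C(1) sW by (simp add: subspace_inter ideal_subspace)
      have "?V \<noteq> W" using A C(3) subspace_0[OF sA] by blast
      then have "dim ?V < dim W" using sV sW by (intro dim_less) auto
      then have "completely_reducible S ?V"
        using C less.prems by (intro less.hyps ideal_Int) auto
      then obtain \<A> where \<A>: "\<And>B. B \<in> \<A> \<Longrightarrow> irreducible_subbimodule S B" "direct_sum_of \<A> ?V"
        unfolding completely_reducible_def by blast
      have V: "?V = span (\<Union>\<A>)" and ds: "\<And>B. B \<in> \<A> \<Longrightarrow> B \<inter> span (\<Union>(\<A> - {B})) = {0}"
        using \<A>(2) by (auto simp: direct_sum_of_def)
      have AV: "A \<inter> span (\<Union>\<A>) = {0}"
        unfolding V[symmetric] using C(3) subspace_0[OF sV] by blast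
      have "A \<notin> \<A>"
      proof
        assume "A \<in> \<A>"
        then have "A \<subseteq> span (\<Union>\<A>)" using span_superset by blast
        then show False using AV A by blast
      qed
      have spanA: "span A = A" using sA by (simp add: span_eq_iff)
      have "direct_sum_of (insert A \<A>) W"
        unfolding direct_sum_of_def
      proof (intro conjI ballI)
        have "W \<subseteq> {a + v | a v. a \<in> A \<and> v \<in> ?V}"
        proof
          fix w assume w: "w \<in> W"
          then obtain a c where ac: "a \<in> A" "c \<in> C" "w = a + c" using C(4) less.prems(2) by blast
          then have "c \<in> W" using subspace_diff[OF sW w, of a] A by auto
          then show "w \<in> {a + v | a v. a \<in> A \<and> v \<in> ?V}" using ac by blast
        qed
        moreover have "{a + v | a v. a \<in> A \<and> v \<in> ?V} \<subseteq> W" using A by (auto intro: subspace_add[OF sW])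
        ultimately show "W = span (\<Union>(insert A \<A>))" unfolding Union_insert span_Un spanA V by blast
        fix B assume "B \<in> insert A \<A>"
        then show "B \<inter> span (\<Union>(insert A \<A> - {B})) = {0}"
        proof
          assume "B = A"
          then show ?thesis using \<open>A \<notin> \<A>\<close> AV by simp
        next
          assume B: "B \<in> \<A>"
          have eq: "insert A \<A> - {B} = insert A (\<A> - {B})" using B \<open>A \<notin> \<A>\<close> by blast
          have sB: "subspace B" using \<A>(1)[OF B] subbimoduleD(1) by (auto simp: irreducible_subbimodule_def)
          have "x = 0" if x: "x \<in> B" "x \<in> span (\<Union>(insert A (\<A> - {B})))" for x
          proof -
            obtain a y where ay: "x = a + y" "a \<in> A" "y \<in> span (\<Union>(\<A> - {B}))"
              using x(2) spanA by (auto simp: span_Un)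
            have "y \<in> span (\<Union>\<A>)" using ay(3) span_mono[of "\<Union>(\<A> - {B})" "\<Union>\<A>"] by blast
            moreover have "x \<in> span (\<Union>\<A>)" using x(1) B by (auto intro: span_base)
            ultimately have "a \<in> span (\<Union>\<A>)" using ay(1) span_diff[of x _ y] by auto
            then have "a = 0" using ay(2) AV by blast
            then show ?thesis using ay x(1) ds[OF B] by auto
          qed
          then show ?thesis unfolding eq using subspace_0[OF sB] span_zero by blast
        qed
      qed
      then show ?thesis
        unfolding completely_reducible_def using irr \<A>(1) by (intro exI[of _ "insert A \<A>"]) auto
    qed
  qed
  then show ?thesis using N(1) by blast
qed

end

lemma (in fd_leibniz) phi_free_almost_reductive:
  assumes phi_free shows almost_reductive
proof -
  obtain S where "split_leibniz scale br Basis nilradical S" using phi_free_split[OF assms] by blast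
  then interpret split_leibniz scale br Basis nilradical S .
  have "v \<in> {n + s | n s. n \<in> nilradical \<and> s \<in> S}" for v using split[of v] by blast
  then show ?thesis
    unfolding almost_reductive_def using S NS completely_reducible_N by (intro exI[of _ S]) auto
qed

section \<open>Cartan's criterion\<close>

context fd_space
begin

lemma pol_intertwine:
  assumes "lin T" "lin T'" "lin A" "\<And>v. A (T v) = T' (A v)"
  shows "A (pol p T v) = pol p T' (A v)"
  by (induction p) (simp_all add: pol_pCons lin_simps assms)

lemma funpow_intertwine:
  assumes "\<And>v. A (T v) = T' (A v)"
  shows "A ((T ^^ k) v) = (T' ^^ k) (A v)"
  by (induction k) (simp_all add: assms)

text \<open>On a vector killed by a power of \<open>T\<close>, the operator
  \<open>s(T) = T - (T - s(T))\<close> is a difference of commuting nilpotent operators, hence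
  nilpotent there; separability makes it zero.\<close>

lemma semisimple_part_ker:
  assumes T: "lin T" and uw: "u * pderiv f + w * f = 1" and f: "\<And>v. pol f (pol s T) v = 0"
    and k: "\<And>v. ((\<lambda>v. T v - pol s T v) ^^ k) v = 0" and "(T ^^ n) v = 0"
  shows "pol s T v = 0"
proof (rule separable_ker[OF lin_pol[OF T] uw f])
  let ?M = "\<lambda>v. T v - pol s T v"
  have M: "lin ?M" by (rule lin_diff[OF T lin_pol[OF T]])
  have "((\<lambda>v. - ?M v) ^^ k) v = 0" using funpow_uminus[OF M, of k v] k by simp
  then have "((\<lambda>v. T v + - ?M v) ^^ (n + k)) v = 0"
    using pol_commute[OF T T] by (intro nilpotent_add[OF T lin_uminus[OF M] _ assms(5)]) (simp add: lin_simps[OF T])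
  then show "(pol s T ^^ (n + k)) v = 0" by simp
qed

lemma trace_nilpotent_commute:
  assumes M: "lin M" and Q: "lin Q" and MQ: "\<And>v. M (Q v) = Q (M v)" and k: "\<And>v. (M ^^ k) v = 0"
  shows "trace (\<lambda>v. M (Q v)) = 0"
proof (rule trace_nilpotent[OF lin_compose[OF M Q]])
  have "((\<lambda>v. M (Q v)) ^^ j) v = (M ^^ j) ((Q ^^ j) v)" for j v
  proof (induction j)
    case (Suc j)
    have "Q ((M ^^ j) y) = (M ^^ j) (Q y)" for y by (rule lin_funpow_commute) (rule MQ[symmetric])
    with Suc show ?case by simp
  qed simp
  then show "((\<lambda>v. M (Q v)) ^^ k) v = 0" for v by (simp add: k)
qed

end

context fd_leibniz
begin

text \<open>The trace form of the action on all of \<open>L\<close> by right multiplication. The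
  Killing form of \<open>S\<close> would only see the action of \<open>S\<close> on itself and not
  the one on \<open>N\<close>.\<close>

definition killing :: "'a \<Rightarrow> 'a \<Rightarrow> 'f" where "killing x y = trace (\<lambda>v. br (br v x) y)"

lemma killing_simps:
  "killing (x + x') y = killing x y + killing x' y" "killing (x - x') y = killing x y - killing x' y"
  "killing (scale c x) y = c * killing x y" "killing 0 y = 0"
  "killing x (y + y') = killing x y + killing x y'" "killing x (scale c y) = c * killing x y"
  "killing x 0 = 0"
  unfolding killing_def by (simp_all add: br_more trace_simps)

lemma killing_invariant: "killing (br a b) c = killing a (br b c)"
proof -
  have "trace (\<lambda>v. br (br (br v b) a) c) = trace (\<lambda>v. br (br (br v a) c) b)"
    by (rule trace_commute[OF lin_compose[OF br_lin(1) br_lin(1)] br_lin(1)])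
  then show ?thesis
    unfolding killing_def leibniz by (simp add: br_more trace_simps)
qed

text \<open>Right multiplication by \<open>[a, b]\<close> is a commutator of those by
  \<open>a\<close> and \<open>b\<close>, and \<open>C\<close> commutes with the one by
  \<open>a\<close>; so the composite is a commutator as well and has trace zero.\<close>

lemma trace_commutator:
  assumes C: "lin C" and comm: "\<And>a v. a \<in> A \<Longrightarrow> C (br v a) = br (C v) a" and "u \<in> br_span A B"
  shows "trace (\<lambda>v. br (C v) u) = 0"
  using assms(3) unfolding br_span_def
proof (induction rule: span_induct_alt)
  case base
  then show ?case by (simp add: br_simps trace_simps)
next
  case (step c x y)
  then obtain a b where ab: "x = br a b" "a \<in> A" by blast
  have "trace (\<lambda>v. br (C (br v a)) b) = trace (\<lambda>v. br (br (C v) b) a)"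
    by (rule trace_commute[OF lin_compose[OF br_lin(1) C] br_lin(1)])
  moreover have "trace (\<lambda>v. br (C (br v a)) b) = trace (\<lambda>v. br (br (C v) a) b)"
    by (rule trace_cong) (simp only: comm[OF ab(2)])
  moreover have "trace (\<lambda>v. br (C v) x) = trace (\<lambda>v. br (br (C v) a) b) - trace (\<lambda>v. br (br (C v) b) a)"
    unfolding ab(1) leibniz[of _ a b] by (rule trace_simps(2))
  ultimately have "trace (\<lambda>v. br (C v) x) = 0" by simp
  then show ?case using step by (simp add: br_simps trace_simps)
qed

text \<open>It suffices that the semisimple part \<open>E\<close> of \<open>R x\<close> is zero. For
  an additive \<open>\<phi>\<close>, the composite of the corresponding replica of \<open>E\<close>
  with \<open>R x\<close> has trace zero, as \<open>x\<close> is in \<open>[P, P]\<close> and the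
  form vanishes on \<open>P\<close>; thus the sum of \<open>mult l * (l * \<phi> l)\<close> over the
  eigenvalues is zero. A rational functional for \<open>\<phi>\<close> turns this into a sum of
  rational squares.\<close>

lemma cartan_criterion:
  assumes P: "subalgebra P" "P \<subseteq> br_span P P"
    and kill: "\<And>x y. x \<in> P \<Longrightarrow> y \<in> P \<Longrightarrow> killing x y = 0" and x: "x \<in> P"
  shows "\<exists>k. \<forall>v. (R x ^^ k) v = 0"
proof -
  let ?D = "R x"
  note D = br_lin(1)[of x]
  have sP: "subspace P" using P(1) by (simp add: subalgebra_def)
  obtain u f w s k where uw: "u * pderiv f + w * f = 1" and f: "\<And>v. pol f (pol s ?D) v = 0"
    and k: "\<And>v. ((\<lambda>v. ?D v - pol s ?D v) ^^ k) v = 0"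
    by (rule jordan_decomposition[OF D]) (rule that)
  define E where "E = pol s ?D"
  define M where "M = (\<lambda>v. ?D v - E v)"
  have E: "lin E" unfolding E_def by (rule lin_pol[OF D])
  have M: "lin M" unfolding M_def by (rule lin_diff[OF D E])
  have fE: "pol f E v = 0" and Mk: "(M ^^ k) v = 0" for v using f k by (simp_all add: E_def M_def)
  have DE: "E (?D v) = ?D (E v)" for v unfolding E_def by (rule pol_commute[OF D D, symmetric]) simp
  have ME: "M (E v) = E (M v)" for v unfolding M_def using DE by (simp add: lin_simps[OF E])
  have der: "E (br b c) = br (E b) c + br b (E c)" for b c
    unfolding E_def by (rule derivation_semisimple_part[OF br_lin(2,1) D br_derivation uw f k])
  have EP: "(E ^^ i) y \<in> P" if "y \<in> P" for i y
  proof (induction i)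
    case (Suc i)
    then show ?case unfolding E_def
      using pol_in_subspace[OF D sP _ Suc] P(1) x by (simp add: E_def subalgebra_def)
  qed (simp add: that)
  define \<Lambda> where "\<Lambda> = {l. poly (ac_poly f) l = 0}"
  have \<Lambda>: "finite \<Lambda>" unfolding \<Lambda>_def by (rule finite_ac_roots[OF uw])
  obtain mult where mult: "\<And>q. (\<Sum>i\<le>degree q. coeff q i * to_ac (trace (E ^^ i)))
      = (\<Sum>l | poly (ac_poly f) l = 0. of_nat (mult l) * poly q l)"
    and E0: "\<And>v. \<forall>l. poly (ac_poly f) l = 0 \<longrightarrow> l \<noteq> 0 \<longrightarrow> mult l = 0 \<Longrightarrow> E v = 0"
    by (rule trace_weights[OF E uw fE]) (rule that)
  note mult = mult[folded \<Lambda>_def]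
  have main: "(\<Sum>l\<in>\<Lambda>. of_nat (mult l) * (l * \<phi> l)) = 0"
    if \<phi>: "\<And>x y. \<phi> (x + y) = \<phi> x + \<phi> y" for \<phi>
  proof -
    define p where "p = (\<Sum>l\<in>\<Lambda>. smult (\<phi> l) (lagrange \<Lambda> l))"
    have p: "poly p l = \<phi> l" if "poly (ac_poly f) l = 0" for l
      using poly_sum_lagrange[OF \<Lambda>, of l \<phi>] that by (simp add: p_def \<Lambda>_def)
    \<comment> \<open>The trace of the replica \<open>p(E)\<close> followed by right multiplication
      by \<open>y\<close>. As \<open>p\<close> has coefficients in the closure, traces are taken for
      each power of \<open>E\<close> and combined afterwards.\<close>
    define F where "F y = (\<Sum>i\<le>degree p. coeff p i * to_ac (trace (\<lambda>v. br ((E ^^ i) v) y)))" for y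
    have F_add: "F (scale c y + z) = to_ac c * F y + F z" for c y z
      by (simp add: F_def br_simps trace_simps sum.distrib sum_distrib_left algebra_simps)
    \<comment> \<open>Cyclicity turns this into the trace of \<open>p(E) R_b - R_b p(E)\<close>
      followed by right multiplication by \<open>a\<close>. As the replica is a derivation, the
      difference is right multiplication by \<open>p(E) b\<close>, which leaves a combination of
      values of the form on \<open>P\<close>.\<close>
    have F_br: "F (br a b) = 0" if ab: "a \<in> P" "b \<in> P" for a b
    proof -
      have tr: "trace (\<lambda>v. br ((E ^^ i) v) (br a b))
          = (\<Sum>e\<in>Basis. crd (br ((E ^^ i) (br e b)) a) e - crd (br (br ((E ^^ i) e) b) a) e)" for i
      proof -
        have "trace (\<lambda>v. br (br ((E ^^ i) v) a) b) = trace (\<lambda>v. br ((E ^^ i) (br v b)) a)"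
          by (rule trace_commute[OF br_lin(1) lin_compose[OF br_lin(1) lin_funpow[OF E]]])
        then show ?thesis by (simp add: leibniz trace_simps) (simp add: trace_def sum_subtractf)
      qed
      have rep: "(\<Sum>i\<le>degree p. coeff p i * to_ac (crd (br ((E ^^ i) (br e b)) a) e))
        = (\<Sum>i\<le>degree p. coeff p i * to_ac (crd (br (br ((E ^^ i) e) b) a) e))
        + (\<Sum>i\<le>degree p. coeff p i * to_ac (crd (br (br e ((E ^^ i) b)) a) e))" for e
        by (rule derivation_replica[OF br_lin(2,1) br_lin(1) E der uw fE \<phi> p])
      have "F (br a b) = (\<Sum>i\<le>degree p. \<Sum>e\<in>Basis. coeff p i * to_ac (crd (br ((E ^^ i) (br e b)) a) e)
          - coeff p i * to_ac (crd (br (br ((E ^^ i) e) b) a) e))"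
        unfolding F_def tr by (simp add: to_ac_sum sum_distrib_left right_diff_distrib)
      also have "\<dots> = (\<Sum>e\<in>Basis. \<Sum>i\<le>degree p. coeff p i * to_ac (crd (br ((E ^^ i) (br e b)) a) e)
          - coeff p i * to_ac (crd (br (br ((E ^^ i) e) b) a) e))"
        by (rule sum.swap)
      also have "\<dots> = (\<Sum>e\<in>Basis. \<Sum>i\<le>degree p. coeff p i * to_ac (crd (br (br e ((E ^^ i) b)) a) e))"
        by (simp add: sum_subtractf rep)
      also have "\<dots> = (\<Sum>i\<le>degree p. \<Sum>e\<in>Basis. coeff p i * to_ac (crd (br (br e ((E ^^ i) b)) a) e))"
        by (rule sum.swap)
      also have "\<dots> = (\<Sum>i\<le>degree p. coeff p i * to_ac (killing ((E ^^ i) b) a))"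
        by (simp add: killing_def trace_def to_ac_sum sum_distrib_left)
      also have "\<dots> = 0" using kill[OF EP[OF ab(2)] ab(1)] by simp
      finally show ?thesis .
    qed
    have "F y = 0" if "y \<in> br_span P P" for y
      using that unfolding br_span_def
    proof (induction rule: span_induct_alt)
      case base
      then show ?case by (simp add: F_def br_simps trace_simps)
    next
      case (step c y z)
      then show ?case using F_br by (auto simp: F_add)
    qed
    then have "F x = 0" using x P(2) by blast
    moreover have "trace (\<lambda>v. br ((E ^^ i) v) x) = trace (E ^^ Suc i)" for i
    proof -
      have "trace (\<lambda>v. M ((E ^^ i) v)) = 0"
        using lin_funpow_commute[of M E i] ME
        by (intro trace_nilpotent_commute[OF M lin_funpow[OF E] _ Mk]) simp
      then have "trace (\<lambda>v. br ((E ^^ i) v) x - E ((E ^^ i) v)) = 0" by (simp add: M_def)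
      then show ?thesis by (simp add: trace_simps trace_def)
    qed
    ultimately have "(\<Sum>i\<le>degree p. coeff p i * to_ac (trace (E ^^ Suc i))) = 0" by (simp add: F_def)
    \<comment> \<open>\<open>pCons 0 p\<close> is X times \<open>p\<close>: it accounts for the
      extra factor \<open>E\<close> and takes the value \<open>l * \<phi> l\<close> at an eigenvalue
      \<open>l\<close>.\<close>
    moreover have "(\<Sum>i\<le>degree (pCons 0 p). coeff (pCons 0 p) i * to_ac (trace (E ^^ i)))
        = (\<Sum>i\<le>degree p. coeff p i * to_ac (trace (E ^^ Suc i)))"
    proof (cases "p = 0")
      case False
      then show ?thesis
        by (subst degree_pCons_eq, assumption, subst sum.atMost_Suc_shift) simp
    qed simp
    ultimately have "(\<Sum>l\<in>\<Lambda>. of_nat (mult l) * poly (pCons 0 p) l) = 0"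
      unfolding mult[of "pCons 0 p", symmetric] by (simp only:)
    then show ?thesis using p by (simp add: \<Lambda>_def)
  qed
  have "mult a = 0" if a: "a \<in> \<Lambda>" "a \<noteq> 0" for a
  proof -
    \<comment> \<open>With \<open>\<phi> l = of_rat (\<psi> l)\<close>, applying
      \<open>\<psi>\<close> once more to \<open>main\<close> gives a vanishing sum of nonnegative
      rationals, whose term at \<open>a\<close> is \<open>mult a\<close>.\<close>
    obtain \<psi> :: "'f alg_closure \<Rightarrow> rat" where \<psi>: "\<And>x y. \<psi> (x + y) = \<psi> x + \<psi> y"
      "\<And>q x. \<psi> (of_rat q * x) = q * \<psi> x" "\<psi> a = 1"
      using ex_rational_functional[OF a(2)] by blast
    have "\<psi> 0 = 0" using \<psi>(2)[of 0 0] by simp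
    then have \<psi>_sum: "\<psi> (\<Sum>l\<in>A. g l) = (\<Sum>l\<in>A. \<psi> (g l))" for A g
      by (induction A rule: infinite_finite_induct) (simp_all add: \<psi>(1))
    have "\<psi> (of_nat (mult l) * (l * of_rat (\<psi> l))) = of_nat (mult l) * (\<psi> l * \<psi> l)" for l
      using \<psi>(2)[of "of_nat (mult l) * \<psi> l" l] by (simp add: of_rat_mult ac_simps)
    then have "(\<Sum>l\<in>\<Lambda>. of_nat (mult l) * (\<psi> l * \<psi> l)) = \<psi> (\<Sum>l\<in>\<Lambda>. of_nat (mult l) * (l * of_rat (\<psi> l)))"
      by (simp add: \<psi>_sum)
    also have "\<dots> = 0"
      using main[of "\<lambda>l. of_rat (\<psi> l)"] \<psi>(1) \<open>\<psi> 0 = 0\<close> by (simp add: of_rat_add)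
    finally have "of_nat (mult a) * (\<psi> a * \<psi> a) = 0"
      using a(1) \<Lambda> by (subst (asm) sum_nonneg_eq_0_iff) auto
    then show ?thesis by (simp add: \<psi>(3))
  qed
  then have "E v = 0" for v using E0 by (simp add: \<Lambda>_def)
  then have "M = ?D" by (simp add: M_def)
  then show ?thesis using Mk by auto
qed

end

section \<open>The Lie algebra complementing the nilradical\<close>

context split_leibniz
begin

lemma kernel_le_N: "leibniz_kernel \<subseteq> N"
  by (rule abelian_le[OF ideal_leibniz_kernel]) (simp add: abelian_iff br_leibniz_kernel_right)

lemma S_anti: "x \<in> S \<Longrightarrow> y \<in> S \<Longrightarrow> br x y = - br y x"
  by (rule lie_antisym[OF S])

lemma split_unique: "n \<in> N \<Longrightarrow> n' \<in> N \<Longrightarrow> s \<in> S \<Longrightarrow> s' \<in> S \<Longrightarrow> n + s = n' + s' \<Longrightarrow> n = n'"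
proof -
  assume *: "n \<in> N" "n' \<in> N" "s \<in> S" "s' \<in> S" "n + s = n' + s'"
  then have "n - n' = s' - s" by (simp add: algebra_simps)
  then have "n - n' \<in> N \<inter> S" using * subspace_diff[OF sN] subspace_diff[OF sS] by (metis IntI)
  then show ?thesis using NS by auto
qed

text \<open>Projection onto \<open>N\<close> along \<open>S\<close>. It commutes with right
  multiplication by elements of \<open>S\<close>, so that module operators on \<open>N\<close>
  extend by zero to \<open>L\<close> and traces over \<open>L\<close> apply to them.\<close>

definition proj :: "'a \<Rightarrow> 'a" where "proj v = (THE n. n \<in> N \<and> (\<exists>s\<in>S. v = n + s))"

lemma proj_eq: "n \<in> N \<Longrightarrow> s \<in> S \<Longrightarrow> proj (n + s) = n"
  unfolding proj_def by (rule the_equality) (auto dest: split_unique)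

lemma proj_N [simp]: "n \<in> N \<Longrightarrow> proj n = n"
  using proj_eq[of n 0] subspace_0[OF sS] by simp

lemma proj_in [simp]: "proj v \<in> N"
  using split[of v] proj_eq by auto

lemma lin_proj: "lin proj"
proof (rule linI)
  fix x y c
  obtain n s m t where nsmt: "x = n + s" "y = m + t" "n \<in> N" "s \<in> S" "m \<in> N" "t \<in> S"
    using split[of x] split[of y] by blast
  have *: "x + y = (n + m) + (s + t)" "scale c x = scale c n + scale c s"
    using nsmt by (simp_all add: scale_right_distrib)
  have "proj x = n" "proj y = m" unfolding nsmt(1,2) using nsmt(3-6) by (simp_all only: proj_eq)
  moreover have "proj (x + y) = n + m" "proj (scale c x) = scale c n"
    unfolding * using nsmt(3-6) sN sS by (auto intro!: proj_eq subspace_add subspace_scale)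
  ultimately show "proj (x + y) = proj x + proj y" "proj (scale c x) = scale c (proj x)"
    by simp_all
qed

lemma proj_br: "a \<in> S \<Longrightarrow> proj (br v a) = br (proj v) a"
proof -
  assume a: "a \<in> S"
  obtain n s where ns: "v = n + s" "n \<in> N" "s \<in> S" using split[of v] by blast
  then have "br v a = br n a + br s a" by (simp add: br_simps)
  then show ?thesis using ns a proj_eq ideal_br[OF N(1)] S_br by simp
qed

definition kernel_compl :: "'a set" where
  "kernel_compl = (SOME C. ideal C \<and> C \<subseteq> N \<and> leibniz_kernel \<inter> C = {0} \<and>
     (\<forall>n\<in>N. \<exists>i\<in>leibniz_kernel. \<exists>c\<in>C. n = i + c))"

lemma kernel_compl:
  "ideal kernel_compl" "kernel_compl \<subseteq> N" "leibniz_kernel \<inter> kernel_compl = {0}"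
  "n \<in> N \<Longrightarrow> \<exists>i\<in>leibniz_kernel. \<exists>c\<in>kernel_compl. n = i + c"
  using someI_ex[OF complement[OF ideal_leibniz_kernel kernel_le_N]]
  unfolding kernel_compl_def[symmetric] by auto

lemma br_kernel_compl: "c \<in> kernel_compl \<Longrightarrow> br v c = - br c v"
proof -
  assume "c \<in> kernel_compl"
  then have "br v c + br c v \<in> leibniz_kernel \<inter> kernel_compl"
    using br_anticomm_kernel ideal_br[OF kernel_compl(1)]
      subspace_add[OF ideal_subspace[OF kernel_compl(1)]] by blast
  then show ?thesis using kernel_compl(3) by (simp add: eq_neg_iff_add_eq_0)
qed

text \<open>The left action of \<open>S\<close> on \<open>N\<close> vanishes on the Leibniz kernel and is the negative of the right
  action on a complement of it.\<close>

lemma left_action_0: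
  assumes "\<And>n. n \<in> N \<Longrightarrow> br n s = 0" and "n \<in> N" shows "br s n = 0"
proof -
  obtain i c where "i \<in> leibniz_kernel" "c \<in> kernel_compl" "n = i + c"
    using kernel_compl(4)[OF assms(2)] by blast
  then show ?thesis
    using kernel_compl(2) assms(1)[of c] by (auto simp: br_simps br_leibniz_kernel_right br_kernel_compl)
qed

text \<open>Since \<open>[s, i + c] = -[c, s]\<close>, stability under the right action implies
  stability under the left one as soon as \<open>K\<close> contains the \<open>kernel_compl\<close>
  components of its elements.\<close>

lemma ideal_if_right_action:
  assumes K: "subspace K" "K \<subseteq> N" "\<And>n s. n \<in> K \<Longrightarrow> s \<in> S \<Longrightarrow> br n s \<in> K"
    and KC: "\<And>i c. i \<in> leibniz_kernel \<Longrightarrow> c \<in> kernel_compl \<Longrightarrow> i + c \<in> K \<Longrightarrow> c \<in> K"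
  shows "ideal K"
proof (rule ideal_if_subbimodule[OF _ K(2)])
  show "subbimodule S K" unfolding subbimodule_def
  proof (intro conjI ballI K(1))
    fix n s assume n: "n \<in> K" and s: "s \<in> S"
    show "br n s \<in> K" using n s by (rule K(3))
    obtain i c where ic: "i \<in> leibniz_kernel" "c \<in> kernel_compl" "n = i + c"
      using kernel_compl(4) n K(2) by blast
    then have "c \<in> K" using KC n by blast
    moreover have "br s n = - br c s" using ic by (simp add: br_simps br_leibniz_kernel_right br_kernel_compl)
    ultimately show "br s n \<in> K" using K(3)[OF _ s] subspace_neg[OF K(1)] by simp
  qed
qed

text \<open>The kernel \<open>K\<close> of \<open>T\<close> in \<open>N\<close> is an ideal. On an
  ideal complementing it in \<open>N\<close>, the operator is injective and nilpotent, so this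
  complement is zero. The assumption \<open>pres\<close> makes \<open>T\<close> respect that
  complement as well as the splitting of \<open>N\<close> by the Leibniz kernel, on which the left
  action depends.\<close>

lemma nilpotent_central_0:
  assumes T: "lin T" and pres: "\<And>A n. ideal A \<Longrightarrow> A \<subseteq> N \<Longrightarrow> n \<in> A \<Longrightarrow> T n \<in> A"
    and comm: "\<And>n s. n \<in> N \<Longrightarrow> s \<in> S \<Longrightarrow> T (br n s) = br (T n) s"
    and nil: "\<And>n. n \<in> N \<Longrightarrow> \<exists>k. (T ^^ k) n = 0" and n: "n \<in> N"
  shows "T n = 0"
proof -
  define K where "K = {n \<in> N. T n = 0}"
  have "ideal K"
  proof (rule ideal_if_right_action)
    show "subspace K" unfolding K_def using subspace_inter[OF sN subspace_ker[OF T]] by (simp add: Int_def)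
    show "br n s \<in> K" if "n \<in> K" "s \<in> S" for n s
      using that comm ideal_br[OF N(1)] by (auto simp: K_def br_simps)
    show "c \<in> K" if "i \<in> leibniz_kernel" "c \<in> kernel_compl" "i + c \<in> K" for i c
    proof -
      have "T i = - T c" using that(3) by (simp add: K_def lin_simps[OF T] eq_neg_iff_add_eq_0)
      then have "T c \<in> leibniz_kernel \<inter> kernel_compl"
        using pres[OF ideal_leibniz_kernel kernel_le_N that(1)] pres[OF kernel_compl(1,2) that(2)]
          subspace_neg[OF subspace_leibniz_kernel, of "T i"] by simp
      then show ?thesis using kernel_compl(2,3) that(2) by (auto simp: K_def)
    qed
  qed (auto simp: K_def)
  moreover have "K \<subseteq> N" by (auto simp: K_def)
  ultimately obtain D where D: "ideal D" "D \<subseteq> N" "K \<inter> D = {0}" "\<And>n. n \<in> N \<Longrightarrow> \<exists>a\<in>K. \<exists>c\<in>D. n = a + c"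
    using complement[of K] by metis
  have "d = 0" if "(T ^^ k) d = 0" "d \<in> D" for k d
    using that
  proof (induction k arbitrary: d)
    case (Suc k)
    then have "T d = 0" using pres[OF D(1,2)] by (simp add: funpow_swap1)
    then have "d \<in> K \<inter> D" using Suc.prems(2) D(2) by (auto simp: K_def)
    then show ?case using D(3) by blast
  qed simp
  then have D0: "d = 0" if "d \<in> D" for d using nil[of d] D(2) that by blast
  obtain a d where "a \<in> K" "d \<in> D" "n = a + d" using D(4)[OF n] by blast
  then have "n \<in> K" using D0[of d] by simp
  then show ?thesis by (simp add: K_def)
qed

section \<open>Ideals of the Lie algebra \<open>S\<close> and its reductive structure\<close>

definition sideal :: "'a set \<Rightarrow> bool" where
  "sideal B \<longleftrightarrow> subspace B \<and> B \<subseteq> S \<and> (\<forall>b\<in>B. \<forall>s\<in>S. br b s \<in> B)"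

lemma sidealD:
  assumes "sideal B"
  shows "subspace B" "B \<subseteq> S" "\<And>b s. b \<in> B \<Longrightarrow> s \<in> S \<Longrightarrow> br b s \<in> B"
    "\<And>b s. b \<in> B \<Longrightarrow> s \<in> S \<Longrightarrow> br s b \<in> B" "subalgebra B"
proof -
  show *: "subspace B" "B \<subseteq> S" "\<And>b s. b \<in> B \<Longrightarrow> s \<in> S \<Longrightarrow> br b s \<in> B"
    using assms by (auto simp: sideal_def)
  show "br s b \<in> B" if "b \<in> B" "s \<in> S" for b s
    using S_anti[of s b] that * subspace_neg[OF *(1)] by auto
  show "subalgebra B" using * by (auto simp: subalgebra_def)
qed

lemma sideal_br_span:
  assumes A: "sideal A" and B: "sideal B"
  shows "sideal (br_span A B)"
  unfolding sideal_def
proof (intro conjI)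
  show "subspace (br_span A B)" by (rule subspace_br_span)
  show "br_span A B \<subseteq> S" using sidealD(2)[OF A] sidealD(2)[OF B] S_br by (intro br_span_subset sS) auto
  have "br_span A B \<subseteq> {v. \<forall>s\<in>S. br v s \<in> br_span A B}"
  proof (rule br_span_subset)
    show "subspace {v. \<forall>s\<in>S. br v s \<in> br_span A B}"
      using subspace_br_span[of A B] unfolding subspace_def by (simp add: br_simps)
    show "br a b \<in> {v. \<forall>s\<in>S. br v s \<in> br_span A B}" if "a \<in> A" "b \<in> B" for a b
      using that sidealD(3)[OF A] sidealD(3)[OF B] unfolding mem_Collect_eq br_derivation[of a b]
      by (intro ballI subspace_add subspace_br_span br_span_mem)
  qed
  then show "\<forall>b\<in>br_span A B. \<forall>s\<in>S. br b s \<in> br_span A B" by blast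
qed

lemma sideal_S: "sideal S"
  using sS S_br by (auto simp: sideal_def)

lemma sideal_br_span_le: "sideal B \<Longrightarrow> A \<subseteq> S \<Longrightarrow> br_span B A \<subseteq> B"
  using sidealD by (intro br_span_subset) auto

text \<open>Acting trivially on \<open>N\<close>, such a \<open>B\<close> is an abelian ideal of
  \<open>L\<close>, hence inside \<open>N\<close>, which meets \<open>S\<close> only in 0.\<close>

lemma trivial_action_0:
  assumes B: "sideal B" "abelian B" and triv: "\<And>n b. n \<in> N \<Longrightarrow> b \<in> B \<Longrightarrow> br n b = 0" and "b \<in> B"
  shows "b = 0"
proof -
  have "ideal B" unfolding ideal_def
  proof (intro conjI ballI allI)
    show "subspace B" by (rule sidealD[OF B(1)])
    fix b y assume b: "b \<in> B"
    obtain n s where "y = n + s" "n \<in> N" "s \<in> S" using split by blast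
    then show "br b y \<in> B" "br y b \<in> B"
      using b triv left_action_0[of b n] sidealD(3,4)[OF B(1) b] by (auto simp: br_simps)
  qed
  then have "B \<subseteq> N" using abelian_le B(2) by blast
  then show ?thesis using sidealD(2)[OF B(1)] NS assms(4) by blast
qed

text \<open>\<open>\<rho>\<close> is the action of \<open>b\<close> on \<open>N\<close>, extended by
  zero. It commutes with right multiplication by \<open>A\<close>, so
  \<open>trace_commutator\<close> applies to every positive power of \<open>\<rho>\<close>; with all
  these traces zero, \<open>\<rho>\<close> is nilpotent.\<close>

lemma nilpotent_action:
  assumes b: "b \<in> S" "b \<in> br_span A B" and A: "A \<subseteq> S" and comm: "\<And>a. a \<in> A \<Longrightarrow> br a b = 0"
  shows "\<exists>k. \<forall>n\<in>N. (R b ^^ k) n = 0"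
proof -
  define \<rho> where "\<rho> v = br (proj v) b" for v
  have \<rho>: "lin \<rho>" unfolding \<rho>_def by (rule lin_compose[OF br_lin(1) lin_proj])
  have \<rho>a: "\<rho> (br v a) = br (\<rho> v) a" if "a \<in> A" for v a
    using that A comm[OF that] by (auto simp: \<rho>_def proj_br br_derivation[of "proj v" a b] br_simps)
  have "trace (\<rho> ^^ Suc k) = 0" for k
  proof -
    have "trace (\<lambda>v. br (proj ((\<rho> ^^ k) v)) b) = 0"
    proof (rule trace_commutator[OF lin_compose[OF lin_proj lin_funpow[OF \<rho>]] _ b(2)])
      fix a v assume a: "a \<in> A"
      have "(\<rho> ^^ k) (br v a) = br ((\<rho> ^^ k) v) a"
        using \<rho>a[OF a] by (induction k) simp_all
      then show "proj ((\<rho> ^^ k) (br v a)) = br (proj ((\<rho> ^^ k) v)) a" using a A by (auto simp: proj_br)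
    qed
    moreover have "\<rho> ^^ Suc k = (\<lambda>v. br (proj ((\<rho> ^^ k) v)) b)" by (auto simp: \<rho>_def)
    ultimately show ?thesis by simp
  qed
  then obtain k where k: "\<And>v. (\<rho> ^^ k) v = 0" using nilpotent_if_traces_0[OF \<rho>] by blast
  have "(R b ^^ j) n \<in> N \<and> (R b ^^ j) n = (\<rho> ^^ j) n" if "n \<in> N" for j n
    by (induction j) (auto simp: that \<rho>_def ideal_br[OF N(1)])
  then show ?thesis using k by auto
qed

text \<open>Such a \<open>z\<close> acts nilpotently on \<open>N\<close> and commutes with the
  semisimple action of \<open>S\<close>, so it acts as zero; then \<open>span {z}\<close> is an
  abelian ideal of \<open>S\<close> with trivial action.\<close>

lemma central_derived_0:
  assumes z: "z \<in> br_span S S" and central: "\<And>s. s \<in> S \<Longrightarrow> br z s = 0"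
  shows "z = 0"
proof -
  have zS: "z \<in> S" using z sideal_br_span_le[OF sideal_S] by blast
  have sz: "br s z = 0" if "s \<in> S" for s using S_anti[OF that zS] central[OF that] by simp
  obtain k where k: "\<And>n. n \<in> N \<Longrightarrow> (R z ^^ k) n = 0"
    using nilpotent_action[OF zS z] sz by blast
  have nz: "br n z = 0" if "n \<in> N" for n
  proof (rule nilpotent_central_0[OF br_lin(1) _ _ _ that])
    show "br (br n s) z = br (br n z) s" if "s \<in> S" for n s
      using sz[OF that] by (simp add: br_derivation[of n s z] br_simps)
  qed (use ideal_br k in blast)+
  show ?thesis
  proof (rule trivial_action_0[of "span {z}"])
    show "sideal (span {z})"
      unfolding sideal_def
    proof (intro conjI ballI subspace_span)
      show "span {z} \<subseteq> S" using zS sS by (intro span_minimal) simp_all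
      show "br b s \<in> span {z}" if "b \<in> span {z}" "s \<in> S" for b s
        using that central[OF that(2)] by (auto simp: span_singleton br_simps intro: range_eqI[of _ _ 0])
    qed
    show "abelian (span {z})" using central[OF zS] by (auto simp: abelian_iff span_singleton br_simps)
    show "z \<in> span {z}" by (simp add: span_base)
    show "br n b = 0" if "n \<in> N" "b \<in> span {z}" for n b
      using that nz by (auto simp: span_singleton br_simps)
  qed
qed

text \<open>The elements of \<open>[B, S]\<close> commute with \<open>B\<close> and so act
  nilpotently on \<open>N\<close>. By Engel's theorem they have a common null vector in every
  nonzero ideal inside \<open>N\<close>; hence a complement of their annihilator \<open>K\<close> is
  zero, and \<open>[B, S]\<close> acts trivially on \<open>N\<close> and vanishes.\<close>

lemma abelian_sideal_central:
  assumes B: "sideal B" "abelian B" and "b \<in> B" "s \<in> S"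
  shows "br b s = 0"
proof -
  define B' where "B' = br_span B S"
  have B': "sideal B'" unfolding B'_def by (rule sideal_br_span[OF B(1) sideal_S])
  have B'B: "B' \<subseteq> B" unfolding B'_def by (rule sideal_br_span_le[OF B(1)]) simp
  note BS = sidealD(2)[OF B(1)]
  have ab: "br x y = 0" if "x \<in> B" "y \<in> B" for x y using B(2) that by (simp add: abelian_iff)
  have ab': "abelian B'" using ab B'B by (auto simp: abelian_iff)
  define K where "K = {n \<in> N. \<forall>b\<in>B'. br n b = 0}"
  have "ideal K"
  proof (rule ideal_if_right_action)
    show "subspace K" unfolding K_def using sN by (auto simp: subspace_def br_simps)
    show "br n s \<in> K" if "n \<in> K" "s \<in> S" for n s
    proof -
      have "br (br n s) b = 0" if "b \<in> B'" for b
        using that \<open>n \<in> K\<close> \<open>s \<in> S\<close> sidealD(4)[OF B'] by (auto simp: br_derivation[of n s b] K_def br_simps)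
      then show ?thesis using that ideal_br[OF N(1)] by (auto simp: K_def)
    qed
    show "c \<in> K" if "i \<in> leibniz_kernel" "c \<in> kernel_compl" "i + c \<in> K" for i c
    proof -
      have "br c b = 0" if b: "b \<in> B'" for b
      proof -
        have "br i b = - br c b" using \<open>i + c \<in> K\<close> b by (simp add: K_def br_simps eq_neg_iff_add_eq_0)
        then have "br c b \<in> leibniz_kernel \<inter> kernel_compl"
          using br_leibniz_kernel_left[OF \<open>i \<in> leibniz_kernel\<close>, of b] ideal_br[OF kernel_compl(1) \<open>c \<in> kernel_compl\<close>]
            subspace_neg[OF subspace_leibniz_kernel, of "br i b"] by simp
        then show ?thesis using kernel_compl(3) by blast
      qed
      then show ?thesis using kernel_compl(2) \<open>c \<in> kernel_compl\<close> by (auto simp: K_def)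
    qed
  qed (auto simp: K_def)
  moreover have "K \<subseteq> N" by (auto simp: K_def)
  ultimately obtain D where D: "ideal D" "D \<subseteq> N" "K \<inter> D = {0}" "\<And>n. n \<in> N \<Longrightarrow> \<exists>a\<in>K. \<exists>c\<in>D. n = a + c"
    using complement[of K] by metis
  have "D = {0}"
  proof (rule ccontr)
    assume "D \<noteq> {0}"
    then have lt: "{0} \<subset> D" using subspace_0[OF ideal_subspace[OF D(1)]] by blast
    have "\<exists>w\<in>D - {0}. \<forall>h\<in>B'. br w h \<in> {0}"
    proof (rule engel[OF sidealD(5)[OF B'] _ _ _ _ lt])
      show "br h h = 0" if "h \<in> B'" for h using ab that B'B by blast
      show "\<exists>n. (R h ^^ n) v = 0" if h: "h \<in> B'" for h v
      proof -
        obtain k where k: "\<And>n. n \<in> N \<Longrightarrow> (R h ^^ k) n = 0"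
          using nilpotent_action[of h B S] h B'B BS ab unfolding B'_def by blast
        obtain n s where ns: "v = n + s" "n \<in> N" "s \<in> S" using split by blast
        \<comment> \<open>Engel's theorem is stated for nilpotency on all of \<open>L\<close>. Two
          steps kill the component in \<open>S\<close>, because \<open>[s, h]\<close> and
          \<open>h\<close> lie in the abelian \<open>B\<close>.\<close>
        have "br (br s h) h = 0" using sidealD(4)[OF B' h ns(3)] h ab B'B by blast
        then have "br (br v h) h = br (br n h) h" by (simp add: ns(1) br_simps)
        then have "(R h ^^ Suc (Suc k)) v = (R h ^^ k) (br (br n h) h)"
          by (simp only: funpow_Suc_right comp_apply)
        also have "\<dots> = 0" using k ideal_br[OF N(1)] ns(2) by blast
        finally show ?thesis by blast
      qed
    qed (auto simp: subspace_single_0 br_simps ideal_subspace D ideal_br)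
    then obtain w where "w \<in> D" "w \<noteq> 0" "\<And>h. h \<in> B' \<Longrightarrow> br w h = 0" by blast
    then have "w \<in> K \<inter> D" using D(2) by (auto simp: K_def)
    then show False using D(3) \<open>w \<noteq> 0\<close> by blast
  qed
  then have NK: "N \<subseteq> K" using D(4) by fastforce
  then have "br n b = 0" if "n \<in> N" "b \<in> B'" for n b using that by (auto simp: K_def)
  then have "x = 0" if "x \<in> B'" for x using trivial_action_0[OF B' ab' _ that] by blast
  moreover have "br b s \<in> B'" unfolding B'_def using assms(3,4) by (rule br_span_mem)
  ultimately show ?thesis by blast
qed

abbreviation S' :: "'a set" where "S' \<equiv> br_span S S"

lemma sideal_S': "sideal S'"
  by (rule sideal_br_span[OF sideal_S sideal_S])

lemma S'_S: "x \<in> S' \<Longrightarrow> x \<in> S"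
  using sidealD(2)[OF sideal_S'] by blast

text \<open>If \<open>J\<close> is not perfect, \<open>[J, J]\<close> is zero by induction and
  \<open>J\<close> is abelian. If it is perfect and nonzero, Cartan's criterion and Engel's theorem
  give it a nonzero centre. But an abelian ideal of \<open>S\<close> inside \<open>[S, S]\<close> is
  central and therefore zero.\<close>

lemma killing_0_sideal:
  assumes "sideal J" "J \<subseteq> S'" "\<And>x y. x \<in> J \<Longrightarrow> y \<in> J \<Longrightarrow> killing x y = 0"
  shows "J = {0}"
  using assms
proof (induction "dim J" arbitrary: J rule: less_induct)
  case less
  note J = less.prems(1)
  note sJ = sidealD(1)[OF J]
  have abelian_0: "Z = {0}" if Z: "sideal Z" "abelian Z" "Z \<subseteq> S'" for Z
  proof -
    have "z = 0" if "z \<in> Z" for z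
      using central_derived_0[of z] abelian_sideal_central[OF Z(1,2) that] Z(3) that by blast
    then show ?thesis using subspace_0[OF sidealD(1)[OF Z(1)]] by blast
  qed
  have dJ: "br_span J J \<subseteq> J" using sideal_br_span_le[OF J sidealD(2)[OF J]] .
  have sd: "sideal (br_span J J)" by (rule sideal_br_span[OF J J])
  show ?case
  proof (cases "br_span J J = J")
    case False
    have "dim (br_span J J) < dim J" by (rule dim_less[OF subspace_br_span sJ dJ False])
    then have "br_span J J = {0}"
      using sd dJ less.prems(2,3) by (intro less.hyps) blast+
    then show ?thesis using abelian_0[OF J _ less.prems(2)] by (simp add: abelian_def)
  next
    case True
    have nil: "\<exists>n. (R h ^^ n) v = 0" if "h \<in> J" for h v
      using cartan_criterion[OF sidealD(5)[OF J] _ less.prems(3) that] True by blast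
    show ?thesis
    proof (rule ccontr)
      assume "J \<noteq> {0}"
      have "br h h = 0" if "h \<in> J" for h
        using that sidealD(2)[OF J] S by (auto simp: lie_subalgebra_def)
      then obtain w where w: "w \<in> J" "w \<noteq> 0" "\<And>h. h \<in> J \<Longrightarrow> br w h = 0"
        using engel_center[OF sidealD(5)[OF J] _ nil \<open>J \<noteq> {0}\<close>] by blast
      define Z where "Z = {w \<in> J. \<forall>h\<in>J. br w h = 0}"
      have "sideal Z" unfolding sideal_def
      proof (intro conjI ballI)
        show "subspace Z" using sJ unfolding Z_def subspace_def by (auto simp: br_simps)
        show "Z \<subseteq> S" using sidealD(2)[OF J] by (auto simp: Z_def)
        fix z s assume z: "z \<in> Z" and s: "s \<in> S"
        have "br (br z s) h = 0" if "h \<in> J" for h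
          using that z sidealD(4)[OF J that s] by (auto simp: br_derivation[of z s h] Z_def br_simps)
        then show "br z s \<in> Z" using z sidealD(3)[OF J] s by (auto simp: Z_def)
      qed
      moreover have "abelian Z" by (auto simp: Z_def abelian_iff)
      moreover have "Z \<subseteq> S'" using less.prems(2) by (auto simp: Z_def)
      ultimately have "Z = {0}" by (rule abelian_0)
      then show False using w by (auto simp: Z_def)
    qed
  qed
qed

lemma killing_nondegenerate:
  assumes "x \<in> S'" "\<And>y. y \<in> S' \<Longrightarrow> killing x y = 0"
  shows "x = 0"
proof -
  define J where "J = {x \<in> S'. \<forall>y\<in>S'. killing x y = 0}"
  have "sideal J" unfolding sideal_def
  proof (intro conjI ballI)
    show "subspace J"
      using subspace_br_span[of S S] unfolding J_def subspace_def by (auto simp: killing_simps)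
    show "J \<subseteq> S" using S'_S by (auto simp: J_def)
    fix x s assume x: "x \<in> J" and s: "s \<in> S"
    have "killing (br x s) y = 0" if "y \<in> S'" for y
      using x sidealD(4)[OF sideal_S' that s] by (simp add: killing_invariant J_def)
    then show "br x s \<in> J" using x sidealD(3)[OF sideal_S' _ s] by (auto simp: J_def)
  qed
  then have "J = {0}" by (rule killing_0_sideal) (auto simp: J_def)
  then show ?thesis using assms by (auto simp: J_def)
qed

text \<open>Duality: \<open>T x\<close> encodes the functional \<open>killing x\<close> by its
  values on a basis of \<open>[S, S]\<close>. Nondegeneracy makes \<open>T\<close> injective on
  \<open>[S, S]\<close>, hence onto, so the vector encoding \<open>g\<close> is attained.\<close>

lemma killing_represent:
  assumes g: "\<And>x y. g (x + y) = g x + g y" "\<And>c x. g (scale c x) = c * g x"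
  obtains x where "x \<in> S'" "\<And>y. y \<in> S' \<Longrightarrow> killing x y = g y"
proof -
  interpret vp: finite_dimensional_vector_space_pair_1 scale Basis scale ..
  obtain B where B: "B \<subseteq> S'" "independent B" "S' \<subseteq> span B"
    using maximal_independent_subset[of S'] by metis
  have spB: "span B = S'" using B subspace_br_span by (metis span_subspace)
  have fB: "finite B" using B(2) by (rule finiteI_independent)
  define T where "T x = (\<Sum>b\<in>B. scale (killing x b) b)" for x
  have T: "lin T" unfolding T_def
    by (rule linI) (simp_all add: killing_simps scale_left_distrib sum.distrib scale_sum_right)
  have coeff: "\<forall>b\<in>B. c b = d b" if "(\<Sum>b\<in>B. scale (c b) b) = (\<Sum>b\<in>B. scale (d b) b)" for c d
  proof -
    have "(\<Sum>b\<in>B. scale (c b - d b) b) = 0"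
      using that by (simp add: scale_left_diff_distrib sum_subtractf)
    moreover have "(\<Sum>v\<in>B. scale (u v) v) = 0 \<longrightarrow> (\<forall>v\<in>B. u v = 0)" for u
      using B(2) fB unfolding independent_explicit_finite_subsets by blast
    from this[of "\<lambda>b. c b - d b"] calculation show ?thesis by simp
  qed
  have ext: "h y = k y" if hk: "\<And>b. b \<in> B \<Longrightarrow> h b = k b"
    "\<And>x y. h (x + y) = h x + h y" "\<And>c x. h (scale c x) = c * h x"
    "\<And>x y. k (x + y) = k x + k y" "\<And>c x. k (scale c x) = c * k x" and y: "y \<in> S'" for h k :: "'a \<Rightarrow> 'f" and y
    using y unfolding spB[symmetric]
  proof (induction rule: span_induct_alt)
    case base
    show ?case using hk(3)[of 0 0] hk(5)[of 0 0] by simp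
  qed (simp add: hk)
  have "inj_on T S'"
  proof (rule inj_onI)
    fix x y assume xy: "x \<in> S'" "y \<in> S'" "T x = T y"
    then have "T (x - y) = (\<Sum>b\<in>B. scale 0 b)" by (simp add: lin_simps[OF T])
    then have "killing (x - y) b = 0" if "b \<in> B" for b
      using coeff[of "killing (x - y)" "\<lambda>_. 0"] that unfolding T_def by blast
    then have "killing (x - y) z = 0" if "z \<in> S'" for z
      using ext[of "killing (x - y)" "\<lambda>_. 0"] that by (simp add: killing_simps)
    then have "x - y = 0"
      using subspace_diff[OF subspace_br_span xy(1,2)] by (intro killing_nondegenerate) auto
    then show "x = y" by simp
  qed
  then have "dim (T ` S') = dim S'"
    using vp.dim_image_eq[OF T, of S'] span_eq_iff subspace_br_span by metis
  moreover have "T ` S' \<subseteq> S'"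
    unfolding T_def using B(1) by (auto intro!: subspace_sum subspace_scale subspace_br_span)
  ultimately have "T ` S' = S'"
    by (intro subspace_dim_equal subspace_image[OF T] subspace_br_span) auto
  moreover have "(\<Sum>b\<in>B. scale (g b) b) \<in> S'"
    using B(1) by (intro subspace_sum subspace_scale subspace_br_span) auto
  ultimately have "(\<Sum>b\<in>B. scale (g b) b) \<in> T ` S'" by (simp only:)
  then obtain x where x: "x \<in> S'" "T x = (\<Sum>b\<in>B. scale (g b) b)" by (elim imageE) metis
  then have "killing x b = g b" if "b \<in> B" for b
    using coeff[of "killing x" g] that unfolding T_def by blast
  then have "killing x y = g y" if "y \<in> S'" for y
    using ext[of "killing x" g] that g by (simp add: killing_simps)
  then show thesis using that x(1) by blast
qed

text \<open>Let \<open>s'\<close> in \<open>[S, S]\<close> represent the same functional on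
  \<open>[S, S]\<close> as \<open>s\<close>. Then \<open>z = s - s'\<close> is orthogonal to
  \<open>[S, S]\<close>; by invariance so is \<open>[z, a]\<close>, which lies in
  \<open>[S, S]\<close> and hence vanishes.\<close>

lemma center_plus_derived:
  assumes "s \<in> S"
  obtains z s' where "s = z + s'" "s' \<in> S'" "z \<in> S" "\<And>a. a \<in> S \<Longrightarrow> br z a = 0" "\<And>a. a \<in> S \<Longrightarrow> br a z = 0"
proof -
  obtain s' where s': "s' \<in> S'" "\<And>y. y \<in> S' \<Longrightarrow> killing s' y = killing s y"
    by (rule killing_represent[of "killing s"]) (auto simp: killing_simps)
  define z where "z = s - s'"
  have zS: "z \<in> S" unfolding z_def using assms S'_S[OF s'(1)] by (rule subspace_diff[OF sS])
  have z: "killing z y = 0" if "y \<in> S'" for y using s'(2)[OF that] by (simp add: z_def killing_simps)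
  have za: "br z a = 0" if a: "a \<in> S" for a
  proof (rule killing_nondegenerate)
    show "br z a \<in> S'" by (rule br_span_mem[OF zS a])
    show "killing (br z a) w = 0" if "w \<in> S'" for w
      using z[OF sidealD(4)[OF sideal_S' that a]] by (simp add: killing_invariant)
  qed
  moreover have "br a z = 0" if "a \<in> S" for a using S_anti[OF that zS] za[OF that] by simp
  ultimately show thesis using that[of z s'] s'(1) zS by (simp add: z_def)
qed

text \<open>The semisimple part of a right multiplication by \<open>\<sigma> \<in> S\<close> is a derivation. On \<open>[S, S]\<close> it is
  inner as the trace form is nondegenerate there; the difference \<open>c\<close> to an inner derivation vanishes
  on \<open>N\<close> as the traces of its powers do.\<close>

lemma inner_semisimple:
  assumes \<sigma>: "\<sigma> \<in> S"
  obtains t u f w k where "t \<in> S" "u * pderiv f + w * f = 1" "\<And>v. pol f (R t) v = 0"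
    "\<And>v. ((R (\<sigma> - t)) ^^ k) v = 0" "\<And>v. br (br v t) \<sigma> = br (br v \<sigma>) t"
    "\<And>n v. ((R \<sigma>) ^^ n) v = 0 \<Longrightarrow> br v t = 0"
proof -
  let ?D = "R \<sigma>"
  note D = br_lin(1)[of \<sigma>]
  obtain u f w s k where uw: "u * pderiv f + w * f = 1" and f: "\<And>v. pol f (pol s ?D) v = 0"
    and k: "\<And>v. ((\<lambda>v. ?D v - pol s ?D v) ^^ k) v = 0"
    by (rule jordan_decomposition[OF D]) (rule that)
  define E where "E = pol s ?D"
  define M where "M = (\<lambda>v. ?D v - E v)"
  have E: "lin E" unfolding E_def by (rule lin_pol[OF D])
  have M: "lin M" unfolding M_def by (rule lin_diff[OF D E])
  have Mk: "(M ^^ k) v = 0" for v using k by (simp add: E_def M_def)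
  have DE: "E (?D v) = ?D (E v)" for v unfolding E_def by (rule pol_commute[OF D D, symmetric]) simp
  have der: "E (br b c) = br (E b) c + br b (E c)" for b c
    unfolding E_def by (rule derivation_semisimple_part[OF br_lin(2,1) D br_derivation uw f k])
  have E_pres: "E a \<in> A" if "subspace A" "\<And>a. a \<in> A \<Longrightarrow> br a \<sigma> \<in> A" "a \<in> A" for A a
    unfolding E_def using that by (intro pol_in_subspace[OF D])
  have E_ker: "E v = 0" if "(?D ^^ n) v = 0" for n v
    unfolding E_def using semisimple_part_ker[OF D uw f k that] .
  \<comment> \<open>\<open>s0\<close> makes \<open>e\<close>, the difference of \<open>E\<close> and
    right multiplication by \<open>s0\<close>, orthogonal to \<open>[S, S]\<close> in the trace
    form; being a derivation, \<open>e\<close> then vanishes on \<open>[S, S]\<close>.\<close>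
  obtain s0 where s0: "s0 \<in> S'" "\<And>y. y \<in> S' \<Longrightarrow> killing s0 y = trace (\<lambda>v. br (E v) y)"
    by (rule killing_represent[of "\<lambda>y. trace (\<lambda>v. br (E v) y)"]) (auto simp: br_simps trace_simps)
  note s0S = S'_S[OF s0(1)]
  define e where "e v = E v - br v s0" for v
  have e: "lin e" unfolding e_def by (rule lin_diff[OF E br_lin(1)])
  have e_der: "e (br b c) = br (e b) c + br b (e c)" for b c
    by (simp add: e_def der br_derivation[of b c s0] br_more)
  have e_tr: "trace (\<lambda>v. br (e v) y) = 0" if "y \<in> S'" for y
    using s0(2)[OF that] by (simp add: e_def br_more trace_simps killing_def)
  have e_S': "e y = 0" if y: "y \<in> S'" for y
  proof (rule killing_nondegenerate)
    show "e y \<in> S'"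
      unfolding e_def using sidealD(3)[OF sideal_S'] \<sigma> s0S y
      by (intro subspace_diff subspace_br_span E_pres) auto
    show "killing (e y) w' = 0" if w: "w' \<in> S'" for w'
    proof -
      have "br v (e y) = e (br v y) - br (e v) y" for v by (simp add: e_der)
      then have "killing (e y) w' = trace (\<lambda>v. br (e (br v y)) w') - trace (\<lambda>v. br (br (e v) y) w')"
        by (simp add: killing_def br_more trace_simps)
      also have "trace (\<lambda>v. br (e (br v y)) w') = trace (\<lambda>v. br (br (e v) w') y)"
        by (rule trace_commute[OF lin_compose[OF br_lin(1) e] br_lin(1)])
      also have "trace (\<lambda>v. br (br (e v) w') y) - trace (\<lambda>v. br (br (e v) y) w')
          = trace (\<lambda>v. br (e v) (br w' y))"
        by (simp add: leibniz trace_simps)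
      also have "\<dots> = 0" by (rule e_tr) (rule sidealD(3)[OF sideal_S' w S'_S[OF y]])
      finally show ?thesis .
    qed
  qed
  obtain z s1 where z: "\<sigma> = z + s1" "s1 \<in> S'" "z \<in> S" "\<And>a. a \<in> S \<Longrightarrow> br z a = 0"
    "\<And>a. a \<in> S \<Longrightarrow> br a z = 0" using center_plus_derived[OF \<sigma>] by blast
  have e_S: "e a = 0" if a: "a \<in> S" for a
  proof -
    obtain z' s2 where z': "a = z' + s2" "s2 \<in> S'" "\<And>a. a \<in> S \<Longrightarrow> br z' a = 0"
      using center_plus_derived[OF a] by metis
    have "E z' = 0" using E_ker[of 1 z'] z'(3)[OF \<sigma>] by simp
    then have "e z' = 0" using z'(3)[OF s0S] by (simp add: e_def)
    then show ?thesis using e_S'[OF z'(2)] by (simp add: z'(1) lin_simps[OF e])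
  qed
  \<comment> \<open>Removing right multiplication by the central part \<open>z\<close> of
    \<open>\<sigma>\<close> leaves \<open>c v = br v (s1 - s0) - M v\<close> with
    \<open>s1 - s0\<close> in \<open>[S, S]\<close> and \<open>M\<close> nilpotent. Neither term
    contributes to the traces of powers of \<open>c\<close> on \<open>N\<close>.\<close>
  define c where "c v = e v - br v z" for v
  have c: "lin c" unfolding c_def by (rule lin_diff[OF e br_lin(1)])
  have c_br: "c (br n a) = br (c n) a" if "a \<in> S" for n a
    using e_S[OF that] z(5)[OF that] by (simp add: c_def e_der br_more br_derivation[of n a z])
  have c_pres: "c n \<in> A" if "ideal A" "n \<in> A" for A n
    unfolding c_def e_def using that ideal_br
    by (intro subspace_diff ideal_subspace E_pres) auto
  define c' where "c' v = c (proj v)" for v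
  have c': "lin c'" unfolding c'_def by (rule lin_compose[OF c lin_proj])
  have c'_br: "c' (br v a) = br (c' v) a" if "a \<in> S" for v a
    using that by (simp add: c'_def proj_br c_br)
  have c'_N: "c' v \<in> N" for v unfolding c'_def by (rule c_pres[OF N(1)]) simp
  have cM: "c v = br v (s1 - s0) - M v" for v
    by (simp add: c_def e_def M_def z(1) br_more)
  have "trace (c' ^^ Suc j) = 0" for j
  proof -
    define Q where "Q v = proj ((c' ^^ j) v)" for v
    have Q: "lin Q" unfolding Q_def by (rule lin_compose[OF lin_proj lin_funpow[OF c']])
    have Q_br: "Q (br v a) = br (Q v) a" if "a \<in> S" for v a
    proof -
      have "(c' ^^ j) (br v a) = br ((c' ^^ j) v) a" using c'_br[OF that] by (induction j) simp_all
      then show ?thesis using that by (simp add: Q_def proj_br)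
    qed
    have "s1 - s0 \<in> S'" using z(2) s0(1) by (rule subspace_diff[OF subspace_br_span])
    from trace_commutator[OF Q _ this] Q_br have "trace (\<lambda>v. br (Q v) (s1 - s0)) = 0" by blast
    moreover have "M (Q v) = Q (M v)" for v
    proof -
      have "E (Q v) = Q (E v)" unfolding E_def
        using Q_br[OF \<sigma>] by (intro pol_commute[OF D Q, symmetric]) simp
      then show ?thesis using Q_br[OF \<sigma>] by (simp add: M_def lin_simps[OF Q])
    qed
    then have "trace (\<lambda>v. M (Q v)) = 0" by (rule trace_nilpotent_commute[OF M Q _ Mk])
    moreover have "c' ^^ Suc j = (\<lambda>v. br (Q v) (s1 - s0) - M (Q v))"
      by (auto simp: c'_def Q_def cM)
    ultimately show ?thesis by (simp only: trace_simps) simp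
  qed
  then obtain m where m: "\<And>v. (c' ^^ m) v = 0" using nilpotent_if_traces_0[OF c'] by blast
  have "(c ^^ j) n \<in> N \<and> (c ^^ j) n = (c' ^^ j) n" if "n \<in> N" for j n
    by (induction j) (auto simp: that c'_def c_pres[OF N(1)])
  then have "c n = 0" if "n \<in> N" for n
    using m that c_pres c_br by (intro nilpotent_central_0[OF c]) auto
  define t where "t = s0 + z"
  have Et: "E v = br v t" for v
  proof -
    obtain n a where na: "v = n + a" "n \<in> N" "a \<in> S" using split by blast
    have "E n = br n t" using \<open>\<And>n. n \<in> N \<Longrightarrow> c n = 0\<close>[OF na(2)] by (simp add: c_def e_def t_def br_simps algebra_simps)
    moreover have "E a = br a t" using e_S[OF na(3)] z(5)[OF na(3)] by (simp add: e_def t_def br_simps)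
    ultimately show ?thesis by (simp add: na(1) lin_simps[OF E] br_simps)
  qed
  then have E_eq: "E = (R t)" by blast
  show thesis
  proof (rule that[OF _ uw])
    show "t \<in> S" unfolding t_def using s0S z(3) by (rule subspace_add[OF sS])
    show "pol f (R t) v = 0" for v using f by (simp add: E_eq[symmetric] E_def)
    show "((R (\<sigma> - t)) ^^ k) v = 0" for v
      using Mk by (simp add: M_def E_eq br_more)
    show "br (br v t) \<sigma> = br (br v \<sigma>) t" for v using DE[of v] by (simp add: E_eq)
    show "br v t = 0" if "((R \<sigma>) ^^ n) v = 0" for n v
      using E_ker[OF that] by (simp add: E_eq)
  qed
qed

text \<open>The automorphism \<open>v \<mapsto> v + [v, b]\<close> moves an arbitrary \<open>x = a + \<sigma>\<close> to an element whose component
  in \<open>N\<close> commutes with the semisimple part of \<open>\<sigma>\<close>.\<close>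

lemma jordan_split:
  obtains s n u f w k where "x - (s + n) \<in> leibniz_kernel" "u * pderiv f + w * f = 1"
    "\<And>v. pol f (R s) v = 0" "\<And>v. (R n ^^ k) v = 0"
    "\<And>v. br (br v n) s = br (br v s) n"
proof -
  obtain a \<sigma> where x: "x = a + \<sigma>" "a \<in> N" "\<sigma> \<in> S" using split by blast
  let ?D = "R \<sigma>"
  note D = br_lin(1)[of \<sigma>]
  obtain t u f w k where t: "t \<in> S" and uw: "u * pderiv f + w * f = 1"
    and f: "\<And>v. pol f (R t) v = 0" and k: "\<And>v. ((R (\<sigma> - t)) ^^ k) v = 0"
    and comm: "\<And>v. br (br v t) \<sigma> = br (br v \<sigma>) t" and ker: "\<And>n v. (?D ^^ n) v = 0 \<Longrightarrow> br v t = 0"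
    by (rule inner_semisimple[OF x(3)]) (rule that)
  obtain r q where rq: "\<And>v. (?D ^^ r) (v - ?D (pol q ?D v)) = 0" by (rule fitting[OF D]) (rule that)
  \<comment> \<open>Fitting's decomposition \<open>a = a0 + [b, \<sigma>]\<close>, with
    \<open>a0\<close> in the null component of \<open>?D\<close>, where right multiplication by
    \<open>t\<close> vanishes.\<close>
  define b where "b = pol q ?D a"
  define a0 where "a0 = a - br b \<sigma>"
  have b: "b \<in> N" unfolding b_def using ideal_br[OF N(1)] x(2) by (intro pol_in_subspace[OF D sN]) auto
  have a0: "a0 \<in> N" unfolding a0_def using x(2) ideal_br[OF N(1) b] by (intro subspace_diff[OF sN])
  have a0t: "br a0 t = 0" using ker[OF rq[of a]] by (simp add: a0_def b_def)
  \<comment> \<open>The exponentials of right multiplication by \<open>b\<close> and by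
    \<open>-b\<close>, whose squares vanish as \<open>N\<close> is abelian. Modulo the Leibniz
    kernel \<open>[\<sigma>, b]\<close> is \<open>-[b, \<sigma>]\<close>, so there
    \<open>\<theta>\<close> cancels the summand \<open>[b, \<sigma>]\<close> of
    \<open>x\<close>.\<close>
  define \<theta> \<theta>' where "\<theta> v = v + br v b" and "\<theta>' v = v - br v b" for v
  have lin\<theta>: "lin \<theta>" "lin \<theta>'"
    unfolding \<theta>_def \<theta>'_def by (rule lin_add[OF lin_id br_lin(1)], rule lin_diff[OF lin_id br_lin(1)])
  have vb: "br v b \<in> N" for v using ideal_br(2)[OF N(1) b] .
  have bb: "br (br v b) b = 0" for v using N_br[OF vb b] .
  have inv: "\<theta>' (\<theta> v) = v" "\<theta> (\<theta>' v) = v" for v by (simp_all add: \<theta>_def \<theta>'_def br_more bb)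
  have hom: "\<theta>' (br v y) = br (\<theta>' v) (\<theta>' y)" for v y
    by (simp add: \<theta>'_def br_more N_br[OF vb vb] br_derivation[of v y b])
  define m where "m = \<sigma> - t + a0"
  define s n where "s = \<theta>' t" and "n = \<theta>' m"
  have conj: "br v (\<theta>' y) = \<theta>' (br (\<theta> v) y)" for v y by (simp add: hom inv)
  have R_eq: "(R m) = (\<lambda>v. br v (\<sigma> - t) + br v a0)" by (simp add: m_def br_simps)
  have mN: "br y m = br y (\<sigma> - t)" if "y \<in> N" for y using N_br[OF that a0] by (simp add: m_def br_simps)
  \<comment> \<open>\<open>k\<close> steps lead into \<open>N\<close>, since modulo \<open>N\<close>
    right multiplication by \<open>m\<close> agrees with that by \<open>\<sigma> - t\<close>;
    another \<open>k\<close> steps lead to 0, since \<open>a0\<close> acts as zero on the abelian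
    \<open>N\<close>.\<close>
  have m_nil: "(R m ^^ (k + k)) v = 0" for v
  proof -
    let ?B = "\<lambda>v. br v (\<sigma> - t)"
    have onN: "(R m ^^ j) y = (?B ^^ j) y \<and> (?B ^^ j) y \<in> N" if "y \<in> N" for j y
      by (induction j) (simp_all add: that mN ideal_br[OF N(1)])
    have "(R m ^^ j) v - (?B ^^ j) v \<in> N" for j
    proof (induction j)
      case (Suc j)
      let ?y = "(R m ^^ j) v"
      have "br ?y m - br ((?B ^^ j) v) (\<sigma> - t) = br (?y - (?B ^^ j) v) (\<sigma> - t) + br ?y a0"
        by (simp add: m_def br_more)
      moreover have "\<dots> \<in> N" using Suc ideal_br[OF N(1)] a0 by (intro subspace_add[OF sN]) auto
      ultimately show ?case by simp
    qed (simp add: subspace_0[OF sN])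
    from this[of k] have "(R m ^^ k) v \<in> N" using k by simp
    then show ?thesis using onN k by (simp add: funpow_add)
  qed
  have tm: "br (br v m) t = br (br v t) m" for v
  proof -
    have "br v (br a0 t) = 0" by (simp add: a0t br_simps)
    moreover have "br v (br \<sigma> t) = 0" using comm[of v] by (simp add: leibniz)
    moreover have "br t t = 0" using t S by (simp add: lie_subalgebra_def)
    ultimately have "br v (br m t) = 0" by (simp add: m_def br_more)
    then show ?thesis by (simp add: leibniz)
  qed
  show thesis
  proof (rule that[of s n u f w "k + k"])
    show "u * pderiv f + w * f = 1" by (rule uw)
    have "\<theta> x = t + m + (br b \<sigma> + br \<sigma> b)"
      using N_br[OF x(2) b] by (simp add: \<theta>_def x(1) m_def a0_def br_simps)
    then have "x = \<theta>' (t + m + (br b \<sigma> + br \<sigma> b))" using inv(1)[of x] by simp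
    then have "x - (s + n) = \<theta>' (br b \<sigma> + br \<sigma> b)" by (simp add: s_def n_def lin_simps[OF lin\<theta>(2)])
    then show "x - (s + n) \<in> leibniz_kernel"
      unfolding \<theta>'_def using br_anticomm_kernel br_leibniz_kernel_left
      by (simp add: subspace_diff[OF subspace_leibniz_kernel])
    show "pol f (R s) v = 0" for v
    proof -
      have "\<theta> (pol f (R s) v) = pol f (R t) (\<theta> v)"
        by (rule pol_intertwine[OF br_lin(1) br_lin(1) lin\<theta>(1)]) (simp add: s_def conj inv)
      then show ?thesis using inv(1)[of "pol f (R s) v"] f by (simp add: lin_simps[OF lin\<theta>(2)])
    qed
    show "(R n ^^ (k + k)) v = 0" for v
    proof -
      have "\<theta> ((R n ^^ (k + k)) v) = (R m ^^ (k + k)) (\<theta> v)"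
        by (rule funpow_intertwine) (simp add: n_def conj inv)
      then show ?thesis
        using inv(1)[of "(R n ^^ (k + k)) v"] m_nil by (simp add: lin_simps[OF lin\<theta>(2)])
    qed
    show "br (br v n) s = br (br v s) n" for v
      unfolding s_def n_def conj inv tm ..
  qed
qed

end

section \<open>The quotient by the Leibniz kernel\<close>

context fd_leibniz
begin

abbreviation adq :: "'a \<Rightarrow> 'a set \<Rightarrow> 'a set" where
  "adq x \<equiv> ad_on lie_quotient (kernel_coset x)"

lemma kernel_coset_eq_iff: "kernel_coset x = kernel_coset y \<longleftrightarrow> x - y \<in> leibniz_kernel"
proof
  assume "kernel_coset x = kernel_coset y"
  moreover have "x \<in> kernel_coset x"
    unfolding kernel_coset_def using subspace_0[OF subspace_leibniz_kernel] by force
  ultimately show "x - y \<in> leibniz_kernel" unfolding kernel_coset_def by auto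
next
  have sub: "kernel_coset x \<subseteq> kernel_coset y" if "x - y \<in> leibniz_kernel" for x y
  proof
    fix v assume "v \<in> kernel_coset x"
    then obtain i where "i \<in> leibniz_kernel" "v = y + ((x - y) + i)" by (auto simp: kernel_coset_def)
    then show "v \<in> kernel_coset y"
      unfolding kernel_coset_def using subspace_add[OF subspace_leibniz_kernel that] by blast
  qed
  assume *: "x - y \<in> leibniz_kernel"
  then have "y - x \<in> leibniz_kernel" using subspace_neg[OF subspace_leibniz_kernel] by fastforce
  then show "kernel_coset x = kernel_coset y" using sub * by blast
qed

lemma adq_apply: "adq x (kernel_coset y) = kernel_coset (- br y x)"
proof -
  have "kernel_coset y \<in> carr lie_quotient" by (simp add: lie_quotient_simps)
  then have "adq x (kernel_coset y) = kernel_coset (br x y)" by (simp add: ad_on_def lie_quotient_simps(5))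
  moreover have "br x y - - br y x \<in> leibniz_kernel" using br_anticomm_kernel by simp
  ultimately show ?thesis by (simp only: kernel_coset_eq_iff)
qed

lemma adq_endo: "adq x \<in> endos lie_quotient"
proof -
  have "adq x \<in> carr lie_quotient \<rightarrow>\<^sub>E carr lie_quotient"
    unfolding PiE_iff using adq_apply by (auto simp: lie_quotient_simps ad_on_def)
  then show ?thesis
    by (auto simp: endos_def lie_quotient_simps adq_apply br_more)
qed

text \<open>\<open>adq s\<close> is induced by the negative of right multiplication by
  \<open>s\<close>, so an invariant \<open>W\<close> pulls back to an invariant subspace
  \<open>V\<close> containing the Leibniz kernel. The image of an invariant complement of
  \<open>V\<close> is one of \<open>W\<close>.\<close>

lemma adq_semisimple:
  assumes uw: "u * pderiv f + w * f = 1" and f: "\<And>v. pol f (R s) v = 0"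
  shows "semisimple_endo lie_quotient (adq s)"
  unfolding semisimple_endo_def
proof (intro conjI allI impI adq_endo)
  fix W assume W: "subspace_on lie_quotient W \<and> adq s ` W \<subseteq> W"
  then have W1: "W \<subseteq> range kernel_coset" "kernel_coset 0 \<in> W"
    and W_add: "\<And>A B. A \<in> W \<Longrightarrow> B \<in> W \<Longrightarrow> vadd lie_quotient A B \<in> W"
    and W_scale: "\<And>c A. A \<in> W \<Longrightarrow> vscale lie_quotient c A \<in> W"
    and W_ad: "\<And>A. A \<in> W \<Longrightarrow> adq s A \<in> W"
    by (auto simp: subspace_on_def lie_quotient_simps)
  note W1 = W1 W_add[of "kernel_coset x" "kernel_coset y" for x y, unfolded lie_quotient_simps]
    W_scale[of "kernel_coset x" for x, unfolded lie_quotient_simps] W_ad[of "kernel_coset x" for x, unfolded adq_apply]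
  define V where "V = {v. kernel_coset v \<in> W}"
  have "subspace V" unfolding subspace_def V_def using W1 by auto
  moreover have "br v s \<in> V" if "v \<in> V" for v
    using that W1(4)[of "- br v s" "- 1"] W1(5)[of v] by (simp add: V_def)
  ultimately obtain C where C: "subspace C" "\<And>c. c \<in> C \<Longrightarrow> br c s \<in> C" "V \<inter> C = {0}"
    "\<And>v. \<exists>a\<in>V. \<exists>c\<in>C. v = a + c"
    by (rule separable_complement[OF br_lin(1) uw f]) (assumption, rule that)
  show "\<exists>W'. subspace_on lie_quotient W' \<and> adq s ` W' \<subseteq> W' \<and> W \<inter> W' = {vzero lie_quotient} \<and>
      carr lie_quotient = {vadd lie_quotient w w' | w w'. w \<in> W \<and> w' \<in> W'}"
  proof (intro exI[of _ "kernel_coset ` C"] conjI)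
    show "subspace_on lie_quotient (kernel_coset ` C)"
      using C(1) by (auto simp: subspace_on_def lie_quotient_simps subspace_0
          intro!: imageI subspace_add subspace_scale)
    show "adq s ` kernel_coset ` C \<subseteq> kernel_coset ` C"
      using C(1,2) by (auto simp: adq_apply intro!: imageI subspace_neg)
    show "W \<inter> kernel_coset ` C = {vzero lie_quotient}"
    proof
      show "W \<inter> kernel_coset ` C \<subseteq> {vzero lie_quotient}"
      proof
        fix A assume "A \<in> W \<inter> kernel_coset ` C"
        then obtain c where c: "A = kernel_coset c" "c \<in> C" "c \<in> V" by (auto simp: V_def)
        then have "c = 0" using C(3) by blast
        then show "A \<in> {vzero lie_quotient}" by (simp add: c(1) lie_quotient_simps)
      qed
      show "{vzero lie_quotient} \<subseteq> W \<inter> kernel_coset ` C"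
        using W1(2) subspace_0[OF C(1)] by (auto simp: lie_quotient_simps)
    qed
    show "carr lie_quotient = {vadd lie_quotient w w' | w w'. w \<in> W \<and> w' \<in> kernel_coset ` C}" (is "_ = ?X")
    proof
      show "carr lie_quotient \<subseteq> ?X"
      proof
        fix A assume "A \<in> carr lie_quotient"
        then obtain v where v: "A = kernel_coset v" by (auto simp: lie_quotient_simps)
        obtain a c where "a \<in> V" "c \<in> C" "v = a + c" using C(4) by blast
        then have "A = vadd lie_quotient (kernel_coset a) (kernel_coset c)"
          "kernel_coset a \<in> W" "kernel_coset c \<in> kernel_coset ` C"
          by (simp_all add: v V_def lie_quotient_simps)
        then show "A \<in> ?X" by blast
      qed
      show "?X \<subseteq> carr lie_quotient"
        using W1(1) by (auto simp: lie_quotient_simps(1) dest!: subsetD)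
          (metis lie_quotient_simps(3) rangeI)
    qed
  qed
qed

lemma adq_nilpotent:
  assumes "\<And>v. (R n ^^ k) v = 0"
  shows "nilpotent_endo lie_quotient (adq n)"
proof -
  have "(adq n ^^ j) (kernel_coset v) = kernel_coset (((\<lambda>v. - br v n) ^^ j) v)" for j v
    by (induction j) (simp_all add: adq_apply)
  then have "(adq n ^^ k) (kernel_coset v) = kernel_coset 0" for v
    using assms funpow_uminus[OF br_lin(1)[of n], of k v] by simp
  then show ?thesis
    unfolding nilpotent_endo_def using adq_endo
    by (auto simp: lie_quotient_simps intro!: exI[of _ k])
qed

lemma phi_free_almost_algebraic:
  assumes phi_free shows almost_algebraic
proof -
  obtain S where "split_leibniz scale br Basis nilradical S" using phi_free_split[OF assms] by blast
  then interpret split_leibniz scale br Basis nilradical S .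
  have "\<exists>T\<in>ad_on lie_quotient ` carr lie_quotient. \<exists>M\<in>ad_on lie_quotient ` carr lie_quotient.
      jordan_components lie_quotient (adq x) T M" for x
  proof -
    obtain s n u f w k where x: "x - (s + n) \<in> leibniz_kernel" and uw: "u * pderiv f + w * f = 1"
      and f: "\<And>v. pol f (R s) v = 0" and k: "\<And>v. (R n ^^ k) v = 0"
      and comm: "\<And>v. br (br v n) s = br (br v s) n"
      by (rule jordan_split[of x]) (rule that)
    have "br y x = br y s + br y n" for y
      using br_leibniz_kernel_right[OF x, of y] by (simp add: br_more algebra_simps)
    then have "jordan_components lie_quotient (adq x) (adq s) (adq n)"
      unfolding jordan_components_def
      using adq_semisimple[OF uw f] adq_nilpotent[OF k]
      by (auto simp: lie_quotient_simps adq_apply br_more comm)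
    then show ?thesis by (auto simp: lie_quotient_simps)
  qed
  then show ?thesis
    by (auto simp: almost_algebraic_def almost_algebraic_lie_def almost_algebraic_linear_def lie_quotient_simps)
qed

end

theorem theorem2p3:
  fixes scale :: "'f::field_char_0 \<Rightarrow> 'a::ab_group_add \<Rightarrow> 'a"
    and br :: "'a \<Rightarrow> 'a \<Rightarrow> 'a"
    and Basis :: "'a set"
  assumes "leibniz_algebra scale br"
    and "finite_dimensional_vector_space scale Basis"
  shows "(leibniz_algebra.phi_free scale br \<longrightarrow>
            leibniz_algebra.almost_reductive scale br \<and> leibniz_algebra.almost_algebraic scale br)
       \<and> (leibniz_algebra.almost_reductive scale br \<longrightarrow>
            (leibniz_algebra.phi_free scale br \<longleftrightarrow>
             leibniz_algebra.abelian scale br (leibniz_algebra.nilradical scale br)))"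
proof -
  interpret fd_leibniz scale br Basis using assms by (rule fd_leibniz.intro)
  show ?thesis
    using phi_free_almost_reductive phi_free_almost_algebraic phi_free_imp_nilradical_abelian
      almost_reductive_phi_free by blast
qed

end
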